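(* Let $G$ be a Lie group with finitely many connected components, $K\subseteq G$ a maximal compact subgroup, and $V$ a finite-dimensional smooth representation of $G$. Let $$\mathrm{VE}_{G/K}=\mathsf p\circ(1+\mathsf d\mathsf h)^{-1}\circ\mathsf j\colon \mathsf C^\bullet(G,V)\to \mathsf C^\bullet(\mathfrak g,V)_{K\text{-basic}},\qquad R_{G/K}=\mathsf q\circ(1+\delta\mathsf k)^{-1}\circ\mathsf i\colon \mathsf C^\bullet(\mathfrak g,V)_{K\text{-basic}}\to \mathsf C^\bullet(G,V)$$ be the van Est differentiation and integration maps defined in the context. Then $R_{G/K}$ is a right inverse to $\mathrm{VE}_{G/K}$ at the level of cochains: $\mathrm{VE}_{G/K}\circ R_{G/K}=\mathrm{id}$ on $\mathsf C^\bullet(\mathfrak g,V)_{K\text{-basic}}$.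
   Context: Lie group complex: $\mathsf C^p(G,V)=C^\infty(G^p,V)$ with $(\delta f)(g_1,\ldots,g_{p+1})=f(g_2,\ldots,g_{p+1})+\sum_{i=1}^p(-1)^i f(g_1,\ldots,g_ig_{i+1},\ldots,g_{p+1})+(-1)^{p+1}g_{p+1}^{-1}\cdot f(g_1,\ldots,g_p)$. Lie algebra complex: $\mathsf C^q(\mathfrak g,V)=V\otimes\wedge^q\mathfrak g^*$ with the Chevalley-Eilenberg differential $\mathsf d_{CE}$; $\mathsf C(\mathfrak g,V)_{K\text{-basic}}$ is the subcomplex of $K$-invariant elements (given action on $V$, coadjoint action on $\wedge\mathfrak g^*$) annihilated by contractions with $\mathfrak k=\mathrm{Lie}(K)$. Double complex: $\mathsf D^{p,q}(G,V)=C^\infty(G^p\times G,V\otimes\wedge^q\mathfrak g^* )$, with $(\delta\psi)(g_1,\ldots,g_{p+1};g)=\psi(g_2,\ldots,g_{p+1};g)+\sum_{i=1}^p(-1)^i\psi(g_1,\ldots,g_ig_{i+1},\ldots,g_{p+1};g)+(-1)^{p+1}\psi(g_1,\ldots,g_p;g_{p+1}g)$, and $\mathsf d=(-1)^p\mathsf d_{CE}$, where $\mathsf d_{CE}$ is the Chevalley-Eilenberg differential for the $\mathfrak g$-representation on $C^\infty(G^p\times G)\otimes V$ given by left-invariant vector fields on the last factor $G$ together with the representation on $V$. $\mathsf D(G,V)_{K\text{-basic}}$ consists of the $\psi$ annihilated by contractions with $\mathfrak k$ and $K$-invariant for $(a\cdot\psi)(g_1,\ldots,g_p;g)=a\cdot\psi(g_1,\ldots,g_p;ga)$.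 Maps for differentiation: $(\mathsf jf)(g_1,\ldots,g_p;g)=g^{-1}\cdot f(g_1,\ldots,g_p)$. With $dk$ the normalized Haar measure on $K$: $(\mathsf h\psi)(g_1,\ldots,g_{p-1};g)=(-1)^p\int_K\psi(g_1,\ldots,g_{p-1},gk^{-1};k)\,dk$ for $\psi$ of bidegree $(p,q)$, $p>0$, and $\mathsf h=0$ on bidegree $(0,q)$; $\mathsf p(\psi)=\int_K\psi(k)\,dk$ on bidegree $(0,q)$ and $\mathsf p=0$ on bidegree $(p,q)$, $p>0$. Differential form picture: $\psi\in\mathsf D^{p,q}(G,V)_{K\text{-basic}}$ is identified with a smooth family $\beta\colon G^p\to\Omega^q(G/K,V)$; the pullback of $\beta(g_1,\ldots,g_p)$ to $G$ has at $g\in G$ the value $g\cdot\psi(g_1,\ldots,g_p;g)$, where $T_gG\cong\mathfrak g$ by left translation and $g$ acts on the $V$-factor. Then $\mathsf d$ becomes $(-1)^p$ times the de Rham differential. The map $\mathsf i\colon \mathsf C^q(\mathfrak g,V)_{K\text{-basic}}\to\mathsf D^{0,q}(G,V)_{K\text{-basic}}$ is the inclusion of constant functions $\psi$. Maps for integration: fix a diffeomorphism $G/K\cong\mathfrak g/\mathfrak k$ taking $eK$ to $0$ (one exists since $K$ is maximal compact), and let $\lambda\colon[0,1]\times G/K\to G/K$, $(t,x)\mapsto\lambda_t(x)$, correspond to scalar multiplication by $t$ on $\mathfrak g/\mathfrak k$. Let $T\colon\Omega^q(G/K,V)\to\Omega^{q-1}(G/K,V)$ be the de Rham homotopy operator $T\beta=\int_0^1\iota_{\partial_t}(\lambda^*\beta)\,dt$.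 Put $(\mathsf k\beta)(g_1,\ldots,g_p)=(-1)^pT(\beta(g_1,\ldots,g_p))$. For $\beta$ of bidegree $(p,0)$, $(\mathsf q\beta)(g_1,\ldots,g_p)=\beta(g_1,\ldots,g_p)|_{eK}\in V$, and $\mathsf q=0$ on bidegree $(p,q)$ with $q>0$. On degree $p$ elements, $\mathrm{VE}_{G/K}=(-1)^p\mathsf p(\mathsf d\mathsf h)^p\mathsf j$ and $R_{G/K}=(-1)^p\mathsf q(\delta\mathsf k)^p\mathsf i$. *)

theory Defs
  imports "HOL-Analysis.Analysis" "HOL-Algebra.Left_Coset"
begin

text \<open>
  Finite-dimensional real vector spaces. Unlike \<^class>\<open>euclidean_space\<close>, dimension zero is
  allowed (needed for \<open>\<gg>/\<kk>\<close> when \<open>G\<close> is compact, for discrete groups, and for \<open>V = 0\<close>). Every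
  finite-dimensional real vector space carries an inner product; it only serves to provide the
  topology.
\<close>

class fin_dim_space = real_inner + banach + second_countable_topology +
  assumes finite_spanning_set: "\<exists>B. finite B \<and> (\<forall>x. \<exists>c. x = (\<Sum>b\<in>B. c b *\<^sub>R b))"

instance euclidean_space \<subseteq> fin_dim_space
proof
  show "\<exists>B::'a set. finite B \<and> (\<forall>x. \<exists>c. x = (\<Sum>b\<in>B. c b *\<^sub>R b))"
    by (metis finite_Basis euclidean_representation)
qed

section \<open>Smooth maps\<close>

text \<open>
  A chart is a domain together with a coordinate map; values of the coordinate map outside the
  domain are irrelevant. Points of the power \<open>M\<^sup>n\<close> are lists of length \<open>n\<close>; coordinates on \<open>M\<^sup>n\<close>
  are functions \<open>x :: nat \<Rightarrow> 'e\<close>, of which only \<open>x 0, \<dots>, x (n - 1)\<close> matter.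
\<close>

type_synonym ('m, 'e) chart = "'m set \<times> ('m \<Rightarrow> 'e)"

definition chart_inv :: "('m, 'e) chart \<Rightarrow> 'e \<Rightarrow> 'm"
  where "chart_inv c = inv_into (fst c) (snd c)"

definition chart_image :: "('m, 'e) chart \<Rightarrow> 'e set"
  where "chart_image c = snd c ` fst c"

text \<open>
  \<open>Ck n m S f\<close>: all iterated partial derivatives of \<open>f\<close> of order at most \<open>m\<close>, in the variables
  \<open>x 0, \<dots>, x (n - 1)\<close>, exist and are continuous on \<open>S\<close>.
\<close>

primrec Ck :: "nat \<Rightarrow> nat \<Rightarrow> (nat \<Rightarrow> 'e) set \<Rightarrow> ((nat \<Rightarrow> 'e::fin_dim_space) \<Rightarrow> 'f::fin_dim_space) \<Rightarrow> bool"
  where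
    "Ck n 0 S f \<longleftrightarrow> continuous_on S f"
  | "Ck n (Suc m) S f \<longleftrightarrow> continuous_on S f \<and>
      (\<forall>i<n. \<forall>v. \<exists>f'.
        (\<forall>x\<in>S. ((\<lambda>t. f (x(i := x i + t *\<^sub>R v))) has_vector_derivative f' x) (at 0)) \<and> Ck n m S f')"

definition C_infinity :: "nat \<Rightarrow> (nat \<Rightarrow> 'e) set \<Rightarrow> ((nat \<Rightarrow> 'e::fin_dim_space) \<Rightarrow> 'f::fin_dim_space) \<Rightarrow> bool"
  where "C_infinity n S f \<longleftrightarrow> (\<forall>m. Ck n m S f)"

definition smooth_atlas ::
    "('m::{t2_space, second_countable_topology}, 'e::fin_dim_space) chart set \<Rightarrow> bool"
  where "smooth_atlas A \<longleftrightarrow>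
    \<Union>(fst ` A) = UNIV \<and>
    (\<forall>c\<in>A. open (fst c) \<and> open (chart_image c) \<and>
      homeomorphism (fst c) (chart_image c) (snd c) (chart_inv c)) \<and>
    (\<forall>c\<in>A. \<forall>c'\<in>A.
      C_infinity 1 {x. x 0 \<in> snd c ` (fst c \<inter> fst c')} (\<lambda>x. snd c' (chart_inv c (x 0))))"

text \<open>
  Smoothness of \<open>F : M\<^sup>n \<rightarrow> N\<close> with respect to atlases \<open>A\<close> of \<open>M\<close> and \<open>B\<close> of \<open>N\<close>. Openness of
  the coordinate domain \<open>S\<close> expresses continuity of \<open>F\<close>.
\<close>

definition smooth_map ::
    "('m, 'e::fin_dim_space) chart set \<Rightarrow> ('n, 'f::fin_dim_space) chart set \<Rightarrow> nat \<Rightarrow> ('m list \<Rightarrow> 'n) \<Rightarrow> bool"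
  where "smooth_map A B n F \<longleftrightarrow>
    (\<forall>cs c. (\<forall>i<n. cs i \<in> A) \<and> c \<in> B \<longrightarrow>
      (let f = (\<lambda>x. F (map (\<lambda>i. chart_inv (cs i) (x i)) [0..<n]));
           S = {x. (\<forall>i<n. x i \<in> chart_image (cs i)) \<and> f x \<in> fst c}
       in open S \<and> C_infinity n S (\<lambda>x. snd c (f x))))"

definition vector_atlas :: "('f, 'f) chart set"
  where "vector_atlas = {(UNIV, \<lambda>x. x)}"

section \<open>Lie groups, subgroups and representations\<close>

record ('g, 'e) smooth_group = "'g monoid" +
  charts :: "('g, 'e) chart set"

locale lie_group = group G
  for G :: "('g::{t2_space, second_countable_topology}, 'e::fin_dim_space) smooth_group" (structure) +
  assumes carrier_UNIV: "carrier G = UNIV"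
    and atlas: "smooth_atlas (charts G)"
    and smooth_mult: "smooth_map (charts G) (charts G) 2 (\<lambda>gs. gs ! 0 \<otimes> gs ! 1)"
    and smooth_inv: "smooth_map (charts G) (charts G) 1 (\<lambda>gs. inv (gs ! 0))"

text \<open>
  The Lie algebra \<open>\<gg> = T\<^sub>eG\<close> is identified with the model space \<open>'e\<close> by means of a chart around
  the unit. \<open>tangent_curve G X\<close> is a curve through the unit with velocity \<open>X\<close>, defined for
  small times.
\<close>

definition unit_chart :: "('g, 'e) smooth_group \<Rightarrow> ('g, 'e) chart"
  where "unit_chart G = (SOME c. c \<in> charts G \<and> \<one>\<^bsub>G\<^esub> \<in> fst c)"

definition tangent_curve :: "('g, 'e::fin_dim_space) smooth_group \<Rightarrow> 'e \<Rightarrow> real \<Rightarrow> 'g"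
  where "tangent_curve G X t = chart_inv (unit_chart G) (snd (unit_chart G) \<one>\<^bsub>G\<^esub> + t *\<^sub>R X)"

text \<open>
  \<open>left_deriv G F g X\<close> is the differential of \<open>F\<close> at \<open>g\<close> applied to \<open>X \<in> \<gg> \<cong> T\<^sub>gG\<close>, the
  isomorphism being left translation; equivalently, the left-invariant vector field of \<open>X\<close>
  applied to \<open>F\<close> at \<open>g\<close>.
\<close>

definition left_deriv ::
    "('g, 'e::fin_dim_space) smooth_group \<Rightarrow> ('g \<Rightarrow> 'f::real_normed_vector) \<Rightarrow> 'g \<Rightarrow> 'e \<Rightarrow> 'f"
  where "left_deriv G F g X = vector_derivative (\<lambda>t. F (g \<otimes>\<^bsub>G\<^esub> tangent_curve G X t)) (at 0)"

text \<open>
  The value at the unit of the commutator of left-invariant vector fields, in the coordinates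
  of \<open>unit_chart G\<close>: \<open>[X, Y]\<^sup>i = X(Y\<^sup>i) - Y(X\<^sup>i)\<close>, where \<open>Y\<^sup>i\<close> is \<open>Y\<close> applied to the \<open>i\<close>-th
  coordinate function.
\<close>

definition lie_bracket :: "('g, 'e::fin_dim_space) smooth_group \<Rightarrow> 'e \<Rightarrow> 'e \<Rightarrow> 'e"
  where "lie_bracket G X Y =
    left_deriv G (\<lambda>g. left_deriv G (snd (unit_chart G)) g Y) \<one>\<^bsub>G\<^esub> X -
    left_deriv G (\<lambda>g. left_deriv G (snd (unit_chart G)) g X) \<one>\<^bsub>G\<^esub> Y"

definition Ad :: "('g, 'e::fin_dim_space) smooth_group \<Rightarrow> 'g \<Rightarrow> 'e \<Rightarrow> 'e"
  where "Ad G a X = vector_derivative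
    (\<lambda>t. snd (unit_chart G) (a \<otimes>\<^bsub>G\<^esub> tangent_curve G X t \<otimes>\<^bsub>G\<^esub> inv\<^bsub>G\<^esub> a)) (at 0)"

text \<open>The Lie algebra of a closed subgroup: velocities of its one-parameter subgroups.\<close>

definition lie_subalgebra ::
    "('g::topological_space, 'e::fin_dim_space) smooth_group \<Rightarrow> 'g set \<Rightarrow> 'e set"
  where "lie_subalgebra G K =
    {X. \<exists>\<gamma>. continuous_on UNIV \<gamma> \<and> (\<forall>t. \<gamma> t \<in> K) \<and> (\<forall>s t. \<gamma> (s + t) = \<gamma> s \<otimes>\<^bsub>G\<^esub> \<gamma> t) \<and>
        ((\<lambda>t::real. snd (unit_chart G) (\<gamma> t)) has_vector_derivative X) (at 0)}"

definition maximal_compact_subgroup ::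
    "('g::topological_space, 'e) smooth_group \<Rightarrow> 'g set \<Rightarrow> bool"
  where "maximal_compact_subgroup G K \<longleftrightarrow>
    subgroup K G \<and> compact K \<and> (\<forall>L. subgroup L G \<and> compact L \<and> K \<subseteq> L \<longrightarrow> L = K)"

definition smooth_representation ::
    "('g, 'e::fin_dim_space) smooth_group \<Rightarrow> ('g \<Rightarrow> 'v \<Rightarrow> 'v::fin_dim_space) \<Rightarrow> bool"
  where "smooth_representation G \<rho> \<longleftrightarrow>
    (\<forall>g. linear (\<rho> g)) \<and> (\<forall>v. \<rho> \<one>\<^bsub>G\<^esub> v = v) \<and> (\<forall>g h v. \<rho> (g \<otimes>\<^bsub>G\<^esub> h) v = \<rho> g (\<rho> h v)) \<and>
    (\<forall>v. smooth_map (charts G) vector_atlas 1 (\<lambda>gs. \<rho> (gs ! 0) v))"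

definition normalized_Haar_measure ::
    "('g::topological_space, 'e) smooth_group \<Rightarrow> 'g set \<Rightarrow> 'g measure \<Rightarrow> bool"
  where "normalized_Haar_measure G K \<mu> \<longleftrightarrow>
    emeasure \<mu> K = 1 \<and> sets \<mu> = sets (restrict_space borel K) \<and>
    (\<forall>a\<in>K. distr \<mu> \<mu> (\<lambda>k. a \<otimes>\<^bsub>G\<^esub> k) = \<mu>)"

text \<open>\<open>pr\<close> exhibits the vector space \<open>'w\<close> as the quotient \<open>\<gg>/\<kk>\<close>.\<close>

definition quotient_projection ::
    "('g::topological_space, 'e::fin_dim_space) smooth_group \<Rightarrow> 'g set \<Rightarrow> ('e \<Rightarrow> 'w::fin_dim_space) \<Rightarrow> bool"
  where "quotient_projection G K pr \<longleftrightarrow>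
    linear pr \<and> surj pr \<and> {X. pr X = 0} = lie_subalgebra G K"

text \<open>
  \<open>G/K\<close> is the set of left cosets, with the unique smooth structure for which \<open>G \<rightarrow> G/K\<close> is a
  submersion. A bijection \<open>\<Phi>\<close> of \<open>G/K\<close> onto a vector space is a diffeomorphism iff its pullback
  to \<open>G\<close>, given by \<open>lift_to_group\<close>, is a smooth submersion.
\<close>

definition lift_to_group :: "('g, 'e) smooth_group \<Rightarrow> 'g set \<Rightarrow> ('g set \<Rightarrow> 'w) \<Rightarrow> 'g \<Rightarrow> 'w"
  where "lift_to_group G K \<Phi> g = \<Phi> (g <#\<^bsub>G\<^esub> K)"

definition homogeneous_space_diffeo ::
    "('g, 'e::fin_dim_space) smooth_group \<Rightarrow> 'g set \<Rightarrow> ('g set \<Rightarrow> 'w::fin_dim_space) \<Rightarrow> bool"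
  where "homogeneous_space_diffeo G K \<Phi> \<longleftrightarrow>
    bij_betw \<Phi> (lcosets\<^bsub>G\<^esub> K) UNIV \<and>
    smooth_map (charts G) vector_atlas 1 (\<lambda>gs. lift_to_group G K \<Phi> (gs ! 0)) \<and>
    (\<forall>g. surj (left_deriv G (lift_to_group G K \<Phi>) g))"

section \<open>The complexes\<close>

text \<open>
  Elements of \<open>V \<otimes> \<Lambda>\<^sup>q\<gg>*\<close> are alternating \<open>q\<close>-linear maps \<open>\<gg>\<^sup>q \<rightarrow> V\<close>. Arguments from \<open>G\<^sup>p\<close> and
  \<open>\<gg>\<^sup>q\<close> are lists of length \<open>p\<close> and \<open>q\<close>, and an element of the direct sum over all degrees is one
  function on lists of arbitrary length, its components being the restrictions to lists of fixed
  length. Accordingly the operators below read \<open>p\<close> and \<open>q\<close> off the lengths of their arguments.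
\<close>

definition alternating_multilinear :: "('e::real_vector list \<Rightarrow> 'v::real_vector) \<Rightarrow> bool"
  where "alternating_multilinear \<alpha> \<longleftrightarrow>
    (\<forall>Xs. \<forall>i<length Xs. linear (\<lambda>X. \<alpha> (Xs[i := X]))) \<and>
    (\<forall>Xs. \<not> distinct Xs \<longrightarrow> \<alpha> Xs = 0)"

text \<open>\<open>C\<^sup>\<bullet>(G,V)\<close>\<close>

definition group_cochains ::
    "('g, 'e::fin_dim_space) smooth_group \<Rightarrow> ('g list \<Rightarrow> 'v::fin_dim_space) set"
  where "group_cochains G =
    {f. (\<exists>N. \<forall>gs. N < length gs \<longrightarrow> f gs = 0) \<and>
        (\<forall>p. smooth_map (charts G) vector_atlas p f)}"

text \<open>\<open>C\<^sup>\<bullet>(\<gg>,V)\<close>, \<open>K\<close>-basic part\<close>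

definition lie_cochains_basic ::
    "('g::topological_space, 'e::fin_dim_space) smooth_group \<Rightarrow> ('g \<Rightarrow> 'v \<Rightarrow> 'v) \<Rightarrow> 'g set \<Rightarrow>
      ('e list \<Rightarrow> 'v::fin_dim_space) set"
  where "lie_cochains_basic G \<rho> K =
    {\<alpha>. (\<exists>N. \<forall>Xs. N < length Xs \<longrightarrow> \<alpha> Xs = 0) \<and>
        alternating_multilinear \<alpha> \<and>
        (\<forall>X\<in>lie_subalgebra G K. \<forall>Xs. \<alpha> (X # Xs) = 0) \<and>
        (\<forall>a\<in>K. \<forall>Xs. \<rho> a (\<alpha> (map (Ad G (inv\<^bsub>G\<^esub> a)) Xs)) = \<alpha> Xs)}"

text \<open>
  \<open>D(G,V)\<close>, \<open>K\<close>-basic part. The value \<open>\<psi>(g\<^sub>1,\<dots>,g\<^sub>p;g)(X\<^sub>1,\<dots>,X\<^sub>q)\<close> is written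
  \<open>\<psi> [g\<^sub>1,\<dots>,g\<^sub>p] g [X\<^sub>1,\<dots>,X\<^sub>q]\<close>.
\<close>

type_synonym ('g, 'e, 'v) double_cochain = "'g list \<Rightarrow> 'g \<Rightarrow> 'e list \<Rightarrow> 'v"

definition double_cochains_basic ::
    "('g::topological_space, 'e::fin_dim_space) smooth_group \<Rightarrow> ('g \<Rightarrow> 'v \<Rightarrow> 'v) \<Rightarrow> 'g set \<Rightarrow>
      ('g, 'e, 'v::fin_dim_space) double_cochain set"
  where "double_cochains_basic G \<rho> K =
    {\<psi>. (\<exists>N. \<forall>gs g Xs. N < length gs + length Xs \<longrightarrow> \<psi> gs g Xs = 0) \<and>
        (\<forall>gs g. alternating_multilinear (\<psi> gs g)) \<and>
        (\<forall>p Xs. smooth_map (charts G) vector_atlas (p + 1) (\<lambda>hs. \<psi> (butlast hs) (last hs) Xs)) \<and>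
        (\<forall>X\<in>lie_subalgebra G K. \<forall>gs g Xs. \<psi> gs g (X # Xs) = 0) \<and>
        (\<forall>a\<in>K. \<forall>gs g Xs.
          \<rho> a (\<psi> gs (g \<otimes>\<^bsub>G\<^esub> a) (map (Ad G (inv\<^bsub>G\<^esub> a)) Xs)) = \<psi> gs g Xs)}"

text \<open>\<open>(g\<^sub>1,\<dots>,g\<^sub>i g\<^sub>i\<^sub>+\<^sub>1,\<dots>)\<close>, with \<open>i\<close> counted from 1\<close>

definition merge_at :: "('g, 'e) smooth_group \<Rightarrow> nat \<Rightarrow> 'g list \<Rightarrow> 'g list"
  where "merge_at G i gs = take (i - 1) gs @ [gs ! (i - 1) \<otimes>\<^bsub>G\<^esub> gs ! i] @ drop (i + 1) gs"

definition delta_op ::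
    "('g, 'e) smooth_group \<Rightarrow> ('g, 'e, 'v::real_vector) double_cochain \<Rightarrow> ('g, 'e, 'v) double_cochain"
  where "delta_op G \<psi> gs g Xs =
    (if gs = [] then 0
     else let p = length gs - 1 in
       \<psi> (tl gs) g Xs
       + (\<Sum>i=1..p. (- 1) ^ i *\<^sub>R \<psi> (merge_at G i gs) g Xs)
       + (- 1) ^ (p + 1) *\<^sub>R \<psi> (butlast gs) (last gs \<otimes>\<^bsub>G\<^esub> g) Xs)"

definition omit :: "nat \<Rightarrow> 'a list \<Rightarrow> 'a list"
  where "omit i Xs = take i Xs @ drop (i + 1) Xs"

text \<open>Chevalley-Eilenberg differential; the positions in \<open>Xs\<close> are counted from 0.\<close>

definition d_CE ::
    "('g, 'e::fin_dim_space) smooth_group \<Rightarrow> ('g \<Rightarrow> 'v \<Rightarrow> 'v) \<Rightarrow>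
      ('g, 'e, 'v::fin_dim_space) double_cochain \<Rightarrow> ('g, 'e, 'v) double_cochain"
  where "d_CE G \<rho> \<psi> gs g Xs =
    (\<Sum>i<length Xs. (- 1) ^ i *\<^sub>R
       (left_deriv G (\<lambda>g'. \<psi> gs g' (omit i Xs)) g (Xs ! i)
        + left_deriv G (\<lambda>g'. \<rho> g' (\<psi> gs g (omit i Xs))) \<one>\<^bsub>G\<^esub> (Xs ! i)))
    + (\<Sum>j<length Xs. \<Sum>i<j. (- 1) ^ (i + j) *\<^sub>R
       \<psi> gs g (lie_bracket G (Xs ! i) (Xs ! j) # omit i (omit j Xs)))"

definition d_op ::
    "('g, 'e::fin_dim_space) smooth_group \<Rightarrow> ('g \<Rightarrow> 'v \<Rightarrow> 'v) \<Rightarrow>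
      ('g, 'e, 'v::fin_dim_space) double_cochain \<Rightarrow> ('g, 'e, 'v) double_cochain"
  where "d_op G \<rho> \<psi> gs g Xs = (- 1) ^ length gs *\<^sub>R d_CE G \<rho> \<psi> gs g Xs"

section \<open>Differentiation\<close>

definition j_op ::
    "('g, 'e) smooth_group \<Rightarrow> ('g \<Rightarrow> 'v \<Rightarrow> 'v) \<Rightarrow> ('g list \<Rightarrow> 'v::zero) \<Rightarrow> ('g, 'e, 'v) double_cochain"
  where "j_op G \<rho> f gs g Xs = (if Xs = [] then \<rho> (inv\<^bsub>G\<^esub> g) (f gs) else 0)"

text \<open>\<open>h \<psi>\<close> at \<open>p - 1\<close> group arguments involves the component of \<open>\<psi>\<close> with \<open>p\<close> group arguments.\<close>

definition h_op ::
    "('g, 'e) smooth_group \<Rightarrow> 'g measure \<Rightarrow>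
      ('g, 'e, 'v::fin_dim_space) double_cochain \<Rightarrow> ('g, 'e, 'v) double_cochain"
  where "h_op G \<mu> \<psi> gs g Xs =
    (- 1) ^ (length gs + 1) *\<^sub>R (\<integral>k. \<psi> (gs @ [g \<otimes>\<^bsub>G\<^esub> inv\<^bsub>G\<^esub> k]) k Xs \<partial>\<mu>)"

definition p_op ::
    "'g measure \<Rightarrow> ('g, 'e, 'v::fin_dim_space) double_cochain \<Rightarrow> 'e list \<Rightarrow> 'v"
  where "p_op \<mu> \<psi> Xs = (\<integral>k. \<psi> [] k Xs \<partial>\<mu>)"

text \<open>
  \<open>1 + d h\<close> is invertible on \<open>D(G,V)\<^bsub>K-basic\<^esub>\<close> because \<open>d h\<close> lowers \<open>p\<close> by one; on degree \<open>p\<close>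
  elements, \<open>VE\<close> is thus \<open>(-1)\<^sup>p p (d h)\<^sup>p j\<close>. Likewise for \<open>1 + \<delta> k\<close> below, as \<open>\<delta> k\<close> lowers \<open>q\<close>.
\<close>

definition VE ::
    "('g::topological_space, 'e::fin_dim_space) smooth_group \<Rightarrow> 'g set \<Rightarrow> ('g \<Rightarrow> 'v \<Rightarrow> 'v) \<Rightarrow>
      'g measure \<Rightarrow> ('g list \<Rightarrow> 'v::fin_dim_space) \<Rightarrow> 'e list \<Rightarrow> 'v"
  where "VE G K \<rho> \<mu> f =
    p_op \<mu> (inv_into (double_cochains_basic G \<rho> K)
      (\<lambda>\<psi> gs g Xs. \<psi> gs g Xs + d_op G \<rho> (h_op G \<mu> \<psi>) gs g Xs) (j_op G \<rho> f))"

section \<open>Integration\<close>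

text \<open>
  Differential forms on \<open>G/K\<close> are transported along \<open>\<Phi>\<close> to forms on the vector space
  \<open>'w = \<gg>/\<kk>\<close>, that is, to functions \<open>\<omega> w [w\<^sub>1,\<dots>,w\<^sub>q]\<close>. \<open>form_of\<close> and \<open>of_form\<close> are the two directions of
  the identification between \<open>K\<close>-basic \<open>\<psi>\<close> and families \<open>\<beta>\<close> of forms: the pullback of
  \<open>\<beta>(g\<^sub>1,\<dots>,g\<^sub>p)\<close> to \<open>G\<close> has at \<open>g\<close> the value \<open>g \<cdot> \<psi>(g\<^sub>1,\<dots>,g\<^sub>p;g)\<close>. The value selected in
  \<open>form_of\<close> is unique for \<open>K\<close>-basic \<open>\<psi>\<close>.
\<close>

type_synonym ('w, 'v) form = "'w \<Rightarrow> 'w list \<Rightarrow> 'v"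

definition form_of ::
    "('g, 'e::fin_dim_space) smooth_group \<Rightarrow> 'g set \<Rightarrow> ('g \<Rightarrow> 'v \<Rightarrow> 'v) \<Rightarrow> ('g set \<Rightarrow> 'w::fin_dim_space) \<Rightarrow>
      ('g, 'e, 'v::fin_dim_space) double_cochain \<Rightarrow> 'g list \<Rightarrow> ('w, 'v) form"
  where "form_of G K \<rho> \<Phi> \<psi> gs w ws =
    (THE v. \<exists>g Xs. lift_to_group G K \<Phi> g = w \<and>
       map (left_deriv G (lift_to_group G K \<Phi>) g) Xs = ws \<and> v = \<rho> g (\<psi> gs g Xs))"

definition of_form ::
    "('g, 'e::fin_dim_space) smooth_group \<Rightarrow> 'g set \<Rightarrow> ('g \<Rightarrow> 'v \<Rightarrow> 'v) \<Rightarrow> ('g set \<Rightarrow> 'w::fin_dim_space) \<Rightarrow>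
      ('g list \<Rightarrow> ('w, 'v::fin_dim_space) form) \<Rightarrow> ('g, 'e, 'v) double_cochain"
  where "of_form G K \<rho> \<Phi> \<beta> gs g Xs =
    \<rho> (inv\<^bsub>G\<^esub> g) (\<beta> gs (lift_to_group G K \<Phi> g)
      (map (left_deriv G (lift_to_group G K \<Phi>) g) Xs))"

text \<open>
  The de Rham homotopy operator \<open>T\<beta> = \<integral>\<^sub>0\<^sup>1 \<iota>(\<partial>\<^sub>t) \<lambda>\<^sup>*\<beta> dt\<close>. In the vector space \<open>'w\<close> one has
  \<open>\<lambda>\<^sub>t(w) = t w\<close>, hence \<open>\<partial>\<^sub>t \<lambda>\<^sub>t(w) = w\<close>, and the differential of \<open>\<lambda>\<^sub>t\<close> is multiplication by \<open>t\<close>.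
\<close>

definition homotopy_op :: "('w::fin_dim_space, 'v::fin_dim_space) form \<Rightarrow> ('w, 'v) form"
  where "homotopy_op \<omega> w ws = integral {0..1} (\<lambda>t::real. \<omega> (t *\<^sub>R w) (w # map (\<lambda>u. t *\<^sub>R u) ws))"

definition i_op :: "('e list \<Rightarrow> 'v::zero) \<Rightarrow> ('g, 'e, 'v) double_cochain"
  where "i_op \<alpha> gs g Xs = (if gs = [] then \<alpha> Xs else 0)"

definition k_op ::
    "('g, 'e::fin_dim_space) smooth_group \<Rightarrow> 'g set \<Rightarrow> ('g \<Rightarrow> 'v \<Rightarrow> 'v) \<Rightarrow> ('g set \<Rightarrow> 'w::fin_dim_space) \<Rightarrow>
      ('g, 'e, 'v::fin_dim_space) double_cochain \<Rightarrow> ('g, 'e, 'v) double_cochain"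
  where "k_op G K \<rho> \<Phi> \<psi> =
    of_form G K \<rho> \<Phi> (\<lambda>gs w ws. (- 1) ^ length gs *\<^sub>R homotopy_op (form_of G K \<rho> \<Phi> \<psi> gs) w ws)"

definition q_op ::
    "('g, 'e::fin_dim_space) smooth_group \<Rightarrow> 'g set \<Rightarrow> ('g \<Rightarrow> 'v \<Rightarrow> 'v) \<Rightarrow> ('g set \<Rightarrow> 'w::fin_dim_space) \<Rightarrow>
      ('g, 'e, 'v::fin_dim_space) double_cochain \<Rightarrow> 'g list \<Rightarrow> 'v"
  where "q_op G K \<rho> \<Phi> \<psi> gs = form_of G K \<rho> \<Phi> \<psi> gs (lift_to_group G K \<Phi> \<one>\<^bsub>G\<^esub>) []"

definition R ::
    "('g::topological_space, 'e::fin_dim_space) smooth_group \<Rightarrow> 'g set \<Rightarrow> ('g \<Rightarrow> 'v \<Rightarrow> 'v) \<Rightarrow>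
      ('g set \<Rightarrow> 'w::fin_dim_space) \<Rightarrow> ('e list \<Rightarrow> 'v::fin_dim_space) \<Rightarrow> 'g list \<Rightarrow> 'v"
  where "R G K \<rho> \<Phi> \<alpha> =
    q_op G K \<rho> \<Phi> (inv_into (double_cochains_basic G \<rho> K)
      (\<lambda>\<psi> gs g Xs. \<psi> gs g Xs + delta_op G (k_op G K \<rho> \<Phi> \<psi>) gs g Xs) (i_op \<alpha>))"

end

theory Submission
  imports Defs
begin

text \<open>
  Write \<open>\<psi>\<close> for the zigzag \<open>(1 + \<delta>k)\<^sup>-\<^sup>1 i \<alpha>\<close> and \<open>f = R \<alpha> = q \<psi>\<close>. Two facts about \<open>\<xi> = k \<psi>\<close> at points of
  \<open>K\<close>, that is, over the origin of \<open>\<gg>/\<kk>\<close>, give the result. First, \<open>\<xi>\<close> vanishes there, because the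
  contracting vector field does; hence \<open>h \<delta> \<xi> = \<xi>\<close>, as only the last term of \<open>\<delta> \<xi>\<close> contributes to the
  integral over \<open>K\<close>. Second, \<open>d \<xi> = \<psi>\<close> there in positive form degree, by differentiating
  \<open>s \<mapsto> s \<integral>\<^sub>0\<^sup>1 t\<^sup>q \<omega>\<close> at \<open>s = 0\<close>; neither closedness nor the full Poincare lemma is needed. So
  \<open>\<phi> = j f + d \<xi>\<close> agrees with \<open>\<psi>\<close> at points of \<open>K\<close>, whence \<open>h \<phi> = h \<psi> = - h \<delta> \<xi> = - \<xi>\<close> and
  \<open>\<phi> + d h \<phi> = j f\<close>. Therefore \<open>VE f = p \<phi> = p \<psi> = \<alpha>\<close>.

  That \<open>k\<close>, \<open>\<delta>\<close> and \<open>d\<close> preserve basic cochains is checked on forms on \<open>\<gg>/\<kk>\<close>. The pulled back forms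
  are smooth because \<open>G \<rightarrow> G/K\<close> has smooth local sections, and the Chevalley-Eilenberg differential
  becomes the exterior derivative because \<open>X (Y F) - Y (X F) = [X, Y] F\<close>.
\<close>

section \<open>Calculus on finite-dimensional spaces\<close>

text \<open>\<open>VE\<close> and \<open>R\<close> invert \<open>1 + d h\<close> and
  \<open>1 + \<delta> k\<close> by \<open>inv_into\<close> on the basic cochains \<open>D\<close>.
  Solving the two equations is therefore not enough: each solution has to lie in \<open>D\<close>,
  and the perturbed identity has to be injective on \<open>D\<close>. Injectivity is an induction on
  degrees, because cochains are bounded. Membership is the expensive half: it asks for smoothness in
  all group arguments jointly, while \<open>k\<close> passes through forms on the quotient that are
  given pointwise by a definite description.

  Smoothness is handled by plots, that is, smooth maps from open coordinate domains into the group.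
  Multiplication and inversion act on plots, and a further real parameter (time of a curve, variable
  of an integral) is adjoined as one more coordinate.

  Coordinates are functions on \<open>nat\<close> with the product topology, so \<open>Ck\<close>
  can only speak of directional derivatives; the chain rule is built from these. Frechet derivatives
  return for a single vector variable, where the inverse function theorem takes place.\<close>

text \<open>Orthogonalise a finite spanning set, discard zero and normalise. The result replaces a
  basis in all later expansions and may be empty, which covers dimension zero.\<close>

lemma exists_frame:
  "\<exists>B::'a::fin_dim_space set. finite B \<and> (\<forall>x. x = (\<Sum>b\<in>B. (x \<bullet> b) *\<^sub>R b))"
proof -
  obtain B :: "'a set" where B: "finite B" "\<And>x. \<exists>c. x = (\<Sum>b\<in>B. c b *\<^sub>R b)"
    using finite_spanning_set by blast
  have "span B = UNIV"
    using B(2) by (metis (no_types, lifting) UNIV_eq_I span_base span_scale span_sum)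
  then obtain C :: "'a set" where C: "finite C" "span C = UNIV" "pairwise orthogonal C"
    using basis_orthogonal[OF B(1)] by auto
  define D where "D = (\<lambda>c. c /\<^sub>R norm c) ` (C - {0})"
  have finD: "finite D" using C(1) by (simp add: D_def)
  have orth: "d \<bullet> d' = (if d = d' then 1 else 0)" if "d \<in> D" "d' \<in> D" for d d'
  proof -
    obtain c c' where c: "c \<in> C" "c \<noteq> 0" "d = c /\<^sub>R norm c" "c' \<in> C" "c' \<noteq> 0" "d' = c' /\<^sub>R norm c'"
      using \<open>d \<in> D\<close> \<open>d' \<in> D\<close> by (auto simp: D_def)
    show ?thesis
    proof (cases "c = c'")
      case True
      then show ?thesis using c by (simp add: dot_square_norm power2_eq_square)
    next
      case False
      then have "d \<bullet> d' = 0" using C(3) c by (simp add: pairwise_def orthogonal_def)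
      moreover have "d \<bullet> d \<noteq> 0" using c by simp
      ultimately show ?thesis by auto
    qed
  qed
  have "C \<subseteq> span D"
  proof
    fix c assume "c \<in> C"
    show "c \<in> span D"
    proof (cases "c = 0")
      case False
      then have "c = norm c *\<^sub>R (c /\<^sub>R norm c)" by simp
      moreover have "c /\<^sub>R norm c \<in> D" using False \<open>c \<in> C\<close> by (auto simp: D_def)
      ultimately show ?thesis by (metis span_base span_scale)
    qed (simp add: span_zero)
  qed
  then have "span D = UNIV" using C(2) by (metis span_minimal subspace_span top.extremum_uniqueI)
  have "x = (\<Sum>b\<in>D. (x \<bullet> b) *\<^sub>R b)" for x
  proof -
    have "x \<in> span D" by (simp add: \<open>span D = UNIV\<close>)
    then obtain r where r: "x = (\<Sum>d\<in>D. r d *\<^sub>R d)"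
      unfolding span_finite[OF finD] by auto
    have "x \<bullet> b = r b" if "b \<in> D" for b
      unfolding r inner_sum_left using orth that finD
      by (simp add: if_distrib[of "(*) _"] cong: if_cong)
    then show ?thesis using r by simp
  qed
  then show ?thesis using finD by blast
qed

definition frame :: "'a::fin_dim_space set"
  where "frame = (SOME B. finite B \<and> (\<forall>x. x = (\<Sum>b\<in>B. (x \<bullet> b) *\<^sub>R b)))"

lemma finite_frame [simp]: "finite frame"
  and frame_expansion: "(\<Sum>b\<in>frame. (x \<bullet> b) *\<^sub>R b) = x"
  using someI_ex[OF exists_frame, folded frame_def] by (blast, metis)

lemma linear_frame_expansion:
  fixes f :: "'a::fin_dim_space \<Rightarrow> 'b::real_vector"
  assumes "linear f"
  shows "f x = (\<Sum>b\<in>frame. (x \<bullet> b) *\<^sub>R f b)"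
proof -
  have "f x = f (\<Sum>b\<in>frame. (x \<bullet> b) *\<^sub>R b)" by (simp only: frame_expansion)
  also have "\<dots> = (\<Sum>b\<in>frame. (x \<bullet> b) *\<^sub>R f b)"
    by (simp add: linear_sum[OF assms] linear_scale[OF assms])
  finally show ?thesis .
qed

lemma linear_imp_bounded_linear:
  fixes f :: "'a::fin_dim_space \<Rightarrow> 'b::real_normed_vector"
  assumes "linear f"
  shows "bounded_linear f"
proof -
  have "bounded_linear (\<lambda>x. \<Sum>b\<in>frame. (x \<bullet> b) *\<^sub>R f b)"
    by (intro bounded_linear_sum bounded_linear_scaleR_const bounded_linear_inner_left)
  then show ?thesis by (simp flip: linear_frame_expansion[OF assms])
qed

text \<open>Needed for the coordinate type \<open>'p \<times> real\<close>, in which a real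
  parameter is adjoined to given coordinates.\<close>

instance prod :: (fin_dim_space, fin_dim_space) fin_dim_space
proof
  let ?B = "(\<lambda>b. (b, 0)) ` frame \<union> (\<lambda>b. (0, b)) ` frame :: ('a \<times> 'b) set"
  have "p \<in> span ?B" for p
  proof -
    have "p = (\<Sum>b\<in>frame. (fst p \<bullet> b) *\<^sub>R (b, 0)) + (\<Sum>b\<in>frame. (snd p \<bullet> b) *\<^sub>R (0, b))"
      by (rule prod_eqI) (simp_all add: fst_sum snd_sum frame_expansion)
    also have "\<dots> \<in> span ?B"
      by (intro span_add span_sum span_scale span_base) auto
    finally show ?thesis .
  qed
  then have "\<forall>x. \<exists>c. x = (\<Sum>b\<in>?B. c b *\<^sub>R b)"
    by (subst (asm) span_finite) (auto simp: image_iff)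
  then show "\<exists>B::('a \<times> 'b) set. finite B \<and> (\<forall>x. \<exists>c. x = (\<Sum>b\<in>B. c b *\<^sub>R b))"
    by (intro exI[of _ ?B]) simp
qed

subsection \<open>Partial derivatives\<close>

definition pd :: "nat \<Rightarrow> 'a \<Rightarrow> ((nat \<Rightarrow> 'a::real_vector) \<Rightarrow> 'b::real_normed_vector) \<Rightarrow> (nat \<Rightarrow> 'a) \<Rightarrow> 'b"
  where "pd i v f x = vector_derivative (\<lambda>t. f (x(i := x i + t *\<^sub>R v))) (at 0)"

lemma continuous_on_proj:
  fixes g :: "'x::topological_space \<Rightarrow> nat \<Rightarrow> 'a::topological_space"
  shows "continuous_on S g \<Longrightarrow> continuous_on S (\<lambda>x. g x i)"
  by (rule continuous_on_product_then_coordinatewise)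

lemma continuous_on_upd:
  fixes g :: "'x::topological_space \<Rightarrow> nat \<Rightarrow> 'a::topological_space"
  assumes "continuous_on S g" "continuous_on S h"
  shows "continuous_on S (\<lambda>x. (g x)(i := h x))"
proof (rule continuous_on_coordinatewise_then_product)
  show "continuous_on S (\<lambda>x. ((g x)(i := h x)) j)" for j
    using assms continuous_on_proj[of S g j] by (cases "j = i") auto
qed

lemma open_upd_line:
  fixes x :: "nat \<Rightarrow> 'a::real_normed_vector"
  assumes "open S"
  shows "open {t. x(i := x i + t *\<^sub>R v) \<in> S}"
proof -
  have "continuous_on UNIV (\<lambda>t. x(i := x i + t *\<^sub>R v))"
    by (intro continuous_on_upd continuous_intros)
  from open_vimage[OF assms this] show ?thesis by (simp add: vimage_def)
qed

lemma pd_deriv_cong: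
  fixes x :: "nat \<Rightarrow> 'a::real_normed_vector"
  assumes "open S" "x \<in> S" "\<And>y. y \<in> S \<Longrightarrow> f y = g y"
  shows "((\<lambda>t. f (x(i := x i + t *\<^sub>R v))) has_vector_derivative d) (at 0) \<longleftrightarrow>
    ((\<lambda>t. g (x(i := x i + t *\<^sub>R v))) has_vector_derivative d) (at 0)"
proof -
  let ?T = "{t. x(i := x i + t *\<^sub>R v) \<in> S}"
  have T: "open ?T" "0 \<in> ?T"
    using open_upd_line[OF assms(1)] assms(2) by auto
  have "f (x(i := x i + t *\<^sub>R v)) = g (x(i := x i + t *\<^sub>R v))" if "t \<in> ?T" for t
    using that assms(3) by simp
  then show ?thesis
    using has_vector_derivative_transform_within_open[OF _ T, of "\<lambda>t. f (x(i := x i + t *\<^sub>R v))"]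
      has_vector_derivative_transform_within_open[OF _ T, of "\<lambda>t. g (x(i := x i + t *\<^sub>R v))"]
    by (metis (no_types, lifting))
qed

lemma Ck_imp_continuous: "Ck n m S f \<Longrightarrow> continuous_on S f"
  by (cases m) auto

lemma Ck_cong:
  assumes "open S" "\<And>x. x \<in> S \<Longrightarrow> f x = g x"
  shows "Ck n m S f \<longleftrightarrow> Ck n m S g"
proof (cases m)
  case 0
  then show ?thesis using continuous_on_cong[OF refl assms(2)] by simp
next
  case (Suc k)
  have "((\<lambda>t. f (x(i := x i + t *\<^sub>R v))) has_vector_derivative d) (at 0) \<longleftrightarrow>
    ((\<lambda>t. g (x(i := x i + t *\<^sub>R v))) has_vector_derivative d) (at 0)" if "x \<in> S" for x i v d
    by (rule pd_deriv_cong[OF assms(1) that assms(2)])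
  moreover have "continuous_on S f \<longleftrightarrow> continuous_on S g"
    using continuous_on_cong[OF refl assms(2)] .
  ultimately show ?thesis by (simp only: Suc Ck.simps cong: ball_cong)
qed

lemma Ck_SucE:
  assumes "Ck n (Suc m) S f" "i < n"
  obtains f' where "\<And>x. x \<in> S \<Longrightarrow> ((\<lambda>t. f (x(i := x i + t *\<^sub>R v))) has_vector_derivative f' x) (at 0)"
    "Ck n m S f'"
proof -
  have "\<exists>f'. (\<forall>x\<in>S. ((\<lambda>t. f (x(i := x i + t *\<^sub>R v))) has_vector_derivative f' x) (at 0)) \<and> Ck n m S f'"
    using assms by simp
  with that show ?thesis by blast
qed

lemma Ck_SucI:
  assumes "continuous_on S f"
    "\<And>i v. i < n \<Longrightarrow> Ck n m S (f' i v)"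
    "\<And>i v x. i < n \<Longrightarrow> x \<in> S \<Longrightarrow> ((\<lambda>t. f (x(i := x i + t *\<^sub>R v))) has_vector_derivative f' i v x) (at 0)"
  shows "Ck n (Suc m) S f"
  unfolding Ck.simps using assms by blast

text \<open>Holds for arbitrary subsets, because the derivatives in \<open>Ck\<close> are taken
  along full lines at \<open>0\<close> and not relative to \<open>S\<close>.\<close>

lemma Ck_subset: "Ck n m S f \<Longrightarrow> T \<subseteq> S \<Longrightarrow> Ck n m T f"
proof (induction m arbitrary: f)
  case 0
  then show ?case by (auto intro: continuous_on_subset)
next
  case (Suc m)
  have "\<exists>f'. (\<forall>x\<in>T. ((\<lambda>t. f (x(i := x i + t *\<^sub>R v))) has_vector_derivative f' x) (at 0)) \<and> Ck n m T f'"
    if "i < n" for i v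
    using Ck_SucE[OF Suc.prems(1) that, of v] Suc.IH Suc.prems(2) by (metis subsetD)
  moreover have "continuous_on T f"
    using Suc.prems by (auto intro: continuous_on_subset)
  ultimately show ?case unfolding Ck.simps by blast
qed

text \<open>Derivatives are unique, so the derivative that \<open>Ck\<close> only claims to exist
  can be named \<open>pd\<close>. Openness enters through \<open>Ck_cong\<close>: a line through a
  point of \<open>S\<close> stays in \<open>S\<close> for small times.\<close>

lemma Ck_Suc_iff:
  assumes "open S"
  shows "Ck n (Suc m) S f \<longleftrightarrow> continuous_on S f \<and>
    (\<forall>i<n. \<forall>v. (\<forall>x\<in>S. ((\<lambda>t. f (x(i := x i + t *\<^sub>R v))) has_vector_derivative pd i v f x) (at 0))
      \<and> Ck n m S (pd i v f))"
proof -
  have "(\<exists>f'. (\<forall>x\<in>S. ((\<lambda>t. f (x(i := x i + t *\<^sub>R v))) has_vector_derivative f' x) (at 0)) \<and> Ck n m S f')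
    \<longleftrightarrow> (\<forall>x\<in>S. ((\<lambda>t. f (x(i := x i + t *\<^sub>R v))) has_vector_derivative pd i v f x) (at 0))
      \<and> Ck n m S (pd i v f)" for i v
  proof
    assume "\<exists>f'. (\<forall>x\<in>S. ((\<lambda>t. f (x(i := x i + t *\<^sub>R v))) has_vector_derivative f' x) (at 0)) \<and> Ck n m S f'"
    then obtain f' where f': "\<forall>x\<in>S. ((\<lambda>t. f (x(i := x i + t *\<^sub>R v))) has_vector_derivative f' x) (at 0)"
      "Ck n m S f'" by auto
    then have "f' x = pd i v f x" if "x \<in> S" for x
      using that by (metis pd_def vector_derivative_at)
    with f' Ck_cong[OF assms this] show
      "(\<forall>x\<in>S. ((\<lambda>t. f (x(i := x i + t *\<^sub>R v))) has_vector_derivative pd i v f x) (at 0))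
      \<and> Ck n m S (pd i v f)" by auto
  qed auto
  then show ?thesis by simp
qed

lemma Ck_Suc_imp: "Ck n (Suc m) S f \<Longrightarrow> Ck n m S f"
proof (induction m arbitrary: f)
  case (Suc m)
  then show ?case by (simp only: Ck.simps(2)[of _ "Suc m"] Ck.simps(2)[of _ m]) blast
qed auto

lemma Ck_mono: "Ck n m S f \<Longrightarrow> k \<le> m \<Longrightarrow> Ck n k S f"
proof (induction m)
  case (Suc m)
  then show ?case by (cases "k = Suc m") (simp, metis Ck_Suc_imp le_SucE)
qed simp

text \<open>The local derivatives glue because \<open>pd\<close> does not refer to the
  neighbourhood.\<close>

lemma Ck_local:
  assumes "open S" "\<And>x. x \<in> S \<Longrightarrow> \<exists>U. open U \<and> x \<in> U \<and> Ck n m (S \<inter> U) f"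
  shows "Ck n m S f"
  using assms(2)
proof (induction m arbitrary: f)
  case 0
  then have "\<And>x. x \<in> S \<Longrightarrow> \<exists>U. open U \<and> x \<in> U \<and> continuous_on (S \<inter> U) f" by simp
  then show ?case
    by (simp, metis IntI assms(1) at_within_open continuous_on_eq_continuous_within open_Int)
next
  case (Suc m)
  have loc: "\<exists>U. open U \<and> x \<in> U \<and> U \<subseteq> S \<and> Ck n (Suc m) U f" if "x \<in> S" for x
    using Suc.prems[OF that] assms(1) that by (metis Int_iff inf_le1 open_Int)
  have "continuous_on S f"
    by (metis loc Ck_imp_continuous continuous_on_eq_continuous_at assms(1))
  moreover have "((\<lambda>t. f (x(i := x i + t *\<^sub>R v))) has_vector_derivative pd i v f x) (at 0)"
    if "i < n" "x \<in> S" for i v x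
    using loc[OF that(2)] that by (metis Ck_Suc_iff)
  moreover have "Ck n m S (pd i v f)" if "i < n" for i v
  proof (rule Suc.IH)
    fix x assume "x \<in> S"
    from loc[OF this] obtain U where U: "open U" "x \<in> U" "U \<subseteq> S" "Ck n (Suc m) U f" by auto
    then have "Ck n m (S \<inter> U) (pd i v f)" using Ck_Suc_iff[OF U(1), of n m f] that by (auto simp: Int_absorb1)
    then show "\<exists>U. open U \<and> x \<in> U \<and> Ck n m (S \<inter> U) (pd i v f)" using U by blast
  qed
  ultimately show ?case by (simp only: Ck_Suc_iff[OF assms(1)]) blast
qed

lemma Ck_const [simp]: "Ck n m S (\<lambda>x. c)"
proof (induction m arbitrary: c)
  case (Suc m)
  show ?case by (rule Ck_SucI[where f' = "\<lambda>_ _ _. 0"]) (auto simp: Suc)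
qed simp

lemma Ck_proj [simp]: "Ck n m S (\<lambda>x. x j)"
proof (cases m)
  case (Suc k)
  show ?thesis unfolding Suc
  proof (rule Ck_SucI[where f' = "\<lambda>i v x. if i = j then v else 0"])
    show "continuous_on S (\<lambda>x. x j)" by (rule continuous_on_proj[OF continuous_on_id])
    show "((\<lambda>t. (x(i := x i + t *\<^sub>R v)) j) has_vector_derivative (if i = j then v else 0)) (at 0)"
      for x :: "nat \<Rightarrow> 'a" and i v
      by (auto intro!: derivative_eq_intros)
  qed simp
qed (simp add: continuous_on_proj[OF continuous_on_id])

lemma Ck_add:
  "Ck n m S f \<Longrightarrow> Ck n m S g \<Longrightarrow> Ck n m S (\<lambda>x. f x + g x)"
proof (induction m arbitrary: f g)
  case (Suc m)
  have "\<exists>h. (\<forall>x\<in>S. ((\<lambda>t. f (x(i := x i + t *\<^sub>R v)) + g (x(i := x i + t *\<^sub>R v)))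
      has_vector_derivative h x) (at 0)) \<and> Ck n m S h" if i: "i < n" for i v
  proof -
    obtain f' where f':
      "\<And>x. x \<in> S \<Longrightarrow> ((\<lambda>t. f (x(i := x i + t *\<^sub>R v))) has_vector_derivative f' x) (at 0)" "Ck n m S f'"
      using Ck_SucE[OF Suc.prems(1) i, of v] by blast
    obtain g' where g':
      "\<And>x. x \<in> S \<Longrightarrow> ((\<lambda>t. g (x(i := x i + t *\<^sub>R v))) has_vector_derivative g' x) (at 0)" "Ck n m S g'"
      using Ck_SucE[OF Suc.prems(2) i, of v] by blast
    note d = f' g'
    show ?thesis
      using Suc.IH d by (intro exI[of _ "\<lambda>x. f' x + g' x"]) (auto intro!: has_vector_derivative_add)
  qed
  moreover have "continuous_on S (\<lambda>x. f x + g x)"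
    using Suc.prems by (intro continuous_on_add) (auto dest: Ck_imp_continuous)
  ultimately show ?case by simp
qed (simp add: continuous_on_add)

lemma Ck_bilinear:
  assumes "bounded_bilinear h"
  shows "Ck n m S f \<Longrightarrow> Ck n m S g \<Longrightarrow> Ck n m S (\<lambda>x. h (f x) (g x))"
proof (induction m arbitrary: f g)
  case 0
  then show ?case using assms by (auto intro: bounded_bilinear.continuous_on)
next
  case (Suc m)
  have "\<exists>k. (\<forall>x\<in>S. ((\<lambda>t. h (f (x(i := x i + t *\<^sub>R v))) (g (x(i := x i + t *\<^sub>R v))))
      has_vector_derivative k x) (at 0)) \<and> Ck n m S k" if i: "i < n" for i v
  proof -
    obtain f' where f':
      "\<And>x. x \<in> S \<Longrightarrow> ((\<lambda>t. f (x(i := x i + t *\<^sub>R v))) has_vector_derivative f' x) (at 0)" "Ck n m S f'"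
      using Ck_SucE[OF Suc.prems(1) i, of v] by blast
    obtain g' where g':
      "\<And>x. x \<in> S \<Longrightarrow> ((\<lambda>t. g (x(i := x i + t *\<^sub>R v))) has_vector_derivative g' x) (at 0)" "Ck n m S g'"
      using Ck_SucE[OF Suc.prems(2) i, of v] by blast
    note d = f' g'
    have "Ck n m S (\<lambda>x. h (f x) (g' x) + h (f' x) (g x))"
      using Suc.prems[THEN Ck_Suc_imp] d by (intro Ck_add Suc.IH)
    moreover have "((\<lambda>t. h (f (x(i := x i + t *\<^sub>R v))) (g (x(i := x i + t *\<^sub>R v)))) has_vector_derivative
         h (f x) (g' x) + h (f' x) (g x)) (at 0)" if "x \<in> S" for x
      using bounded_bilinear.has_vector_derivative[OF assms d(1)[OF that] d(3)[OF that]]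
      by (simp only: scaleR_zero_left add_0_right fun_upd_triv)
    ultimately show ?thesis
      by (intro exI[of _ "\<lambda>x. h (f x) (g' x) + h (f' x) (g x)"] conjI ballI)
  qed
  moreover have "continuous_on S (\<lambda>x. h (f x) (g x))"
    by (rule bounded_bilinear.continuous_on[OF assms Suc.prems[THEN Ck_imp_continuous]])
  ultimately show ?case by simp
qed

lemma Ck_bounded_linear:
  assumes "bounded_linear h"
  shows "Ck n m S f \<Longrightarrow> Ck n m S (\<lambda>x. h (f x))"
proof (induction m arbitrary: f)
  case 0
  then show ?case using assms by (auto intro: bounded_linear.continuous_on)
next
  case (Suc m)
  have "\<exists>k. (\<forall>x\<in>S. ((\<lambda>t. h (f (x(i := x i + t *\<^sub>R v)))) has_vector_derivative k x) (at 0)) \<and> Ck n m S k"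
    if i: "i < n" for i v
  proof -
    obtain f' where f':
      "\<And>x. x \<in> S \<Longrightarrow> ((\<lambda>t. f (x(i := x i + t *\<^sub>R v))) has_vector_derivative f' x) (at 0)" "Ck n m S f'"
      using Ck_SucE[OF Suc.prems(1) i, of v] by blast
    show ?thesis
      by (intro exI[of _ "\<lambda>x. h (f' x)"] conjI ballI Suc.IH f'
        bounded_linear.has_vector_derivative[OF assms])
  qed
  moreover have "continuous_on S (\<lambda>x. h (f x))"
    by (rule bounded_linear.continuous_on[OF assms Suc.prems[THEN Ck_imp_continuous]])
  ultimately show ?case by simp
qed

lemmas Ck_scaleR = Ck_bilinear[OF bounded_bilinear_scaleR]
lemmas Ck_inner_left = Ck_bounded_linear[OF bounded_linear_inner_left]

lemma Ck_sum: "(\<And>a. a \<in> A \<Longrightarrow> Ck n m S (f a)) \<Longrightarrow> Ck n m S (\<lambda>x. \<Sum>a\<in>A. f a x)"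
  by (induction A rule: infinite_finite_induct) (auto intro: Ck_add)

subsection \<open>The chain rule\<close>

lemma has_vector_derivative_iff_slope:
  fixes f :: "real \<Rightarrow> 'a::real_normed_vector"
  shows "(f has_vector_derivative d) (at 0) \<longleftrightarrow> ((\<lambda>t. (f t - f 0) /\<^sub>R t) \<longlongrightarrow> d) (at 0)"
proof -
  have "norm (f h - f 0 - h *\<^sub>R d) / norm h = norm ((f h - f 0) /\<^sub>R h - d)" if "h \<noteq> 0" for h
  proof -
    have "(f h - f 0) /\<^sub>R h - d = (f h - f 0 - h *\<^sub>R d) /\<^sub>R h"
      using that by (simp add: scaleR_diff_right)
    then show ?thesis by (simp add: divide_inverse mult.commute)
  qed
  then have "((\<lambda>h. norm (f (0 + h) - f 0 - h *\<^sub>R d) / norm h) \<longlongrightarrow> 0) (at 0) \<longleftrightarrow>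
      ((\<lambda>h. norm ((f h - f 0) /\<^sub>R h - d)) \<longlongrightarrow> 0) (at 0)"
    by (intro filterlim_cong) (auto simp: eventually_at_filter)
  also have "\<dots> \<longleftrightarrow> ((\<lambda>t. (f t - f 0) /\<^sub>R t) \<longlongrightarrow> d) (at 0)"
    by (simp only: tendsto_norm_zero_iff LIM_zero_iff)
  finally show ?thesis
    unfolding has_vector_derivative_def has_derivative_at by (simp only: bounded_linear_scaleR_left simp_thms)
qed

text \<open>One step of the chain rule: move a single coordinate in a single direction
  \<open>b\<close>, from a base point \<open>z t\<close> that itself moves. Of \<open>z\<close> only
  convergence to \<open>y0\<close> is known; continuity of \<open>f'\<close> near \<open>y0\<close>
  compensates.\<close>

lemma increment_derivative:
  fixes f :: "(nat \<Rightarrow> 'a::fin_dim_space) \<Rightarrow> 'b::fin_dim_space" and z :: "real \<Rightarrow> nat \<Rightarrow> 'a"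
  assumes S: "open S" "y0 \<in> S"
    and der: "\<And>y. y \<in> S \<Longrightarrow> ((\<lambda>t. f (y(i := y i + t *\<^sub>R b))) has_vector_derivative f' y) (at 0)"
    and f': "continuous_on S f'"
    and z: "(z \<longlongrightarrow> y0) (at 0)"
    and s: "(s has_vector_derivative s') (at (0::real))" "s 0 = (0::real)"
  shows "((\<lambda>t. f ((z t)(i := z t i + s t *\<^sub>R b)) - f (z t)) has_vector_derivative s' *\<^sub>R f' y0) (at 0)"
proof -
  let ?u = "\<lambda>(y, r::real). (y :: nat \<Rightarrow> 'a)(i := y i + r *\<^sub>R b)"
  let ?F = "\<lambda>t. f ((z t)(i := z t i + s t *\<^sub>R b)) - f (z t)"
  have cu: "continuous_on UNIV ?u"
    unfolding case_prod_beta
    by (intro continuous_on_upd continuous_intros continuous_on_proj)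
  have s_lim: "(s \<longlongrightarrow> 0) (at 0)"
    using has_vector_derivative_continuous[OF s(1)] s(2) by (simp add: continuous_at)
  have slope: "((\<lambda>t. s t / t) \<longlongrightarrow> s') (at 0)"
    using s by (simp add: has_real_derivative_iff_has_vector_derivative[symmetric] DERIV_def)
  \<comment> \<open>The pairs (base point, displacement) that land where \<open>f'\<close> is within
    \<open>e\<close> of \<open>f' y0\<close> form an open set around \<open>(y0, 0)\<close>. A
    product neighbourhood inside it makes the mean value estimate uniform in the base point.\<close>
  have bound: "\<forall>\<^sub>F t in at 0. norm (?F t - s t *\<^sub>R f' y0) \<le> e * \<bar>s t\<bar>" if "e > 0" for e
  proof -
    let ?U = "{y \<in> S. dist (f' y) (f' y0) < e}"
    have "open ?U"
    proof -
      have "open (S \<inter> f' -` ball (f' y0) e)"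
        by (rule continuous_open_preimage[OF f' S(1) open_ball])
      moreover have "S \<inter> f' -` ball (f' y0) e = ?U" by (auto simp: dist_commute)
      ultimately show ?thesis by simp
    qed
    then have op: "open (?u -` ?U)" by (rule open_vimage[OF _ cu])
    have mem: "(y0, 0) \<in> ?u -` ?U" using S(2) \<open>e > 0\<close> by simp
    from open_prod_elim[OF op mem]
    obtain A B where AB': "open A" "open B" "(y0, 0) \<in> A \<times> B" "A \<times> B \<subseteq> ?u -` ?U"
      by blast
    then have AB: "open A" "open B" "y0 \<in> A" "0 \<in> B" "A \<times> B \<subseteq> ?u -` ?U"
      by auto
    obtain d where d: "d > 0" "ball 0 d \<subseteq> B" using AB(2,4) open_contains_ball by blast
    have "\<forall>\<^sub>F t in at 0. z t \<in> A" using topological_tendstoD[OF z AB(1,3)] .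
    moreover have "\<forall>\<^sub>F t in at 0. dist (s t) 0 < d" using tendstoD[OF s_lim d(1)] .
    ultimately show ?thesis
    proof eventually_elim
      case (elim t)
      have inU: "(z t)(i := z t i + r *\<^sub>R b) \<in> ?U" if "r \<in> closed_segment 0 (s t)" for r
      proof -
        have "\<bar>r\<bar> \<le> \<bar>s t\<bar>" using that by (auto simp: closed_segment_eq_real_ivl split: if_splits)
        then have "r \<in> B" using elim(2) d(2) by (auto simp: subset_iff dist_real_def)
        then have "(z t, r) \<in> ?u -` ?U" using AB(5) elim(1) by blast
        then show ?thesis by simp
      qed
      let ?g = "\<lambda>r. f ((z t)(i := z t i + r *\<^sub>R b)) - r *\<^sub>R f' y0"
      have "norm (?g (s t) - ?g 0) \<le> e * norm (s t - 0)"
      proof (rule differentiable_bound[of "closed_segment 0 (s t)" ?g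
            "\<lambda>r h. h *\<^sub>R (f' ((z t)(i := z t i + r *\<^sub>R b)) - f' y0)"])
        fix r assume r: "r \<in> closed_segment 0 (s t)"
        let ?y = "(z t)(i := z t i + r *\<^sub>R b)"
        have "((\<lambda>h. f (?y(i := ?y i + h *\<^sub>R b))) has_vector_derivative f' ?y) (at (r - r))"
          using der[of ?y] inU[OF r] by simp
        moreover have "(\<lambda>h. f (?y(i := ?y i + h *\<^sub>R b))) \<circ> (\<lambda>q. q - r) = (\<lambda>q. f ((z t)(i := z t i + q *\<^sub>R b)))"
          by (auto simp: fun_eq_iff algebra_simps)
        moreover have "((\<lambda>q. q - r) has_vector_derivative 1) (at r)"
          by (auto intro!: derivative_eq_intros)
        ultimately have "((\<lambda>q. f ((z t)(i := z t i + q *\<^sub>R b))) has_vector_derivative f' ?y) (at r)"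
          using vector_diff_chain_at[of "\<lambda>q. q - r" 1 r "\<lambda>h. f (?y(i := ?y i + h *\<^sub>R b))" "f' ?y"]
          by simp
        then have "(?g has_vector_derivative f' ?y - f' y0) (at r)"
          by (auto intro!: derivative_eq_intros)
        then show "(?g has_derivative (\<lambda>h. h *\<^sub>R (f' ?y - f' y0))) (at r within closed_segment 0 (s t))"
          unfolding has_vector_derivative_def by (rule has_derivative_at_withinI)
        show "onorm (\<lambda>h. h *\<^sub>R (f' ?y - f' y0)) \<le> e"
        proof (rule onorm_le)
          fix h :: real
          have "norm (f' ?y - f' y0) \<le> e" using inU[OF r] by (simp add: dist_norm)
          then show "norm (h *\<^sub>R (f' ?y - f' y0)) \<le> e * norm h"
            by (simp add: mult.commute[of e] mult_left_mono)
        qed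
      qed auto
      then show ?case by (simp add: algebra_simps)
    qed
  qed
  have "((\<lambda>t. (?F t - s t *\<^sub>R f' y0) /\<^sub>R t) \<longlongrightarrow> 0) (at 0)"
  proof (rule tendstoI)
    fix e :: real assume "e > 0"
    \<comment> \<open>Eventually the slope \<open>s t / t\<close> is below
      \<open>\<bar>s'\<bar> + 1\<close> in absolute value, so precision \<open>c\<close> for
      \<open>bound\<close> yields \<open>e\<close>.\<close>
    define c where "c = e / (\<bar>s'\<bar> + 1)"
    have "c > 0" using \<open>e > 0\<close> by (simp add: c_def add_nonneg_pos)
    have "\<forall>\<^sub>F t in at 0. \<bar>s t / t\<bar> < \<bar>s'\<bar> + 1"
      by (rule order_tendstoD(2)[OF tendsto_rabs[OF slope]]) simp
    with bound[OF \<open>c > 0\<close>] show "\<forall>\<^sub>F t in at 0. dist ((?F t - s t *\<^sub>R f' y0) /\<^sub>R t) 0 < e"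
    proof eventually_elim
      case (elim t)
      have "norm ((?F t - s t *\<^sub>R f' y0) /\<^sub>R t) = norm (?F t - s t *\<^sub>R f' y0) / \<bar>t\<bar>"
        by (simp add: divide_inverse mult.commute)
      also have "\<dots> \<le> c * \<bar>s t\<bar> / \<bar>t\<bar>" using elim(1) by (simp add: divide_right_mono)
      also have "\<dots> = c * \<bar>s t / t\<bar>" by simp
      also have "\<dots> < c * (\<bar>s'\<bar> + 1)" using elim(2) \<open>c > 0\<close> by (rule mult_strict_left_mono)
      also have "\<dots> = e" by (simp add: c_def)
      finally show ?case by simp
    qed
  qed
  moreover have "((\<lambda>t. (s t / t) *\<^sub>R f' y0) \<longlongrightarrow> s' *\<^sub>R f' y0) (at 0)"
    by (intro tendsto_intros slope)
  ultimately have "((\<lambda>t. (?F t - s t *\<^sub>R f' y0) /\<^sub>R t + (s t / t) *\<^sub>R f' y0) \<longlongrightarrow> 0 + s' *\<^sub>R f' y0) (at 0)"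
    by (rule tendsto_add)
  moreover have "(?F t - s t *\<^sub>R f' y0) /\<^sub>R t + (s t / t) *\<^sub>R f' y0 = ?F t /\<^sub>R t" for t
    by (simp add: scaleR_diff_right divide_inverse mult.commute)
  ultimately have "((\<lambda>t. ?F t /\<^sub>R t) \<longlongrightarrow> s' *\<^sub>R f' y0) (at 0)" by simp
  moreover have "?F 0 = 0" using s(2) by simp
  ultimately show ?thesis unfolding has_vector_derivative_iff_slope by simp
qed

text \<open>The curve is reached from the constant \<open>u 0\<close> by switching on its frame
  components one after the other: in \<open>y J\<close> only those listed in \<open>J\<close> move.
  Each switch is an instance of \<open>increment_derivative\<close>. Coordinates from
  \<open>n\<close> on must stand still, as \<open>Ck n\<close> says nothing about derivatives
  there.\<close>

lemma curve_derivative: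
  fixes f :: "(nat \<Rightarrow> 'a::fin_dim_space) \<Rightarrow> 'b::fin_dim_space" and u :: "real \<Rightarrow> nat \<Rightarrow> 'a"
  assumes S: "open S" "u 0 \<in> S" and f: "Ck n (Suc 0) S f"
    and u: "\<And>i. i < n \<Longrightarrow> ((\<lambda>t. u t i) has_vector_derivative u' i) (at 0)"
    and u0: "\<And>i t. n \<le> i \<Longrightarrow> u t i = u 0 i"
  shows "((\<lambda>t. f (u t)) has_vector_derivative
    (\<Sum>i<n. \<Sum>b\<in>frame. (u' i \<bullet> b) *\<^sub>R pd i b f (u 0))) (at 0)"
proof -
  define s where "s i b t = (u t i - u 0 i) \<bullet> b" for i b t
  define y where "y J t = (\<lambda>i. u 0 i + (\<Sum>b | b \<in> frame \<and> (i, b) \<in> J. s i b t *\<^sub>R b))" for J t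
  have s: "(s i b has_vector_derivative u' i \<bullet> b) (at 0)" "s i b 0 = 0" if "i < n" for i b
  proof -
    have "((\<lambda>t. (u t i - u 0 i) \<bullet> b) has_vector_derivative (u' i - 0) \<bullet> b) (at 0)"
      by (intro bounded_linear.has_vector_derivative[OF bounded_linear_inner_left]
        has_vector_derivative_diff u that has_vector_derivative_const)
    then show "(s i b has_vector_derivative u' i \<bullet> b) (at 0)" unfolding s_def by simp
  qed (simp add: s_def)
  have s_lim: "(s i b \<longlongrightarrow> 0) (at 0)" if "i < n" for i b
    using has_vector_derivative_continuous[OF s(1)[OF that, of b]] s(2)[OF that, of b]
    by (simp add: continuous_at)
  have y_lim: "(y J \<longlongrightarrow> u 0) (at 0)" if "J \<subseteq> {..<n} \<times> frame" for J
  proof -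
    have "((\<lambda>t. y J t i) \<longlongrightarrow> u 0 i + (\<Sum>b | b \<in> frame \<and> (i, b) \<in> J. 0 *\<^sub>R b)) (at 0)" for i
      unfolding y_def using that by (intro tendsto_add tendsto_const tendsto_sum tendsto_scaleR s_lim) auto
    then have "((\<lambda>t. y J t i) \<longlongrightarrow> u 0 i) (at 0)" for i by simp
    then show ?thesis
      using limitin_componentwise[of "\<lambda>_. euclidean" UNIV "y J" "u 0" "at 0"]
      by (simp add: euclidean_product_topology)
  qed
  have "((\<lambda>t. f (y J t)) has_vector_derivative (\<Sum>(i,b)\<in>J. (u' i \<bullet> b) *\<^sub>R pd i b f (u 0))) (at 0)"
    if "finite J" "J \<subseteq> {..<n} \<times> frame" for J
    using that
  proof (induction J rule: finite_induct)
    case empty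
    then show ?case by (simp add: y_def)
  next
    case (insert p J)
    obtain i b where p: "p = (i, b)" by (cases p)
    with insert have ib: "i < n" "b \<in> frame" "(i, b) \<notin> J" "J \<subseteq> {..<n} \<times> frame" by auto
    have step: "y (insert p J) t = (y J t)(i := y J t i + s i b t *\<^sub>R b)" for t
    proof
      fix k
      show "y (insert p J) t k = ((y J t)(i := y J t i + s i b t *\<^sub>R b)) k"
      proof (cases "k = i")
        case True
        have "{c \<in> frame. (i, c) \<in> insert p J} = insert b {c \<in> frame. (i, c) \<in> J}"
          using ib p by auto
        then show ?thesis using True ib by (simp add: y_def)
      next
        case False
        then show ?thesis by (simp add: y_def p)
      qed
    qed
    have "((\<lambda>t. f ((y J t)(i := y J t i + s i b t *\<^sub>R b)) - f (y J t)) has_vector_derivative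
        (u' i \<bullet> b) *\<^sub>R pd i b f (u 0)) (at 0)"
    proof (rule increment_derivative[OF S])
      show "((\<lambda>t. f (x(i := x i + t *\<^sub>R b))) has_vector_derivative pd i b f x) (at 0)" if "x \<in> S" for x
        using f ib(1) that unfolding Ck_Suc_iff[OF S(1)] by blast
      show "continuous_on S (pd i b f)"
        using f ib(1) unfolding Ck_Suc_iff[OF S(1)] by simp
      show "(y J \<longlongrightarrow> u 0) (at 0)" by (rule y_lim[OF ib(4)])
    qed (use s ib in auto)
    from has_vector_derivative_add[OF this insert.IH[OF ib(4)]]
    show ?case unfolding step using insert.hyps by (simp add: p del: fun_upd_apply)
  qed
  from this[of "{..<n} \<times> frame"]
  have "((\<lambda>t. f (y ({..<n} \<times> frame) t)) has_vector_derivative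
      (\<Sum>i<n. \<Sum>b\<in>frame. (u' i \<bullet> b) *\<^sub>R pd i b f (u 0))) (at 0)"
    by (simp add: sum.cartesian_product)
  moreover have "y ({..<n} \<times> frame) t = u t" for t
  proof
    fix i show "y ({..<n} \<times> frame) t i = u t i"
      using u0[of i t] by (cases "i < n") (simp_all add: y_def s_def frame_expansion)
  qed
  ultimately show ?thesis by simp
qed

text \<open>\<open>Ck\<close> treats each direction separately; linearity in the direction is a
  consequence of continuity of the derivatives, obtained from the chain rule along a straight
  line.\<close>

lemma pd_expansion:
  assumes "open S" "x \<in> S" "Ck n (Suc 0) S f" "i < n"
  shows "pd i v f x = (\<Sum>b\<in>frame. (v \<bullet> b) *\<^sub>R pd i b f x)"
proof -
  have "((\<lambda>t. f (x(i := x i + t *\<^sub>R v))) has_vector_derivative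
    (\<Sum>k<n. \<Sum>b\<in>frame. ((if k = i then v else 0) \<bullet> b) *\<^sub>R pd k b f (x(i := x i + 0 *\<^sub>R v)))) (at 0)"
  proof (rule curve_derivative[OF assms(1) _ assms(3)])
    show "x(i := x i + 0 *\<^sub>R v) \<in> S" using assms(2) by simp
    show "((\<lambda>t. (x(i := x i + t *\<^sub>R v)) k) has_vector_derivative (if k = i then v else 0)) (at 0)" for k
      by (cases "k = i") (auto intro!: derivative_eq_intros)
    show "(x(i := x i + t *\<^sub>R v)) k = (x(i := x i + 0 *\<^sub>R v)) k" if "n \<le> k" for k t
      using that assms(4) by simp
  qed
  then have "pd i v f x = (\<Sum>k<n. \<Sum>b\<in>frame. ((if k = i then v else 0) \<bullet> b) *\<^sub>R pd k b f x)"
    unfolding pd_def by (simp add: vector_derivative_at)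
  also have "\<dots> = (\<Sum>k<n. if k = i then (\<Sum>b\<in>frame. (v \<bullet> b) *\<^sub>R pd k b f x) else 0)"
    by (intro sum.cong) auto
  also have "\<dots> = (\<Sum>b\<in>frame. (v \<bullet> b) *\<^sub>R pd i b f x)" using assms(4) by simp
  finally show ?thesis .
qed

lemma linear_pd:
  assumes "open S" "x \<in> S" "Ck n (Suc 0) S f" "i < n"
  shows "linear (\<lambda>v. pd i v f x)"
proof -
  have "linear (\<lambda>v. \<Sum>b\<in>frame. (v \<bullet> b) *\<^sub>R pd i b f x)"
    by (intro linearI) (simp_all add: inner_add_left scaleR_add_left sum.distrib scaleR_sum_right)
  then show ?thesis by (simp only: pd_expansion[OF assms, symmetric])
qed

text \<open>The derivative of the composite consists of products of derivatives of \<open>u\<close>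
  with \<open>pd i b f\<close> composed with \<open>u\<close>, so the induction is on the order for
  all \<open>f\<close> at once. Coordinates of \<open>u\<close> from \<open>n\<close> on have to be
  continuous and unaffected by the active parameters, for the reason given at
  \<open>curve_derivative\<close>.\<close>

lemma Ck_compose:
  fixes f :: "(nat \<Rightarrow> 'a::fin_dim_space) \<Rightarrow> 'b::fin_dim_space"
    and u :: "(nat \<Rightarrow> 'p::fin_dim_space) \<Rightarrow> nat \<Rightarrow> 'a"
  assumes S': "open S'" and S: "open S" and maps: "\<And>x. x \<in> S \<Longrightarrow> u x \<in> S'"
    and cont: "\<And>i. continuous_on S (\<lambda>x. u x i)"
    and indep: "\<And>i j x y. n \<le> i \<Longrightarrow> j < n' \<Longrightarrow> u (x(j := y)) i = u x i"
  shows "Ck n m S' f \<Longrightarrow> (\<And>i. i < n \<Longrightarrow> Ck n' m S (\<lambda>x. u x i)) \<Longrightarrow> Ck n' m S (\<lambda>x. f (u x))"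
proof (induction m arbitrary: f)
  case 0
  have "continuous_on S u" using cont by (rule continuous_on_coordinatewise_then_product)
  moreover have "continuous_on S' f" using 0(1) by simp
  ultimately have "continuous_on S (\<lambda>x. f (u x))"
    by (intro continuous_on_compose2[of S' f S u]) (use maps in blast)+
  then show ?case by simp
next
  case (Suc m)
  have u_m: "Ck n' m S (\<lambda>x. u x i)" if "i < n" for i using Suc.prems(2)[OF that] by (rule Ck_Suc_imp)
  have f1: "Ck n (Suc 0) S' f" using Suc.prems(1) by (rule Ck_mono) simp
  show ?case
  proof (rule Ck_SucI[where f' = "\<lambda>j v x. \<Sum>i<n. \<Sum>b\<in>frame. (pd j v (\<lambda>x. u x i) x \<bullet> b) *\<^sub>R pd i b f (u x)"])
    have "continuous_on S u" using cont by (rule continuous_on_coordinatewise_then_product)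
    then show "continuous_on S (\<lambda>x. f (u x))"
      by (rule continuous_on_compose2[OF Ck_imp_continuous[OF Suc.prems(1)]]) (use maps in blast)
  next
    fix j v assume j: "j < n'"
    show "Ck n' m S (\<lambda>x. \<Sum>i<n. \<Sum>b\<in>frame. (pd j v (\<lambda>x. u x i) x \<bullet> b) *\<^sub>R pd i b f (u x))"
    proof (intro Ck_sum Ck_scaleR Ck_inner_left)
      fix i b assume i: "i \<in> {..<n}"
      show "Ck n' m S (pd j v (\<lambda>x. u x i))"
        using Suc.prems(2)[of i] i j unfolding Ck_Suc_iff[OF S] by simp
      show "Ck n' m S (\<lambda>x. pd i b f (u x))"
        using Suc.prems(1) i u_m by (intro Suc.IH) (simp_all add: Ck_Suc_iff[OF S'] del: Ck.simps)
    qed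
    fix x assume x: "x \<in> S"
    have d: "((\<lambda>t. u (x(j := x j + t *\<^sub>R v)) i) has_vector_derivative pd j v (\<lambda>x. u x i) x) (at 0)" if "i < n" for i
      using Suc.prems(2)[OF that] j x unfolding Ck_Suc_iff[OF S] by blast
    have "((\<lambda>t. f (u (x(j := x j + t *\<^sub>R v)))) has_vector_derivative
      (\<Sum>i<n. \<Sum>b\<in>frame. (pd j v (\<lambda>x. u x i) x \<bullet> b) *\<^sub>R pd i b f (u (x(j := x j + 0 *\<^sub>R v))))) (at 0)"
    proof (rule curve_derivative[OF S' _ f1])
      show "u (x(j := x j + 0 *\<^sub>R v)) \<in> S'" using x maps by simp
      show "u (x(j := x j + t *\<^sub>R v)) i = u (x(j := x j + 0 *\<^sub>R v)) i" if "n \<le> i" for i t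
        by (simp only: indep[OF that j])
    qed (rule d)
    then show "((\<lambda>t. f (u (x(j := x j + t *\<^sub>R v)))) has_vector_derivative
      (\<Sum>i<n. \<Sum>b\<in>frame. (pd j v (\<lambda>x. u x i) x \<bullet> b) *\<^sub>R pd i b f (u x))) (at 0)"
      by simp
  qed
qed

section \<open>Closure properties of smooth functions in several vector variables\<close>

lemma C_infinity_cong:
  assumes "open S" "\<And>x. x \<in> S \<Longrightarrow> f x = g x"
  shows "C_infinity n S f \<longleftrightarrow> C_infinity n S g"
  using Ck_cong[OF assms] by (simp add: C_infinity_def)

lemma C_infinity_subset: "C_infinity n S f \<Longrightarrow> T \<subseteq> S \<Longrightarrow> C_infinity n T f"
  unfolding C_infinity_def using Ck_subset by blast

lemma C_infinity_local:
  assumes "open S" "\<And>x. x \<in> S \<Longrightarrow> \<exists>U. open U \<and> x \<in> U \<and> C_infinity n (S \<inter> U) f"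
  shows "C_infinity n S f"
  unfolding C_infinity_def
  by (intro allI Ck_local[OF assms(1)]) (use assms(2) in \<open>force simp: C_infinity_def\<close>)

lemma C_infinity_continuous: "C_infinity n S f \<Longrightarrow> continuous_on S f"
  unfolding C_infinity_def using Ck_imp_continuous[of n 0 S f] by blast

lemma C_infinity_const [simp]: "C_infinity n S (\<lambda>x. c)"
  and C_infinity_proj [simp]: "C_infinity n S (\<lambda>x. x j)"
  and C_infinity_add: "C_infinity n S f \<Longrightarrow> C_infinity n S g \<Longrightarrow> C_infinity n S (\<lambda>x. f x + g x)"
  and C_infinity_scaleR: "C_infinity n S r \<Longrightarrow> C_infinity n S g \<Longrightarrow> C_infinity n S (\<lambda>x. r x *\<^sub>R g x)"
  and C_infinity_inner_left: "C_infinity n S f \<Longrightarrow> C_infinity n S (\<lambda>x. f x \<bullet> b)"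
  and C_infinity_sum: "(\<And>a. a \<in> A \<Longrightarrow> C_infinity n S (h a)) \<Longrightarrow> C_infinity n S (\<lambda>x. \<Sum>a\<in>A. h a x)"
  and C_infinity_bounded_linear: "bounded_linear l \<Longrightarrow> C_infinity n S f \<Longrightarrow> C_infinity n S (\<lambda>x. l (f x))"
  by (simp_all add: C_infinity_def Ck_add Ck_scaleR Ck_inner_left Ck_sum Ck_bounded_linear)

lemma C_infinity_linear:
  fixes l :: "'a::fin_dim_space \<Rightarrow> 'b::fin_dim_space"
  shows "linear l \<Longrightarrow> C_infinity n S f \<Longrightarrow> C_infinity n S (\<lambda>x. l (f x))"
  by (rule C_infinity_bounded_linear[OF linear_imp_bounded_linear])

lemma C_infinity_compose:
  fixes f :: "(nat \<Rightarrow> 'a::fin_dim_space) \<Rightarrow> 'b::fin_dim_space"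
    and u :: "(nat \<Rightarrow> 'p::fin_dim_space) \<Rightarrow> nat \<Rightarrow> 'a"
  assumes "open S'" "open S" "\<And>x. x \<in> S \<Longrightarrow> u x \<in> S'" "C_infinity n S' f"
    "\<And>i. i < n \<Longrightarrow> C_infinity n' S (\<lambda>x. u x i)"
    "\<And>i. n \<le> i \<Longrightarrow> continuous_on S (\<lambda>x. u x i)"
    "\<And>i j x y. n \<le> i \<Longrightarrow> j < n' \<Longrightarrow> u (x(j := y)) i = u x i"
  shows "C_infinity n' S (\<lambda>x. f (u x))"
proof -
  have "continuous_on S (\<lambda>x. u x i)" for i
    using C_infinity_continuous[OF assms(5)[of i]] assms(6)[of i] not_le by blast
  note cont = this
  have "Ck n' m S (\<lambda>x. f (u x))" for m
  proof (rule Ck_compose[OF assms(1-3) cont assms(7)])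
    show "Ck n m S' f" using assms(4) unfolding C_infinity_def by blast
    show "Ck n' m S (\<lambda>x. u x i)" if "i < n" for i using assms(5)[OF that] unfolding C_infinity_def by blast
  qed
  then show ?thesis unfolding C_infinity_def by blast
qed

lemma C_infinity_pd:
  assumes "open S" "C_infinity n S f" "i < n"
  shows "C_infinity n S (pd i v f)"
  using assms unfolding C_infinity_def by (metis Ck_Suc_iff)

lemma pd_has_vector_derivative:
  assumes "open S" "C_infinity n S f" "i < n" "x \<in> S"
  shows "((\<lambda>t. f (x(i := x i + t *\<^sub>R v))) has_vector_derivative pd i v f x) (at 0)"
  using assms unfolding C_infinity_def by (metis Ck_Suc_iff)

lemma has_vector_derivative_at_shift:
  fixes f :: "'a::real_normed_vector \<Rightarrow> 'b::real_normed_vector"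
  assumes "((\<lambda>t. f (a + r *\<^sub>R v + t *\<^sub>R v)) has_vector_derivative d) (at 0)"
  shows "((\<lambda>t. f (a + t *\<^sub>R v)) has_vector_derivative d) (at r)"
proof -
  have "((\<lambda>q. q - r) has_vector_derivative 1) (at r)"
    by (auto intro!: derivative_eq_intros)
  moreover have "((\<lambda>t. f (a + r *\<^sub>R v + t *\<^sub>R v)) has_vector_derivative d) (at (r - r))"
    using assms by simp
  moreover have "(\<lambda>t. f (a + r *\<^sub>R v + t *\<^sub>R v)) \<circ> (\<lambda>q. q - r) = (\<lambda>t. f (a + t *\<^sub>R v))"
    by (auto simp: fun_eq_iff algebra_simps)
  ultimately show ?thesis
    using vector_diff_chain_at[of "\<lambda>q. q - r" 1 r "\<lambda>t. f (a + r *\<^sub>R v + t *\<^sub>R v)" d] by simp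
qed

section \<open>Smooth functions of one vector variable\<close>

definition smooth_on :: "'a set \<Rightarrow> ('a::fin_dim_space \<Rightarrow> 'b::fin_dim_space) \<Rightarrow> bool"
  where "smooth_on U f \<longleftrightarrow> C_infinity 1 {x. x 0 \<in> U} (\<lambda>x. f (x 0))"

definition dd :: "('a::real_vector \<Rightarrow> 'b::real_normed_vector) \<Rightarrow> 'a \<Rightarrow> 'a \<Rightarrow> 'b"
  where "dd f a v = vector_derivative (\<lambda>t. f (a + t *\<^sub>R v)) (at 0)"

lemma open_proj_vimage:
  fixes U :: "'a::topological_space set"
  assumes "open U"
  shows "open {x :: nat \<Rightarrow> 'a. x i \<in> U}"
  using open_vimage[OF assms continuous_on_product_coordinates[of i]] by (simp add: vimage_def)

lemma pd_single: "pd 0 v (\<lambda>x. f (x 0)) = (\<lambda>x. dd f (x 0) v)"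
  by (simp add: pd_def dd_def fun_eq_iff)

lemma smooth_on_dd:
  assumes "open U" "smooth_on U f"
  shows "smooth_on U (\<lambda>a. dd f a v)"
    and "a \<in> U \<Longrightarrow> ((\<lambda>t. f (a + t *\<^sub>R v)) has_vector_derivative dd f a v) (at 0)"
    and "a \<in> U \<Longrightarrow> linear (dd f a)"
proof -
  note S = open_proj_vimage[OF assms(1), of 0] and f = assms(2)[unfolded smooth_on_def]
  show "smooth_on U (\<lambda>a. dd f a v)"
    using C_infinity_pd[OF S f, of 0 v] by (simp add: smooth_on_def pd_single)
  show "((\<lambda>t. f (a + t *\<^sub>R v)) has_vector_derivative dd f a v) (at 0)" if "a \<in> U"
    using pd_has_vector_derivative[OF S f, of 0 "\<lambda>_. a" v] that by (simp add: pd_single)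
  show "linear (dd f a)" if "a \<in> U"
  proof -
    have "Ck 1 (Suc 0) {x. x 0 \<in> U} (\<lambda>x. f (x 0))" using f unfolding C_infinity_def by blast
    from linear_pd[OF S _ this, of "\<lambda>_. a" 0] that show ?thesis by (simp add: pd_single)
  qed
qed

lemma continuous_on_diag: "continuous_on U (\<lambda>a. (\<lambda>_. a) :: nat \<Rightarrow> 'a::topological_space)"
  by (intro continuous_on_coordinatewise_then_product continuous_on_id)

lemma smooth_on_continuous:
  assumes "smooth_on U f"
  shows "continuous_on U f"
proof -
  have "continuous_on U (\<lambda>a. (\<lambda>x. f (x 0)) (\<lambda>_. a))"
    by (rule continuous_on_compose2[OF C_infinity_continuous[OF assms[unfolded smooth_on_def]] continuous_on_diag]) auto
  then show ?thesis by simp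
qed

lemma smooth_on_compose_C_infinity:
  assumes "open U" "smooth_on U f" "open S" "C_infinity n S u" "\<And>x. x \<in> S \<Longrightarrow> u x \<in> U"
  shows "C_infinity n S (\<lambda>x. f (u x))"
  using C_infinity_compose[OF open_proj_vimage[OF assms(1), of 0] assms(3), of "\<lambda>x i. if i = 0 then u x else 0"
      1 "\<lambda>x. f (x 0)" n] assms
  by (simp add: smooth_on_def)

text \<open>Continuous directional derivatives give a Frechet derivative: apply the mean value bound
  on the segment from \<open>a\<close> to \<open>y\<close> to \<open>f\<close> minus its linear
  part.\<close>

lemma smooth_on_has_derivative:
  fixes f :: "'a::fin_dim_space \<Rightarrow> 'b::fin_dim_space"
  assumes "open U" "smooth_on U f" "a \<in> U"
  shows "(f has_derivative dd f a) (at a)"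
proof -
  have lin: "linear (dd f x)" if "x \<in> U" for x by (rule smooth_on_dd(3)[OF assms(1,2) that])
  \<comment> \<open>A continuous bound for the operator norm of \<open>dd f x - dd f a\<close>,
    computed on the finite frame; it vanishes at \<open>x = a\<close>.\<close>
  let ?m = "\<lambda>x. \<Sum>b\<in>frame. norm (b::'a) * norm (dd f x b - dd f a b)"
  have cont: "continuous_on U ?m"
    by (intro continuous_intros smooth_on_continuous smooth_on_dd assms)
  have m: "norm (dd f x v - dd f a v) \<le> norm v * ?m x" if "x \<in> U" for x v
  proof -
    have "dd f x v - dd f a v = (\<Sum>b\<in>frame. (v \<bullet> b) *\<^sub>R (dd f x b - dd f a b))"
      by (simp add: linear_frame_expansion[OF lin[OF that], of v]
        linear_frame_expansion[OF lin[OF assms(3)], of v] scaleR_diff_right sum_subtractf)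
    also have "norm \<dots> \<le> (\<Sum>b\<in>frame. norm v * (norm b * norm (dd f x b - dd f a b)))"
      by (intro sum_norm_le) (simp add: Cauchy_Schwarz_ineq2 mult_right_mono flip: mult.assoc)
    finally show ?thesis by (simp add: sum_distrib_left)
  qed
  show ?thesis unfolding has_derivative_at_alt
  proof (intro conjI allI impI)
    show "bounded_linear (dd f a)" by (rule linear_imp_bounded_linear[OF lin[OF assms(3)]])
    fix e :: real assume "e > 0"
    have "open {x \<in> U. ?m x < e}"
    proof -
      have "open (U \<inter> ?m -` {..<e})" by (rule continuous_open_preimage[OF cont assms(1) open_lessThan])
      moreover have "U \<inter> ?m -` {..<e} = {x \<in> U. ?m x < e}" by auto
      ultimately show ?thesis by simp
    qed
    moreover have "a \<in> {x \<in> U. ?m x < e}" using assms(3) \<open>e > 0\<close> by simp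
    ultimately obtain d where d: "d > 0" "ball a d \<subseteq> {x \<in> U. ?m x < e}"
      using open_contains_ball by blast
    have "norm (f y - f a - dd f a (y - a)) \<le> e * norm (y - a)" if "norm (y - a) < d" for y
    proof -
      let ?g = "\<lambda>r. f (a + r *\<^sub>R (y - a)) - r *\<^sub>R dd f a (y - a)"
      have "norm (?g 1 - ?g 0) \<le> (e * norm (y - a)) * norm (1 - 0 :: real)"
      proof (rule differentiable_bound[of "{0..1}" ?g
            "\<lambda>r h. h *\<^sub>R (dd f (a + r *\<^sub>R (y - a)) (y - a) - dd f a (y - a))"])
        fix r :: real assume r: "r \<in> {0..1}"
        let ?x = "a + r *\<^sub>R (y - a)"
        have "norm (r *\<^sub>R (y - a)) < d"
          using r that by simp (meson le_less_trans mult_left_le_one_le norm_ge_zero)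
        then have "?x \<in> ball a d" by (simp add: dist_norm)
        then have x: "?x \<in> U" "?m ?x < e" using d by auto
        have "((\<lambda>r. f (a + r *\<^sub>R (y - a))) has_vector_derivative dd f ?x (y - a)) (at r)"
          by (rule has_vector_derivative_at_shift[OF smooth_on_dd(2)[OF assms(1,2) x(1)]])
        then have "(?g has_vector_derivative dd f ?x (y - a) - dd f a (y - a)) (at r)"
          by (auto intro!: derivative_eq_intros)
        then show "(?g has_derivative (\<lambda>h. h *\<^sub>R (dd f ?x (y - a) - dd f a (y - a)))) (at r within {0..1})"
          unfolding has_vector_derivative_def by (rule has_derivative_at_withinI)
        show "onorm (\<lambda>h. h *\<^sub>R (dd f ?x (y - a) - dd f a (y - a))) \<le> e * norm (y - a)"
        proof (rule onorm_le)
          fix h :: real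
          have "norm (dd f ?x (y - a) - dd f a (y - a)) \<le> norm (y - a) * e"
            using m[OF x(1), of "y - a"] mult_left_mono[OF less_imp_le[OF x(2)], of "norm (y - a)"] by simp
          then show "norm (h *\<^sub>R (dd f ?x (y - a) - dd f a (y - a))) \<le> e * norm (y - a) * norm h"
            using mult_left_mono[of "norm (dd f ?x (y - a) - dd f a (y - a))" "norm (y - a) * e" "\<bar>h\<bar>"]
            by (simp add: mult.commute mult.left_commute)
        qed
      qed auto
      then show ?thesis by (simp add: algebra_simps)
    qed
    with d(1) show "\<exists>d>0. \<forall>y. norm (y - a) < d \<longrightarrow> norm (f y - f a - dd f a (y - a)) \<le> e * norm (y - a)"
      by blast
  qed
qed

subsection \<open>Families of invertible maps\<close>

text \<open>Makes the dimension arguments of \<open>finite_dimensional_vector_space\<close>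
  applicable to this class.\<close>

lemma fin_dim_basis:
  obtains B :: "'a::fin_dim_space set" where "finite_dimensional_vector_space ((*\<^sub>R) :: real \<Rightarrow> 'a \<Rightarrow> 'a) B"
proof -
  obtain B :: "'a set" where "B \<subseteq> UNIV" and B: "independent B" "UNIV \<subseteq> span B"
    by (rule maximal_independent_subset)
  have "x \<in> span frame" for x :: 'a
    by (subst frame_expansion[symmetric]) (intro span_sum span_scale span_base)
  then have "finite B"
    by (intro independent_span_bound[OF finite_frame B(1), THEN conjunct1] subsetI)
  have "finite_dimensional_vector_space ((*\<^sub>R) :: real \<Rightarrow> 'a \<Rightarrow> 'a) B"
  proof (intro finite_dimensional_vector_space.intro finite_dimensional_vector_space_axioms.intro)
    show "vector_space ((*\<^sub>R) :: real \<Rightarrow> 'a \<Rightarrow> 'a)" by (rule real_vector.vector_space_axioms)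
    show "\<not> module.dependent (*\<^sub>R) B" using B(1) by (simp add: dependent_raw_def)
    show "module.span (*\<^sub>R) B = UNIV" using B(2) by (auto simp: span_raw_def)
  qed (rule \<open>finite B\<close>)
  then show ?thesis by (rule that)
qed

lemma
  fixes f :: "'a::fin_dim_space \<Rightarrow> 'a"
  assumes "linear f"
  shows linear_inj_imp_surj: "inj f \<Longrightarrow> surj f"
    and linear_surj_imp_inj: "surj f \<Longrightarrow> inj f"
proof -
  obtain B :: "'a set" where "finite_dimensional_vector_space ((*\<^sub>R) :: real \<Rightarrow> 'a \<Rightarrow> 'a) B"
    by (rule fin_dim_basis)
  then interpret B: finite_dimensional_vector_space "(*\<^sub>R) :: real \<Rightarrow> 'a \<Rightarrow> 'a" B .
  interpret pr: finite_dimensional_vector_space_pair "(*\<^sub>R) :: real \<Rightarrow> 'a \<Rightarrow> 'a" B "(*\<^sub>R) :: real \<Rightarrow> 'a \<Rightarrow> 'a" B ..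
  have f: "Vector_Spaces.linear (*\<^sub>R) (*\<^sub>R) f" using assms by (simp add: linear_def)
  show "inj f \<Longrightarrow> surj f" using B.linear_inj_imp_surj[OF f] .
  show "surj f \<Longrightarrow> inj f" using B.linear_surj_imp_inj[OF f] .
qed

lemma Ck_compose_single:
  assumes "open U" "Ck 1 m {x. x 0 \<in> U} (\<lambda>x. f (x 0))" "open S" "Ck n m S u" "\<And>x. x \<in> S \<Longrightarrow> u x \<in> U"
  shows "Ck n m S (\<lambda>x. f (u x))"
proof -
  let ?u = "\<lambda>x (i::nat). if i = 0 then u x else 0"
  have "continuous_on S (\<lambda>x. ?u x i)" for i
    using Ck_imp_continuous[OF assms(4)] by (cases "i = 0") auto
  from Ck_compose[where u = ?u, OF open_proj_vimage[OF assms(1), of 0] assms(3) _ this _ assms(2), of n]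
  show ?thesis using assms(4,5) by simp
qed

text \<open>The bound by one half, instead of bare invertibility, bounds all inverses of a family by
  2. This uniformity gives continuity of the inverse in parameters, and one half is also the
  contraction constant in the inverse function theorem.\<close>

locale near_identity =
  fixes A :: "'w::fin_dim_space \<Rightarrow> 'w"
  assumes lin: "linear A" and near: "\<And>v. norm (A v - v) \<le> norm v / 2"
begin

lemma lower_bound: "norm v \<le> 2 * norm (A v)"
  using near[of v] norm_triangle_ineq2[of v "A v"] by (simp add: norm_minus_commute)

lemma bij: "bij A"
proof -
  have "inj A"
  proof (subst linear_injective_0[OF lin], intro allI impI)
    fix v assume "A v = 0"
    then show "v = 0" using lower_bound[of v] by simp
  qed
  then show ?thesis using linear_inj_imp_surj[OF lin] by (simp add: bij_def)
qed

lemma inv_right [simp]: "A (inv_into UNIV A v) = v" and inv_left [simp]: "inv_into UNIV A (A v) = v"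
  using bij by (simp_all add: bij_is_surj surj_f_inv_f bij_is_inj)

lemma norm_inv: "norm (inv_into UNIV A v) \<le> 2 * norm v"
  using lower_bound[of "inv_into UNIV A v"] by simp

lemma linear_inv: "linear (inv_into UNIV A)"
proof (rule linearI)
  fix a b and r :: real
  have "inv_into UNIV A (A (inv_into UNIV A a + inv_into UNIV A b)) = inv_into UNIV A (a + b)"
    by (simp only: linear_add[OF lin] inv_right)
  then show "inv_into UNIV A (a + b) = inv_into UNIV A a + inv_into UNIV A b" by simp
  have "inv_into UNIV A (A (r *\<^sub>R inv_into UNIV A a)) = inv_into UNIV A (r *\<^sub>R a)"
    by (simp only: linear_scale[OF lin] inv_right)
  then show "inv_into UNIV A (r *\<^sub>R a) = r *\<^sub>R inv_into UNIV A a" by simp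
qed

end

text \<open>The derivative of the inverse is minus inverse times derivative times inverse. Expanded
  in the frame, it involves inverses at fixed vectors only, so the induction hypothesis for all
  \<open>v\<close> covers it.\<close>

lemma near_identity_inverse_Ck:
  fixes A :: "(nat \<Rightarrow> 'p::fin_dim_space) \<Rightarrow> 'w::fin_dim_space \<Rightarrow> 'w"
  assumes S: "open S" and A: "\<And>x. x \<in> S \<Longrightarrow> near_identity (A x)"
    and smooth: "\<And>v. C_infinity n S (\<lambda>x. A x v)"
  shows "Ck n m S (\<lambda>x. inv_into UNIV (A x) v)"
proof (induction m arbitrary: v)
  note lower = near_identity.norm_inv[OF A] and lin_inv = near_identity.linear_inv[OF A]
  \<comment> \<open>The resolvent identity: a difference of inverses is inverse times difference
    times inverse.\<close>
  have diff: "inv_into UNIV (A x) v - inv_into UNIV (A y) v = inv_into UNIV (A x) (A y (inv_into UNIV (A y) v) - A x (inv_into UNIV (A y) v))"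
    if "x \<in> S" "y \<in> S" for x y v
    using that A by (simp add: linear_diff[OF lin_inv] near_identity.inv_left near_identity.inv_right)
  have cont: "continuous_on S (\<lambda>x. inv_into UNIV (A x) v)" for v
    unfolding continuous_on
  proof
    fix y assume y: "y \<in> S"
    let ?w = "inv_into UNIV (A y) v"
    have "continuous_on S (\<lambda>x. A x ?w)" by (rule C_infinity_continuous[OF smooth])
    then have "((\<lambda>x. A x ?w) \<longlongrightarrow> A y ?w) (at y within S)"
      using y by (simp add: continuous_on)
    then have "((\<lambda>x. 2 * norm (A y ?w - A x ?w)) \<longlongrightarrow> 2 * norm (A y ?w - A y ?w)) (at y within S)"
      by (intro tendsto_intros)
    then have "((\<lambda>x. 2 * norm (A y ?w - A x ?w)) \<longlongrightarrow> 0) (at y within S)" by simp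
    moreover have "\<forall>\<^sub>F x in at y within S. norm (inv_into UNIV (A x) v - inv_into UNIV (A y) v) \<le> 2 * norm (A y ?w - A x ?w)"
      unfolding eventually_at_filter
    proof (intro always_eventually allI impI)
      fix x assume x: "x \<in> S"
      show "norm (inv_into UNIV (A x) v - inv_into UNIV (A y) v) \<le> 2 * norm (A y ?w - A x ?w)"
        unfolding diff[OF x y] by (rule lower[OF x])
    qed
    ultimately have "((\<lambda>x. inv_into UNIV (A x) v - inv_into UNIV (A y) v) \<longlongrightarrow> 0) (at y within S)"
      by (rule Lim_null_comparison[rotated])
    then show "((\<lambda>x. inv_into UNIV (A x) v) \<longlongrightarrow> inv_into UNIV (A y) v) (at y within S)"
      by (simp add: LIM_zero_iff)
  qed
  {
    case 0
    show ?case using cont by simp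
  next
    case (Suc m)
    \<comment> \<open>The derivative of the family in coordinate \<open>i\<close> and direction
      \<open>u\<close>, extended linearly from the frame.\<close>
    define A' where "A' i u x w = (\<Sum>b\<in>frame. (w \<bullet> b) *\<^sub>R pd i u (\<lambda>x. A x b) x)" for i u x w
    have linA: "linear (A x)" if "x \<in> S" for x using A[OF that] by (simp add: near_identity_def)
    have linA': "linear (A' i u x)" for i u x
      unfolding A'_def
      by (intro linearI) (simp_all add: inner_add_left scaleR_add_left sum.distrib scaleR_sum_right)
    show ?case
    proof (rule Ck_SucI[where f' = "\<lambda>i u x. - (\<Sum>b\<in>frame. (A' i u x (inv_into UNIV (A x) v) \<bullet> b) *\<^sub>R inv_into UNIV (A x) b)"])
      show "continuous_on S (\<lambda>x. inv_into UNIV (A x) v)" by (rule cont)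
    next
      fix i u assume i: "i < n"
      have "Ck n m S (pd i u (\<lambda>x. A x b))" for b
        using C_infinity_pd[OF S smooth i] by (simp add: C_infinity_def)
      then have "Ck n m S (\<lambda>x. \<Sum>b\<in>frame. (A' i u x (inv_into UNIV (A x) v) \<bullet> b) *\<^sub>R inv_into UNIV (A x) b)"
        unfolding A'_def by (intro Ck_sum Ck_scaleR Ck_inner_left Suc.IH)
      then show "Ck n m S (\<lambda>x. - (\<Sum>b\<in>frame. (A' i u x (inv_into UNIV (A x) v) \<bullet> b) *\<^sub>R inv_into UNIV (A x) b))"
        by (rule Ck_bounded_linear[OF bounded_linear_minus[OF bounded_linear_ident]])
      fix x assume x: "x \<in> S"
      let ?x = "\<lambda>t. x(i := x i + t *\<^sub>R u)" and ?w = "inv_into UNIV (A x) v"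
      have ev: "\<forall>\<^sub>F t in at 0. ?x t \<in> S"
        using open_upd_line[OF S, of x i u] x
        by (intro eventually_at_topological[THEN iffD2] exI[of _ "{t. ?x t \<in> S}"]) simp
      have x_lim: "(?x \<longlongrightarrow> x) (at 0)"
      proof -
        have "continuous_on UNIV ?x" by (intro continuous_on_upd continuous_intros)
        then have "\<forall>r. (?x \<longlongrightarrow> ?x r) (at r)" by (simp add: continuous_on)
        from this[rule_format, of 0] show ?thesis by (simp only: scaleR_zero_left add_0_right fun_upd_triv)
      qed
      have inv_lim: "((\<lambda>t. inv_into UNIV (A (?x t)) b) \<longlongrightarrow> inv_into UNIV (A x) b) (at 0)" for b
      proof -
        have "isCont (\<lambda>x. inv_into UNIV (A x) b) x"
          using cont[of b] S x by (simp add: continuous_on_eq_continuous_at)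
        then show ?thesis using x_lim by (rule isCont_tendsto_compose)
      qed
      have dA: "((\<lambda>t. A (?x t) ?w) has_vector_derivative A' i u x ?w) (at 0)"
      proof -
        have "((\<lambda>t. \<Sum>b\<in>frame. (?w \<bullet> b) *\<^sub>R A (?x t) b) has_vector_derivative A' i u x ?w) (at 0)"
          unfolding A'_def
          by (intro has_vector_derivative_sum bounded_linear.has_vector_derivative[OF bounded_linear_scaleR_right]
              pd_has_vector_derivative[OF S smooth i x])
        moreover have "open {t. ?x t \<in> S}" "0 \<in> {t. ?x t \<in> S}"
          using open_upd_line[OF S] x by simp_all
        ultimately show ?thesis
          by (rule has_vector_derivative_transform_within_open)
            (simp add: linear_frame_expansion[OF linA])
      qed
      have q: "((\<lambda>t. (A (?x t) ?w - A x ?w) /\<^sub>R t) \<longlongrightarrow> A' i u x ?w) (at 0)"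
        using dA unfolding has_vector_derivative_iff_slope by (simp only: scaleR_zero_left add_0_right fun_upd_triv)
      have "((\<lambda>t. - (\<Sum>b\<in>frame. (((A (?x t) ?w - A x ?w) /\<^sub>R t) \<bullet> b) *\<^sub>R inv_into UNIV (A (?x t)) b)) \<longlongrightarrow>
          - (\<Sum>b\<in>frame. (A' i u x ?w \<bullet> b) *\<^sub>R inv_into UNIV (A x) b)) (at 0)"
        by (intro tendsto_intros q inv_lim)
      moreover have "\<forall>\<^sub>F t in at 0. - (\<Sum>b\<in>frame. (((A (?x t) ?w - A x ?w) /\<^sub>R t) \<bullet> b) *\<^sub>R inv_into UNIV (A (?x t)) b) =
          (inv_into UNIV (A (?x t)) v - inv_into UNIV (A x) v) /\<^sub>R t"
        using ev
      proof eventually_elim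
        case (elim t)
        let ?B = "inv_into UNIV (A (?x t))"
        note li = lin_inv[OF elim]
        have 1: "(\<Sum>b\<in>frame. (((A (?x t) ?w - A x ?w) /\<^sub>R t) \<bullet> b) *\<^sub>R ?B b) = ?B ((A (?x t) ?w - A x ?w) /\<^sub>R t)"
          by (rule linear_frame_expansion[OF li, symmetric])
        have 2: "?B ((A (?x t) ?w - A x ?w) /\<^sub>R t) = ?B (A (?x t) ?w - A x ?w) /\<^sub>R t"
          by (rule linear_scale[OF li])
        have 3: "?B (A (?x t) ?w - A x ?w) = - ?B (A x ?w - A (?x t) ?w)"
          by (simp only: linear_diff[OF li] minus_diff_eq)
        have 4: "?B (A x ?w - A (?x t) ?w) = ?B v - inv_into UNIV (A x) v"
          by (rule diff[OF elim x, of v, symmetric])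
        show ?case unfolding 1 2 3 4 by (simp only: scaleR_minus_right minus_minus)
      qed
      ultimately have "((\<lambda>t. (inv_into UNIV (A (?x t)) v - inv_into UNIV (A x) v) /\<^sub>R t) \<longlongrightarrow>
          - (\<Sum>b\<in>frame. (A' i u x ?w \<bullet> b) *\<^sub>R inv_into UNIV (A x) b)) (at 0)"
        by (rule Lim_transform_eventually)
      then show "((\<lambda>t. inv_into UNIV (A (?x t)) v) has_vector_derivative
          - (\<Sum>b\<in>frame. (A' i u x ?w \<bullet> b) *\<^sub>R inv_into UNIV (A x) b)) (at 0)"
        unfolding has_vector_derivative_iff_slope by (simp only: scaleR_zero_left add_0_right fun_upd_triv)
    qed
  }
qed


lemma near_identity_inverse:
  assumes "open S" "\<And>x. x \<in> S \<Longrightarrow> near_identity (A x)" "\<And>v. C_infinity n S (\<lambda>x. A x v)"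
  shows "C_infinity n S (\<lambda>x. inv_into UNIV (A x) v)"
  unfolding C_infinity_def using near_identity_inverse_Ck[OF assms] by blast

lemma near_identity_criterion:
  assumes "linear A" "(\<Sum>b\<in>frame. norm b * norm (A b - b)) \<le> 1 / 2"
  shows "near_identity A"
proof (rule near_identity.intro[OF assms(1)])
  fix v
  have "A v - v = (\<Sum>b\<in>frame. (v \<bullet> b) *\<^sub>R A b) - (\<Sum>b\<in>frame. (v \<bullet> b) *\<^sub>R b)"
    by (simp only: linear_frame_expansion[OF assms(1), symmetric] frame_expansion)
  also have "\<dots> = (\<Sum>b\<in>frame. (v \<bullet> b) *\<^sub>R (A b - b))"
    by (simp add: scaleR_diff_right sum_subtractf)
  also have "norm \<dots> \<le> (\<Sum>b\<in>frame. norm v * (norm b * norm (A b - b)))"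
    by (intro sum_norm_le) (simp add: Cauchy_Schwarz_ineq2 mult_right_mono flip: mult.assoc)
  also have "\<dots> \<le> norm v * (1 / 2)"
    unfolding sum_distrib_left[symmetric] by (rule mult_left_mono[OF assms(2)]) simp
  finally show "norm (A v - v) \<le> norm v / 2" by simp
qed

lemma near_identity_neighbourhood:
  fixes A :: "'x::topological_space \<Rightarrow> 'w::fin_dim_space \<Rightarrow> 'w"
  assumes "open S" "x0 \<in> S" "\<And>x. x \<in> S \<Longrightarrow> linear (A x)" "\<And>v. continuous_on S (\<lambda>x. A x v)"
    "\<And>v. A x0 v = v"
  obtains U where "open U" "x0 \<in> U" "U \<subseteq> S" "\<And>x. x \<in> U \<Longrightarrow> near_identity (A x)"
proof
  let ?m = "\<lambda>x. \<Sum>b\<in>frame. norm b * norm (A x b - b)"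
  let ?U = "S \<inter> ?m -` {..<1/2}"
  have "continuous_on S ?m" by (intro continuous_intros assms)
  then show "open ?U" by (rule continuous_open_preimage[OF _ assms(1) open_lessThan])
  show "x0 \<in> ?U" using assms(2,5) by simp
  show "near_identity (A x)" if "x \<in> ?U" for x
    using that by (intro near_identity_criterion assms(3)) auto
qed auto

subsection \<open>The inverse function theorem\<close>

text \<open>With derivative the identity at \<open>x0\<close>, the map \<open>f\<close> minus the
  identity has Lipschitz constant one half on a small ball, and solving \<open>f x = y\<close>
  becomes a fixed point problem. The right inverse on \<open>V\<close> is what will provide local
  sections of the quotient map.\<close>

lemma smooth_local_inverse:
  fixes f :: "'w::fin_dim_space \<Rightarrow> 'w"
  assumes U: "open U" "x0 \<in> U" and f: "smooth_on U f" and d0: "\<And>v. dd f x0 v = v"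
  obtains V s where "open V" "f x0 \<in> V" "smooth_on V s" "s (f x0) = x0"
    "\<And>y. y \<in> V \<Longrightarrow> s y \<in> U" "\<And>y. y \<in> V \<Longrightarrow> f (s y) = y"
proof -
  have lin: "linear (dd f x)" if "x \<in> U" for x by (rule smooth_on_dd(3)[OF U(1) f that])
  have cont: "continuous_on U (\<lambda>x. dd f x v)" for v by (intro smooth_on_continuous smooth_on_dd(1) U f)
  obtain U1 where U1: "open U1" "x0 \<in> U1" "U1 \<subseteq> U" "\<And>x. x \<in> U1 \<Longrightarrow> near_identity (dd f x)"
    using near_identity_neighbourhood[OF U lin cont d0] by metis
  obtain r where r: "r > 0" "cball x0 r \<subseteq> U1" using U1(1,2) open_contains_cball by blast
  have lip: "norm ((f b - b) - (f a - a)) \<le> norm (b - a) / 2" if "a \<in> cball x0 r" "b \<in> cball x0 r" for a b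
  proof -
    let ?g = "\<lambda>q. f (a + q *\<^sub>R (b - a)) - (a + q *\<^sub>R (b - a))"
    have "norm (?g 1 - ?g 0) \<le> (norm (b - a) / 2) * norm (1 - 0 :: real)"
    proof (rule differentiable_bound[of "{0..1}" ?g
          "\<lambda>q h. h *\<^sub>R (dd f (a + q *\<^sub>R (b - a)) (b - a) - (b - a))"])
      fix q :: real assume q: "q \<in> {0..1}"
      let ?x = "a + q *\<^sub>R (b - a)"
      have "?x = (1 - q) *\<^sub>R a + q *\<^sub>R b" by (simp add: algebra_simps)
      then have "?x \<in> cball x0 r" using convexD[OF convex_cball that, of "1 - q" q] q by simp
      then have x: "?x \<in> U" "near_identity (dd f ?x)" using r U1 by auto
      have "((\<lambda>q. f (a + q *\<^sub>R (b - a))) has_vector_derivative dd f ?x (b - a)) (at q)"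
        by (rule has_vector_derivative_at_shift[OF smooth_on_dd(2)[OF U(1) f x(1)]])
      then have "(?g has_vector_derivative dd f ?x (b - a) - (b - a)) (at q)"
        by (auto intro!: derivative_eq_intros)
      then show "(?g has_derivative (\<lambda>h. h *\<^sub>R (dd f ?x (b - a) - (b - a)))) (at q within {0..1})"
        unfolding has_vector_derivative_def by (rule has_derivative_at_withinI)
      show "onorm (\<lambda>h. h *\<^sub>R (dd f ?x (b - a) - (b - a))) \<le> norm (b - a) / 2"
      proof (rule onorm_le)
        fix h :: real
        show "norm (h *\<^sub>R (dd f ?x (b - a) - (b - a))) \<le> norm (b - a) / 2 * norm h"
          using mult_left_mono[OF near_identity.near[OF x(2), of "b - a"], of "\<bar>h\<bar>"] by (simp add: mult.commute)
      qed
    qed auto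
    then show ?thesis by simp
  qed
  \<comment> \<open>The target radius is \<open>r / 2\<close> because the contraction moves the
    centre by at most that much, and adds at most another \<open>r / 2\<close> for other points of
    the ball.\<close>
  have ex: "\<exists>!x. x \<in> cball x0 r \<and> f x = y" if y: "y \<in> ball (f x0) (r / 2)" for y
  proof -
    have "\<exists>!x\<in>cball x0 r. y - (f x - x) = x"
    proof (rule Banach_fix[where c = "1/2"])
      show "complete (cball x0 r)" by (simp add: complete_eq_closed)
      show "(\<lambda>x. y - (f x - x)) ` cball x0 r \<subseteq> cball x0 r"
      proof clarify
        fix x assume x: "x \<in> cball x0 r"
        have "x0 - (y - (f x - x)) = (f x0 - y) + ((f x - x) - (f x0 - x0))" by simp
        also have "norm \<dots> \<le> norm (f x0 - y) + norm ((f x - x) - (f x0 - x0))" by (rule norm_triangle_ineq)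
        also have "\<dots> \<le> r / 2 + norm (x - x0) / 2"
          using y lip[of x0 x] x r(1) by (intro add_mono) (auto simp: dist_norm)
        also have "\<dots> \<le> r" using x by (simp add: dist_norm norm_minus_commute)
        finally show "y - (f x - x) \<in> cball x0 r" by (simp add: dist_norm)
      qed
      show "dist (y - (f a - a)) (y - (f b - b)) \<le> 1 / 2 * dist a b" if "a \<in> cball x0 r" "b \<in> cball x0 r" for a b
      proof -
        have "dist (y - (f a - a)) (y - (f b - b)) = norm ((f b - b) - (f a - a))"
          unfolding dist_norm by (rule arg_cong[where f = norm]) simp
        then show ?thesis using lip[OF that] by (simp add: dist_norm norm_minus_commute[of a b])
      qed
    qed (use r in auto)
    moreover have "y - (f x - x) = x \<longleftrightarrow> f x = y" for x by (auto simp: algebra_simps)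
    ultimately show ?thesis by simp
  qed
  define s where "s y = (THE x. x \<in> cball x0 r \<and> f x = y)" for y
  define V where "V = ball (f x0) (r / 2)"
  have s: "s y \<in> cball x0 r" "f (s y) = y" if "y \<in> V" for y
    using theI'[OF ex[of y]] that by (auto simp: s_def V_def)
  have V: "open V" "f x0 \<in> V" using r(1) by (auto simp: V_def)
  have s_lip: "norm (s y - s z) \<le> 2 * norm (y - z)" if "y \<in> V" "z \<in> V" for y z
  proof -
    have "s y - s z = (y - z) - ((f (s y) - s y) - (f (s z) - s z))"
      by (simp add: s that)
    then have "norm (s y - s z) \<le> norm (y - z) + norm ((f (s y) - s y) - (f (s z) - s z))"
      by (metis norm_triangle_ineq4)
    also have "\<dots> \<le> norm (y - z) + norm (s y - s z) / 2"
      using lip[OF s(1)[OF that(2)] s(1)[OF that(1)]] by simp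
    finally show ?thesis by simp
  qed
  have s_cont: "continuous_on V s"
  proof (rule continuous_onI)
    fix y and e :: real assume "y \<in> V" "e > 0"
    show "\<exists>d>0. \<forall>z\<in>V. dist z y < d \<longrightarrow> dist (s z) (s y) \<le> e"
    proof (intro exI[of _ "e / 2"] conjI ballI impI)
      fix z assume "z \<in> V" "dist z y < e / 2"
      then show "dist (s z) (s y) \<le> e" using s_lip[OF _ \<open>y \<in> V\<close>, of z] by (simp add: dist_norm)
    qed (use \<open>e > 0\<close> in simp)
  qed
  have sU: "s y \<in> U1" "s y \<in> U" if "y \<in> V" for y using s(1)[OF that] r(2) U1(3) by auto
  \<comment> \<open>Continuity of \<open>s\<close>, from the Lipschitz bound 2, suffices for
    differentiability of an inverse.\<close>
  have s_der: "(s has_derivative inv_into UNIV (dd f (s y))) (at y)" if y: "y \<in> V" for y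
  proof (rule has_derivative_inverse_basic[where f = f, OF _ _ _ _ V(1) y])
    note near = U1(4)[OF sU(1)[OF y]]
    show "(f has_derivative dd f (s y)) (at (s y))"
      by (rule smooth_on_has_derivative[OF U(1) f sU(2)[OF y]])
    show "bounded_linear (inv_into UNIV (dd f (s y)))"
      by (rule linear_imp_bounded_linear[OF near_identity.linear_inv[OF near]])
    show "inv_into UNIV (dd f (s y)) \<circ> dd f (s y) = id"
      by (simp add: fun_eq_iff near_identity.inv_left[OF near])
    show "f (s z) = z" if "z \<in> V" for z using s(2)[OF that] .
    show "continuous (at y) s" using s_cont V(1) y by (simp add: continuous_on_eq_continuous_at)
  qed
  note oV = open_proj_vimage[OF V(1), of 0] and oU1 = open_proj_vimage[OF U1(1), of 0]
  have inv_smooth: "Ck 1 m {x. x 0 \<in> U1} (\<lambda>x. inv_into UNIV (dd f (x 0)) v)" for m v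
  proof (rule near_identity_inverse_Ck[OF oU1])
    show "C_infinity 1 {x. x 0 \<in> U1} (\<lambda>x. dd f (x 0) v)" for v
      by (rule C_infinity_subset[OF smooth_on_dd(1)[OF U(1) f, unfolded smooth_on_def]]) (use U1(3) in auto)
  qed (use U1(4) in auto)
  \<comment> \<open>Bootstrapping: the derivative of \<open>s\<close> is a smooth expression in
    \<open>s y\<close>, so order \<open>m\<close> for \<open>s\<close> gives order \<open>m\<close>
    for the derivative and order \<open>m + 1\<close> for \<open>s\<close>.\<close>
  have "Ck 1 m {y. y 0 \<in> V} (\<lambda>y. s (y 0))" for m
  proof (induction m)
    case 0
    have "continuous_on {y :: nat \<Rightarrow> 'w. y 0 \<in> V} (\<lambda>y. s (y 0))"
      by (rule continuous_on_compose2[OF s_cont continuous_on_proj[OF continuous_on_id]]) auto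
    then show ?case by simp
  next
    case (Suc m)
    show ?case
    proof (rule Ck_SucI[where f' = "\<lambda>i v y. inv_into UNIV (dd f (s (y 0))) v"])
      show "continuous_on {y :: nat \<Rightarrow> 'w. y 0 \<in> V} (\<lambda>y. s (y 0))" using Suc by (rule Ck_imp_continuous)
      show "Ck 1 m {y. y 0 \<in> V} (\<lambda>y. inv_into UNIV (dd f (s (y 0))) v)" for v
      proof -
        show ?thesis
          by (rule Ck_compose_single[OF U1(1) inv_smooth oV Suc]) (use sU in auto)
      qed
      fix i v and y :: "nat \<Rightarrow> 'w" assume "i < (1::nat)" "y \<in> {y. y 0 \<in> V}"
      then have i: "i = 0" and y: "y 0 \<in> V" by auto
      have "((\<lambda>t. s (y 0 + t *\<^sub>R v)) has_vector_derivative inv_into UNIV (dd f (s (y 0))) v) (at 0)"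
      proof -
        have "((\<lambda>t. y 0 + t *\<^sub>R v) has_derivative (\<lambda>t. t *\<^sub>R v)) (at 0)"
          by (auto intro!: derivative_eq_intros)
        moreover have "(s has_derivative inv_into UNIV (dd f (s (y 0)))) (at (y 0 + 0 *\<^sub>R v))"
          using s_der[OF y] by simp
        ultimately have "((\<lambda>t. s (y 0 + t *\<^sub>R v)) has_derivative (\<lambda>t. inv_into UNIV (dd f (s (y 0))) (t *\<^sub>R v))) (at 0)"
          by (rule has_derivative_compose)
        then show ?thesis
          unfolding has_vector_derivative_def
          by (simp only: linear_scale[OF near_identity.linear_inv[OF U1(4)[OF sU(1)[OF y]]]])
      qed
      then show "((\<lambda>t. s ((y(i := y i + t *\<^sub>R v)) 0)) has_vector_derivative inv_into UNIV (dd f (s (y 0))) v) (at 0)"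
        by (simp add: i)
    qed
  qed
  then have "smooth_on V s" by (simp add: smooth_on_def C_infinity_def)
  moreover have "s (f x0) = x0"
    unfolding s_def by (rule the1_equality[OF ex]) (use r(1) in auto)
  ultimately show ?thesis using that[OF V _ _ sU(2) s(2)] by blast
qed

subsection \<open>Parameter integrals and symmetry of second derivatives\<close>

lemma continuous_on_slice:
  "continuous_on U (\<lambda>(x, t). (\<lambda>i. (x i, t)) :: nat \<Rightarrow> 'a::topological_space \<times> 'b::topological_space)"
  unfolding case_prod_beta
  by (intro continuous_on_coordinatewise_then_product continuous_on_Pair
      continuous_on_proj[OF continuous_on_fst] continuous_on_snd continuous_on_id)

lemma at_within_ball: "0 < d \<Longrightarrow> at (0::real) within ball 0 d = at 0"
  by (rule at_within_open) simp_all

text \<open>The integration variable is carried as second component of every coordinate, so that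
  \<open>Ck\<close> for \<open>F\<close> already contains the joint continuity that differentiation
  under the integral needs. Directions \<open>(v, 0)\<close> leave that variable fixed.\<close>

lemma Ck_integral:
  fixes F :: "(nat \<Rightarrow> 'p::fin_dim_space \<times> real) \<Rightarrow> 'b::fin_dim_space"
  assumes T: "open T" and S: "open S" and ST: "\<And>x t. x \<in> S \<Longrightarrow> t \<in> {0..1} \<Longrightarrow> (\<lambda>i. (x i, t)) \<in> T"
  shows "Ck n m T F \<Longrightarrow> Ck n m S (\<lambda>x. integral {0..1} (\<lambda>t. F (\<lambda>i. (x i, t))))"
proof (induction m arbitrary: F)
  case 0
  have "continuous_on (S \<times> cbox 0 1) (\<lambda>(x, t). F (\<lambda>i. (x i, t)))"
    using continuous_on_compose2[OF Ck_imp_continuous[OF 0] continuous_on_slice, of "S \<times> cbox 0 1"] ST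
    by (simp add: case_prod_beta image_subset_iff)
  from integral_continuous_on_param[OF this] show ?case by simp
next
  case (Suc m)
  have cont: "continuous_on (S \<times> cbox 0 1) (\<lambda>(x, t). f (\<lambda>i. (x i, t)))" if "continuous_on T f"
    for f :: "(nat \<Rightarrow> 'p \<times> real) \<Rightarrow> 'b"
    using continuous_on_compose2[OF that continuous_on_slice, of "S \<times> cbox 0 1"] ST
    by (simp add: case_prod_beta image_subset_iff)
  have cont1: "continuous_on (cbox 0 1) (\<lambda>t. f (\<lambda>i. (x i, t)))" if "continuous_on T f" "x \<in> S"
    for f :: "(nat \<Rightarrow> 'p \<times> real) \<Rightarrow> 'b" and x
  proof -
    have "continuous_on (cbox 0 1) (\<lambda>t. (\<lambda>(x, t). f (\<lambda>i. (x i, t))) (x, t))"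
      by (rule continuous_on_compose2[OF cont[OF that(1)]]) (use that in \<open>auto intro!: continuous_intros\<close>)
    then show ?thesis by simp
  qed
  show ?case
  proof (rule Ck_SucI[where f' = "\<lambda>i v x. integral {0..1} (\<lambda>t. pd i (v, 0) F (\<lambda>i. (x i, t)))"])
    show "continuous_on S (\<lambda>x. integral {0..1} (\<lambda>t. F (\<lambda>i. (x i, t))))"
      using integral_continuous_on_param[OF cont[OF Ck_imp_continuous[OF Suc.prems]]] by simp
  next
    fix i v assume i: "i < n"
    have pd: "Ck n m T (pd i (v, 0) F)"
      "\<And>y. y \<in> T \<Longrightarrow> ((\<lambda>t. F (y(i := y i + t *\<^sub>R (v, 0)))) has_vector_derivative pd i (v, 0) F y) (at 0)"
      using Suc.prems i unfolding Ck_Suc_iff[OF T] by blast+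
    show "Ck n m S (\<lambda>x. integral {0..1} (\<lambda>t. pd i (v, 0) F (\<lambda>i. (x i, t))))"
      by (rule Suc.IH[OF pd(1)])
    fix x assume x: "x \<in> S"
    let ?x = "\<lambda>s. x(i := x i + s *\<^sub>R v)"
    have "open {s. ?x s \<in> S}" "0 \<in> {s. ?x s \<in> S}" using open_upd_line[OF S] x by simp_all
    then obtain d where d: "d > 0" "ball 0 d \<subseteq> {s. ?x s \<in> S}" using open_contains_ball by blast
    have xs: "?x s \<in> S" if "s \<in> ball 0 d" for s using d(2) that by blast
    have "((\<lambda>s. integral (cbox 0 1) (\<lambda>t. F (\<lambda>k. (?x s k, t)))) has_vector_derivative
        integral (cbox 0 1) (\<lambda>t. pd i (v, 0) F (\<lambda>k. (?x 0 k, t)))) (at 0 within ball 0 d)"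
    proof (rule leibniz_rule_vector_derivative[where f = "\<lambda>s t. F (\<lambda>k. (?x s k, t))"
          and fx = "\<lambda>s t. pd i (v, 0) F (\<lambda>k. (?x s k, t))"])
      fix s t :: real assume s: "s \<in> ball 0 d" and t: "t \<in> cbox 0 1"
      let ?y = "\<lambda>k. (?x s k, t)"
      have y: "?y \<in> T" by (rule ST[OF xs[OF s]]) (use t in simp)
      \<comment> \<open>The shape \<open>0 + s *\<^sub>R 1 + h *\<^sub>R 1\<close> matches
        \<open>has_vector_derivative_at_shift\<close> with base point \<open>0\<close> and direction
        \<open>1\<close>.\<close>
      have eq: "?y(i := ?y i + h *\<^sub>R (v, 0)) = (\<lambda>k. (?x (0 + s *\<^sub>R 1 + h *\<^sub>R 1) k, t))" for h
        by (auto simp: fun_eq_iff algebra_simps)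
      define G where "G s = F (\<lambda>k. (?x s k, t))" for s
      have "((\<lambda>h. G (0 + s *\<^sub>R 1 + h *\<^sub>R 1)) has_vector_derivative pd i (v, 0) F ?y) (at 0)"
        using pd(2)[OF y] unfolding eq G_def .
      from has_vector_derivative_at_shift[OF this]
      have "(G has_vector_derivative pd i (v, 0) F ?y) (at s)"
        by (simp only: add_0_left real_scaleR_def mult_1_right)
      then show "((\<lambda>s. F (\<lambda>k. (?x s k, t))) has_vector_derivative pd i (v, 0) F ?y) (at s within ball 0 d)"
        unfolding G_def by (rule has_vector_derivative_at_within)
    next
      fix s :: real assume "s \<in> ball 0 d"
      from cont1[OF Ck_imp_continuous[OF Suc.prems] xs[OF this]]
      show "(\<lambda>t. F (\<lambda>k. (?x s k, t))) integrable_on cbox 0 1" by (rule integrable_continuous)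
    next
      have "continuous_on (ball 0 d \<times> cbox 0 1) (\<lambda>p. (\<lambda>(x, t). pd i (v, 0) F (\<lambda>i. (x i, t))) (?x (fst p), snd p))"
      proof (rule continuous_on_compose2[OF cont[OF Ck_imp_continuous[OF pd(1)]]])
        show "continuous_on (ball 0 d \<times> cbox 0 (1::real)) (\<lambda>p. (?x (fst p), snd p))"
        proof (rule continuous_on_Pair)
          show "continuous_on (ball 0 d \<times> cbox 0 (1::real)) (\<lambda>p. ?x (fst p))"
            by (rule continuous_on_upd[OF continuous_on_const]) (intro continuous_intros)
          show "continuous_on (ball 0 d \<times> cbox 0 (1::real)) (\<lambda>p. snd p)" by (intro continuous_intros)
        qed
        show "(\<lambda>p. (?x (fst p), snd p)) ` (ball 0 d \<times> cbox 0 (1::real)) \<subseteq> S \<times> cbox 0 (1::real)"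
        proof
          fix q assume "q \<in> (\<lambda>p. (?x (fst p), snd p)) ` (ball 0 d \<times> cbox 0 (1::real))"
          then obtain p where p: "q = (?x (fst p), snd p)" "p \<in> ball 0 d \<times> cbox 0 (1::real)" by (rule imageE)
          then have "fst p \<in> ball 0 d" "snd p \<in> cbox 0 (1::real)" by (simp_all only: mem_Times_iff)
          then show "q \<in> S \<times> cbox 0 (1::real)" unfolding p(1) using xs by (intro SigmaI)
        qed
      qed
      then show "continuous_on (ball 0 d \<times> cbox 0 1) (\<lambda>(s, t). pd i (v, 0) F (\<lambda>k. (?x s k, t)))"
        by (simp add: case_prod_beta)
    qed (use d(1) in simp_all)
    then show "((\<lambda>s. integral {0..1} (\<lambda>t. F (\<lambda>k. (?x s k, t)))) has_vector_derivative
        integral {0..1} (\<lambda>t. pd i (v, 0) F (\<lambda>k. (x k, t)))) (at 0)"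
      using at_within_ball[OF d(1)]
      by (simp only: box_real scaleR_zero_left add_0_right fun_upd_triv)
  qed
qed

lemma C_infinity_integral:
  fixes F :: "(nat \<Rightarrow> 'p::fin_dim_space \<times> real) \<Rightarrow> 'b::fin_dim_space"
  assumes "open T" "open S" "\<And>x t. x \<in> S \<Longrightarrow> t \<in> {0..1} \<Longrightarrow> (\<lambda>i. (x i, t)) \<in> T" "C_infinity n T F"
  shows "C_infinity n S (\<lambda>x. integral {0..1} (\<lambda>t. F (\<lambda>i. (x i, t))))"
  using Ck_integral[OF assms(1-3)] assms(4) unfolding C_infinity_def by blast

text \<open>Write a difference of \<open>f\<close> in direction \<open>w\<close> as an integral,
  differentiate it in direction \<open>v\<close> under the integral, divide by \<open>t\<close> and
  let \<open>t\<close> tend to 0. This yields one mixed derivative as the limit of difference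
  quotients of the other.\<close>

lemma dd_commute:
  fixes f :: "'a::fin_dim_space \<Rightarrow> 'b::fin_dim_space"
  assumes U: "open U" "a \<in> U" and f: "smooth_on U f"
  shows "dd (\<lambda>b. dd f b v) a w = dd (\<lambda>b. dd f b w) a v"
proof -
  obtain e where e: "e > 0" "ball a e \<subseteq> U" using U open_contains_ball by blast
  \<comment> \<open>Keeps all points \<open>a + s *\<^sub>R v + (r * t) *\<^sub>R w\<close> in the
    ball of radius \<open>e\<close>; the summand 1 keeps the denominator positive when both
    directions vanish.\<close>
  define d where "d = e / (2 * (norm v + norm w + 1))"
  have pos: "norm v + norm w + 1 > 0" by (simp add: add_nonneg_pos)
  have d: "d > 0" using e(1) pos by (simp add: d_def)
  have inU: "a + s *\<^sub>R v + (r * t) *\<^sub>R w \<in> U" if "\<bar>s\<bar> \<le> d" "\<bar>t\<bar> \<le> d" "r \<in> {0..1}" for s t r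
  proof -
    have rt: "\<bar>r * t\<bar> \<le> d" using that mult_left_le_one_le[of "\<bar>t\<bar>" "\<bar>r\<bar>"] by (simp add: abs_mult)
    have "norm (s *\<^sub>R v + (r * t) *\<^sub>R w) \<le> d * norm v + d * norm w"
      using norm_triangle_ineq[of "s *\<^sub>R v" "(r * t) *\<^sub>R w"] mult_right_mono[OF that(1), of "norm v"]
        mult_right_mono[OF rt, of "norm w"] by simp
    also have "\<dots> < d * (2 * (norm v + norm w + 1))" using d by (simp add: algebra_simps add_nonneg_pos)
    also have "\<dots> = e" using pos by (simp add: d_def)
    finally have "dist (a + s *\<^sub>R v + (r * t) *\<^sub>R w) a < e" by (simp add: dist_norm add.assoc)
    then have "a + s *\<^sub>R v + (r * t) *\<^sub>R w \<in> ball a e" by (simp only: mem_ball dist_commute)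
    then show ?thesis using e(2) by blast
  qed
  have cdd: "continuous_on U (\<lambda>b. dd f b w)" by (intro smooth_on_continuous smooth_on_dd(1) U f)
  have sm: "smooth_on U (\<lambda>b. dd f b w)" by (rule smooth_on_dd(1)[OF U(1) f])
  let ?h = "\<lambda>b. dd (\<lambda>b. dd f b w) b v"
  have ch: "continuous_on U ?h" by (intro smooth_on_continuous smooth_on_dd(1) U sm)
  have e1: "f (a + s *\<^sub>R v + t *\<^sub>R w) - f (a + s *\<^sub>R v) = t *\<^sub>R integral {0..1} (\<lambda>r. dd f (a + s *\<^sub>R v + (r * t) *\<^sub>R w) w)"
    if "\<bar>s\<bar> \<le> d" "\<bar>t\<bar> \<le> d" for s t
  proof -
    have "((\<lambda>r. f (a + s *\<^sub>R v + r *\<^sub>R (t *\<^sub>R w))) has_vector_derivative t *\<^sub>R dd f (a + s *\<^sub>R v + (r * t) *\<^sub>R w) w) (at r within {0..1})"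
      if "r \<in> {0..1}" for r
    proof -
      note x = inU[OF \<open>\<bar>s\<bar> \<le> d\<close> \<open>\<bar>t\<bar> \<le> d\<close> that]
      have "((\<lambda>r. f (a + s *\<^sub>R v + r *\<^sub>R (t *\<^sub>R w))) has_vector_derivative dd f (a + s *\<^sub>R v + (r * t) *\<^sub>R w) (t *\<^sub>R w)) (at r)"
        by (rule has_vector_derivative_at_shift) (use smooth_on_dd(2)[OF U(1) f x, of "t *\<^sub>R w"] in simp)
      then show ?thesis
        by (simp add: linear_scale[OF smooth_on_dd(3)[OF U(1) f x]] has_vector_derivative_at_within)
    qed
    from fundamental_theorem_of_calculus[OF _ this]
    have "((\<lambda>r. t *\<^sub>R dd f (a + s *\<^sub>R v + (r * t) *\<^sub>R w) w) has_integral
        f (a + s *\<^sub>R v + t *\<^sub>R w) - f (a + s *\<^sub>R v)) {0..1}" by simp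
    then show ?thesis by (metis integral_cmul integral_unique)
  qed
  have e2: "dd f (a + t *\<^sub>R w) v - dd f a v = t *\<^sub>R integral {0..1} (\<lambda>r. ?h (a + (r * t) *\<^sub>R w))"
    if t: "\<bar>t\<bar> \<le> d" for t
  proof -
    let ?I = "\<lambda>s. integral (cbox 0 1) (\<lambda>r. dd f (a + s *\<^sub>R v + (r * t) *\<^sub>R w) w)"
    have "(?I has_vector_derivative integral (cbox 0 1) (\<lambda>r. ?h (a + 0 *\<^sub>R v + (r * t) *\<^sub>R w))) (at 0 within ball 0 d)"
    proof (rule leibniz_rule_vector_derivative[where f = "\<lambda>s r. dd f (a + s *\<^sub>R v + (r * t) *\<^sub>R w) w"
          and fx = "\<lambda>s r. ?h (a + s *\<^sub>R v + (r * t) *\<^sub>R w)"])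
      fix s r :: real assume "s \<in> ball 0 d" "r \<in> cbox 0 1"
      then have "a + s *\<^sub>R v + (r * t) *\<^sub>R w \<in> U" by (intro inU t) auto
      moreover have eq: "a + s *\<^sub>R v + (r * t) *\<^sub>R w = a + (r * t) *\<^sub>R w + s *\<^sub>R v" for s
        by (simp add: add_ac)
      ultimately have x: "a + (r * t) *\<^sub>R w + s *\<^sub>R v \<in> U" by (simp only:)
      have "((\<lambda>s. (\<lambda>b. dd f b w) (a + (r * t) *\<^sub>R w + s *\<^sub>R v)) has_vector_derivative ?h (a + (r * t) *\<^sub>R w + s *\<^sub>R v)) (at s)"
        by (rule has_vector_derivative_at_shift[where f = "\<lambda>b. dd f b w" and a = "a + (r * t) *\<^sub>R w" and r = s and v = v,
            OF smooth_on_dd(2)[OF U(1) sm x, of v]])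
      then show "((\<lambda>s. dd f (a + s *\<^sub>R v + (r * t) *\<^sub>R w) w) has_vector_derivative ?h (a + s *\<^sub>R v + (r * t) *\<^sub>R w)) (at s within ball 0 d)"
        unfolding eq by (rule has_vector_derivative_at_within)
    next
      fix s :: real assume "s \<in> ball 0 d"
      then have "continuous_on (cbox 0 1) (\<lambda>r. dd f (a + s *\<^sub>R v + (r * t) *\<^sub>R w) w)"
        by (intro continuous_on_compose2[OF cdd, where s = "cbox 0 1"] continuous_intros image_subsetI inU t) auto
      then show "(\<lambda>r. dd f (a + s *\<^sub>R v + (r * t) *\<^sub>R w) w) integrable_on cbox 0 1" by (rule integrable_continuous)
    next
      show "continuous_on (ball 0 d \<times> cbox 0 1) (\<lambda>(s, r). ?h (a + s *\<^sub>R v + (r * t) *\<^sub>R w))"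
        unfolding case_prod_beta
        by (intro continuous_on_compose2[OF ch, where s = "ball 0 d \<times> cbox 0 1"] continuous_intros image_subsetI inU t) auto
    qed (use d in auto)
    then have I: "(?I has_vector_derivative integral (cbox 0 1) (\<lambda>r. ?h (a + (r * t) *\<^sub>R w))) (at 0)"
      by (simp only: at_within_ball[OF d] scaleR_zero_left add_0_right)
    have "((\<lambda>s. t *\<^sub>R ?I s) has_vector_derivative t *\<^sub>R integral (cbox 0 1) (\<lambda>r. ?h (a + (r * t) *\<^sub>R w))) (at 0)"
      by (rule bounded_linear.has_vector_derivative[OF bounded_linear_scaleR_right I])
    moreover have "((\<lambda>s. f (a + t *\<^sub>R w + s *\<^sub>R v) - f (a + s *\<^sub>R v)) has_vector_derivative dd f (a + t *\<^sub>R w) v - dd f a v) (at 0)"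
      by (intro has_vector_derivative_diff smooth_on_dd(2)[OF U(1) f] U(2)) (use inU[of 0 t 1] t d in simp)
    then have "((\<lambda>s. t *\<^sub>R ?I s) has_vector_derivative dd f (a + t *\<^sub>R w) v - dd f a v) (at 0)"
    proof (rule has_vector_derivative_transform_within_open)
      show "f (a + t *\<^sub>R w + s *\<^sub>R v) - f (a + s *\<^sub>R v) = t *\<^sub>R ?I s" if "s \<in> ball 0 d" for s
        using e1[of s t] that t by (simp add: add.commute add.left_commute)
    qed (use d in auto)
    ultimately show ?thesis using vector_derivative_unique_at by fastforce
  qed
  have "((\<lambda>t. dd f (a + t *\<^sub>R w) v) has_vector_derivative ?h a) (at 0)"
  proof -
    have "continuous_on (ball 0 d) (\<lambda>t. integral (cbox 0 1) (\<lambda>r. ?h (a + (r * t) *\<^sub>R w)))"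
    proof (rule integral_continuous_on_param)
      show "continuous_on (ball 0 d \<times> cbox 0 1) (\<lambda>(t, r). ?h (a + (r * t) *\<^sub>R w))"
        unfolding case_prod_beta
      proof (intro continuous_on_compose2[OF ch, where s = "ball 0 d \<times> cbox 0 1"] continuous_intros image_subsetI)
        fix p :: "real \<times> real" assume "p \<in> ball 0 d \<times> cbox 0 1"
        then show "a + (snd p * fst p) *\<^sub>R w \<in> U" using inU[of 0 "fst p" "snd p"] d by auto
      qed
    qed
    then have "((\<lambda>t. integral (cbox 0 1) (\<lambda>r. ?h (a + (r * t) *\<^sub>R w))) \<longlongrightarrow>
        integral (cbox 0 1) (\<lambda>r. ?h (a + (r * 0) *\<^sub>R w))) (at 0)"
      using d continuous_on_eq_continuous_at[OF open_ball] isCont_def centre_in_ball by blast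
    then have lim: "((\<lambda>t. integral (cbox 0 1) (\<lambda>r. ?h (a + (r * t) *\<^sub>R w))) \<longlongrightarrow> ?h a) (at 0)" by simp
    have "\<forall>\<^sub>F t in at 0. integral (cbox 0 1) (\<lambda>r. ?h (a + (r * t) *\<^sub>R w)) = (dd f (a + t *\<^sub>R w) v - dd f (a + 0 *\<^sub>R w) v) /\<^sub>R t"
      unfolding eventually_at
      by (intro exI[of _ d] conjI d ballI impI) (use e2 in \<open>simp add: dist_norm\<close>)
    from Lim_transform_eventually[OF lim this] show ?thesis
      unfolding has_vector_derivative_iff_slope .
  qed
  then show ?thesis unfolding dd_def[of "\<lambda>b. dd f b v"] by (rule vector_derivative_at)
qed

subsection \<open>Multilinear maps\<close>

definition multilinear :: "('e::real_vector list \<Rightarrow> 'v::real_vector) \<Rightarrow> bool"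
  where "multilinear \<alpha> \<longleftrightarrow> (\<forall>Xs. \<forall>i<length Xs. linear (\<lambda>X. \<alpha> (Xs[i := X])))"

lemma alternating_imp_multilinear: "alternating_multilinear \<alpha> \<Longrightarrow> multilinear \<alpha>"
  by (simp add: alternating_multilinear_def multilinear_def)

lemma multilinear_middle:
  assumes "multilinear \<alpha>"
  shows "linear (\<lambda>X. \<alpha> (Zs @ X # Ws))"
proof -
  have "linear (\<lambda>X. \<alpha> ((Zs @ undefined # Ws)[length Zs := X]))"
    using assms by (simp add: multilinear_def del: list_update_length)
  then show ?thesis by simp
qed

lemma multilinear_frame_expansion:
  fixes \<alpha> :: "'e::fin_dim_space list \<Rightarrow> 'v::real_vector"
  assumes "multilinear \<alpha>"
  shows "\<alpha> (Zs @ X # Ws) = (\<Sum>b\<in>frame. (X \<bullet> b) *\<^sub>R \<alpha> (Zs @ b # Ws))"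
  by (rule linear_frame_expansion[OF multilinear_middle[OF assms]])

text \<open>The moving arguments are expanded in the frame one by one. The constant frame vectors
  collect in the prefix \<open>Zs\<close>, over which the induction generalises.\<close>

lemma multilinear_C_infinity:
  fixes \<alpha> :: "(nat \<Rightarrow> 'p::fin_dim_space) \<Rightarrow> 'e::fin_dim_space list \<Rightarrow> 'v::fin_dim_space"
  assumes S: "open S" and lin: "\<And>x. x \<in> S \<Longrightarrow> multilinear (\<alpha> x)"
    and smooth: "\<And>Zs. C_infinity n S (\<lambda>x. \<alpha> x Zs)"
  shows "(\<And>F. F \<in> set Fs \<Longrightarrow> C_infinity n S F) \<Longrightarrow> C_infinity n S (\<lambda>x. \<alpha> x (Zs @ map (\<lambda>F. F x) Fs))"
proof (induction Fs arbitrary: Zs)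
  case Nil
  then show ?case using smooth by simp
next
  case (Cons F Fs)
  have "C_infinity n S (\<lambda>x. \<Sum>b\<in>frame. (F x \<bullet> b) *\<^sub>R \<alpha> x ((Zs @ [b]) @ map (\<lambda>F. F x) Fs))"
    by (intro C_infinity_sum C_infinity_scaleR C_infinity_inner_left Cons.IH) (use Cons.prems in simp_all)
  then have "C_infinity n S (\<lambda>x. \<Sum>b\<in>frame. (F x \<bullet> b) *\<^sub>R \<alpha> x (Zs @ b # map (\<lambda>F. F x) Fs))"
    by simp
  moreover have "(\<Sum>b\<in>frame. (F x \<bullet> b) *\<^sub>R \<alpha> x (Zs @ b # map (\<lambda>F. F x) Fs)) = \<alpha> x (Zs @ map (\<lambda>F. F x) (F # Fs))"
    if "x \<in> S" for x
    by (simp add: multilinear_frame_expansion[OF lin[OF that], of Zs "F x"])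
  ultimately show ?case by (rule iffD1[OF C_infinity_cong[OF S], rotated])
qed

text \<open>The product rule when the multilinear map and all its arguments move. The induction uses
  the same expansion: the first argument is replaced by a constant frame vector and joins the
  prefix.\<close>

lemma multilinear_derivative:
  fixes \<alpha> :: "real \<Rightarrow> 'e::fin_dim_space list \<Rightarrow> 'v::real_normed_vector"
  assumes lin: "\<And>t. multilinear (\<alpha> t)" and lin': "multilinear \<alpha>'"
    and der: "\<And>Zs. ((\<lambda>t. \<alpha> t Zs) has_vector_derivative \<alpha>' Zs) (at 0)"
  shows "(\<And>F. F \<in> set Fs \<Longrightarrow> (F has_vector_derivative F' F) (at 0)) \<Longrightarrow>
    ((\<lambda>t. \<alpha> t (Zs @ map (\<lambda>F. F t) Fs)) has_vector_derivative
      \<alpha>' (Zs @ map (\<lambda>F. F 0) Fs) + (\<Sum>j<length Fs. \<alpha> 0 (Zs @ (map (\<lambda>F. F 0) Fs)[j := F' (Fs ! j)]))) (at 0)"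
proof (induction Fs arbitrary: Zs)
  case Nil
  then show ?case using der by simp
next
  case (Cons F Fs)
  let ?m = "\<lambda>t. map (\<lambda>F. F t) Fs"
  let ?D = "\<lambda>b. \<alpha>' (Zs @ b # ?m 0) + (\<Sum>j<length Fs. \<alpha> 0 (Zs @ b # (?m 0)[j := F' (Fs ! j)]))"
  have F: "(F has_vector_derivative F' F) (at 0)" using Cons.prems by simp
  have inn: "((\<lambda>t. F t \<bullet> b) has_vector_derivative F' F \<bullet> b) (at 0)" for b
    by (rule bounded_linear.has_vector_derivative[OF bounded_linear_inner_left F])
  have IH: "((\<lambda>t. \<alpha> t (Zs @ b # ?m t)) has_vector_derivative ?D b) (at 0)" for b
    using Cons.IH[of "Zs @ [b]"] Cons.prems by simp
  have "((\<lambda>t. \<Sum>b\<in>frame. (F t \<bullet> b) *\<^sub>R \<alpha> t (Zs @ b # ?m t)) has_vector_derivative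
      (\<Sum>b\<in>frame. (F 0 \<bullet> b) *\<^sub>R ?D b + (F' F \<bullet> b) *\<^sub>R \<alpha> 0 (Zs @ b # ?m 0))) (at 0)"
    by (intro has_vector_derivative_sum bounded_bilinear.has_vector_derivative[OF bounded_bilinear_scaleR] inn IH)
  moreover have "(\<lambda>t. \<Sum>b\<in>frame. (F t \<bullet> b) *\<^sub>R \<alpha> t (Zs @ b # ?m t)) = (\<lambda>t. \<alpha> t (Zs @ F t # ?m t))"
    by (rule ext) (rule multilinear_frame_expansion[OF lin, symmetric])
  moreover have "(\<Sum>b\<in>frame. (F 0 \<bullet> b) *\<^sub>R ?D b + (F' F \<bullet> b) *\<^sub>R \<alpha> 0 (Zs @ b # ?m 0)) =
      \<alpha>' (Zs @ F 0 # ?m 0) + (\<Sum>j<length (F # Fs). \<alpha> 0 (Zs @ (F 0 # ?m 0)[j := F' ((F # Fs) ! j)]))"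
  proof -
    have "(\<Sum>j<length (F # Fs). \<alpha> 0 (Zs @ (F 0 # ?m 0)[j := F' ((F # Fs) ! j)])) =
        \<alpha> 0 (Zs @ F' F # ?m 0) + (\<Sum>j<length Fs. \<alpha> 0 (Zs @ F 0 # (?m 0)[j := F' (Fs ! j)]))"
      unfolding length_Cons sum.lessThan_Suc_shift by simp
    moreover have "(\<Sum>b\<in>frame. (F' F \<bullet> b) *\<^sub>R \<alpha> 0 (Zs @ b # ?m 0)) = \<alpha> 0 (Zs @ F' F # ?m 0)"
      by (rule multilinear_frame_expansion[OF lin, symmetric])
    moreover have "(\<Sum>b\<in>frame. (F 0 \<bullet> b) *\<^sub>R \<alpha>' (Zs @ b # ?m 0)) = \<alpha>' (Zs @ F 0 # ?m 0)"
      by (rule multilinear_frame_expansion[OF lin', symmetric])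
    moreover have "(\<Sum>b\<in>frame. (F 0 \<bullet> b) *\<^sub>R (\<Sum>j<length Fs. \<alpha> 0 (Zs @ b # (?m 0)[j := F' (Fs ! j)]))) =
        (\<Sum>j<length Fs. \<alpha> 0 (Zs @ F 0 # (?m 0)[j := F' (Fs ! j)]))"
      unfolding scaleR_sum_right
      by (subst sum.swap) (intro sum.cong refl multilinear_frame_expansion[OF lin, symmetric])
    ultimately show ?thesis by (simp add: sum.distrib scaleR_add_right)
  qed
  ultimately show ?case by simp
qed

lemma multilinear_limit:
  fixes \<alpha> :: "real \<Rightarrow> 'e::real_vector list \<Rightarrow> 'v::real_normed_vector"
  assumes lin: "\<And>t. multilinear (\<alpha> t)"
    and der: "\<And>Zs. ((\<lambda>t. \<alpha> t Zs) has_vector_derivative \<alpha>' Zs) (at 0)"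
  shows "multilinear \<alpha>'"
  unfolding multilinear_def
proof (intro allI impI linearI)
  fix Xs :: "'e list" and i X Y and r :: real assume i: "i < length Xs"
  have l: "linear (\<lambda>X. \<alpha> t (Xs[i := X]))" for t using lin i by (simp add: multilinear_def)
  have "((\<lambda>t. \<alpha> t (Xs[i := X + Y])) has_vector_derivative \<alpha>' (Xs[i := X]) + \<alpha>' (Xs[i := Y])) (at 0)"
    unfolding linear_add[OF l] by (rule has_vector_derivative_add[OF der der])
  from vector_derivative_unique_at[OF der this]
  show "\<alpha>' (Xs[i := X + Y]) = \<alpha>' (Xs[i := X]) + \<alpha>' (Xs[i := Y])" .
  have "((\<lambda>t. \<alpha> t (Xs[i := r *\<^sub>R X])) has_vector_derivative r *\<^sub>R \<alpha>' (Xs[i := X])) (at 0)"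
    unfolding linear_scale[OF l] by (rule bounded_linear.has_vector_derivative[OF bounded_linear_scaleR_right der])
  from vector_derivative_unique_at[OF der this]
  show "\<alpha>' (Xs[i := r *\<^sub>R X]) = r *\<^sub>R \<alpha>' (Xs[i := X])" .
qed

subsection \<open>Alternating maps\<close>

lemma alternating_eq_0: "alternating_multilinear \<alpha> \<Longrightarrow> \<not> distinct Xs \<Longrightarrow> \<alpha> Xs = 0"
  by (simp add: alternating_multilinear_def)

text \<open>Polarisation: expand the zero value on the repeated argument
  \<open>a + b\<close>.\<close>

lemma alternating_swap:
  assumes "alternating_multilinear \<alpha>"
  shows "\<alpha> (Xs @ a # b # Zs) = - \<alpha> (Xs @ b # a # Zs)"
proof -
  note ml = alternating_imp_multilinear[OF assms] and zero = alternating_eq_0[OF assms]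
  have l1: "\<alpha> (Xs @ (x + y) # z # Zs) = \<alpha> (Xs @ x # z # Zs) + \<alpha> (Xs @ y # z # Zs)" for x y z
    by (rule linear_add[OF multilinear_middle[OF ml]])
  have l2: "\<alpha> (Xs @ z # (x + y) # Zs) = \<alpha> (Xs @ z # x # Zs) + \<alpha> (Xs @ z # y # Zs)" for x y z
    using linear_add[OF multilinear_middle[OF ml, of "Xs @ [z]" Zs]] by simp
  have "\<alpha> (Xs @ (a + b) # (a + b) # Zs) = 0" "\<alpha> (Xs @ a # a # Zs) = 0" "\<alpha> (Xs @ b # b # Zs) = 0"
    by (simp_all add: zero)
  then have "\<alpha> (Xs @ a # b # Zs) + \<alpha> (Xs @ b # a # Zs) = 0" by (simp add: l1 l2 add_ac)
  then show ?thesis by (simp add: eq_neg_iff_add_eq_0)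
qed

lemma alternating_move_to_front:
  assumes "alternating_multilinear \<alpha>"
  shows "\<alpha> (Xs @ Y # Zs) = (- 1) ^ length Xs *\<^sub>R \<alpha> (Y # Xs @ Zs)"
proof (induction Xs arbitrary: Zs rule: rev_induct)
  case (snoc x Xs)
  have "\<alpha> ((Xs @ [x]) @ Y # Zs) = - \<alpha> (Xs @ Y # x # Zs)"
    using alternating_swap[OF assms, of Xs x Y Zs] by simp
  then show ?case by (simp add: snoc)
qed simp

lemma omit_append: "omit (length Ps) (Ps @ x # Qs) = Ps @ Qs"
  by (simp add: omit_def)

lemma length_omit: "i < length Xs \<Longrightarrow> length (omit i Xs) = length Xs - 1"
  by (simp add: omit_def)

lemma map_omit: "map f (omit i Xs) = omit i (map f Xs)"
  by (simp add: omit_def take_map drop_map)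

lemma alternating_nth_omit:
  assumes "alternating_multilinear \<alpha>" "i < length Xs"
  shows "\<alpha> (Xs ! i # omit i Xs) = (- 1) ^ i *\<^sub>R \<alpha> Xs"
proof -
  have "\<alpha> (take i Xs @ Xs ! i # drop (Suc i) Xs) = (- 1) ^ i *\<^sub>R \<alpha> (Xs ! i # omit i Xs)"
    using alternating_move_to_front[OF assms(1), of "take i Xs" "Xs ! i" "drop (Suc i) Xs"] assms(2)
    by (simp add: omit_def)
  then have "\<alpha> Xs = (- 1) ^ i *\<^sub>R \<alpha> (Xs ! i # omit i Xs)"
    using id_take_nth_drop[OF assms(2)] by simp
  then show ?thesis by (simp flip: power_add mult_2 power_mult)
qed

lemma omit_list_update:
  assumes "i < length ws" "k < length ws"
  shows "omit i (ws[k := X]) = (if k < i then (omit i ws)[k := X] else if k = i then omit i ws else (omit i ws)[k - 1 := X])"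
  using assms by (intro nth_equalityI) (auto simp: omit_def nth_append nth_list_update min_def)

text \<open>The pattern of the exterior derivative, with \<open>D v\<close> in the role of the
  derivative of a form in direction \<open>v\<close>. For a repeated argument only the two terms
  that omit one of its copies can survive, and these cancel.\<close>

lemma alternation:
  fixes D :: "'w::real_vector \<Rightarrow> 'w list \<Rightarrow> 'v::real_vector"
  assumes alt: "\<And>v. alternating_multilinear (D v)" and lin: "\<And>ws. linear (\<lambda>v. D v ws)"
  shows "alternating_multilinear (\<lambda>ws. \<Sum>i<length ws. (- 1) ^ i *\<^sub>R D (ws ! i) (omit i ws))"
  unfolding alternating_multilinear_def
proof (intro conjI allI impI)
  fix ws :: "'w list" and k assume k: "k < length ws"
  have "linear (\<lambda>X. (- 1) ^ i *\<^sub>R D (ws[k := X] ! i) (omit i (ws[k := X])))" if i: "i < length ws" for i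
  proof (cases "k = i")
    case True
    then show ?thesis using i
      by (simp add: omit_list_update linear_compose_scale_right[OF lin])
  next
    case False
    define k' where "k' = (if k < i then k else k - 1)"
    have "linear (\<lambda>X. D (ws ! i) ((omit i ws)[k' := X]))"
      using alternating_imp_multilinear[OF alt] False k i
      by (auto simp: multilinear_def length_omit k'_def)
    then have "linear (\<lambda>X. (- 1) ^ i *\<^sub>R D (ws ! i) ((omit i ws)[k' := X]))"
      by (rule linear_compose_scale_right)
    moreover have "(- 1) ^ i *\<^sub>R D (ws[k := X] ! i) (omit i (ws[k := X])) = (- 1) ^ i *\<^sub>R D (ws ! i) ((omit i ws)[k' := X])" for X
      using False k i by (simp add: omit_list_update k'_def)
    ultimately show ?thesis by simp
  qed
  then have "linear (\<lambda>X. \<Sum>i<length ws. (- 1) ^ i *\<^sub>R D (ws[k := X] ! i) (omit i (ws[k := X])))"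
    by (intro linear_compose_sum) auto
  then show "linear (\<lambda>X. \<Sum>i<length (ws[k := X]). (- 1) ^ i *\<^sub>R D (ws[k := X] ! i) (omit i (ws[k := X])))"
    by simp
next
  fix ws :: "'w list" assume "\<not> distinct ws"
  then obtain P Q R w where ws: "ws = P @ w # Q @ w # R"
    using not_distinct_decomp by fastforce
  let ?f = "\<lambda>i. (- 1) ^ i *\<^sub>R D (ws ! i) (omit i ws)"
  let ?a = "length P" and ?b = "length P + Suc (length Q)"
  have ab: "?a < length ws" "?b < length ws" "?a \<noteq> ?b" by (simp_all add: ws)
  \<comment> \<open>Both copies of \<open>w\<close> survive the omission of a third position;
    \<open>a'\<close> and \<open>b'\<close> are their places in the shorter list.\<close>
  have other: "?f i = 0" if i: "i < length ws" "i \<noteq> ?a" "i \<noteq> ?b" for i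
  proof -
    have "\<not> distinct (omit i ws)"
    proof
      assume d: "distinct (omit i ws)"
      define a' where "a' = (if ?a < i then ?a else ?a - 1)"
      define b' where "b' = (if ?b < i then ?b else ?b - 1)"
      have nth_omit: "omit i ws ! (if c < i then c else c - 1) = ws ! c" if "c < length ws" "c \<noteq> i" for c
        using that i(1) by (auto simp: omit_def nth_append min_def)
      have "ws ! ?a = w" "ws ! ?b = w" by (simp_all add: ws nth_append)
      with nth_omit[of ?a] nth_omit[of ?b] ab i have "omit i ws ! a' = w" "omit i ws ! b' = w"
        by (simp_all add: a'_def b'_def)
      moreover have "a' < length (omit i ws)" "b' < length (omit i ws)" "a' \<noteq> b'"
        using ab i by (auto simp: a'_def b'_def length_omit)
      ultimately show False using d by (metis nth_eq_iff_index_eq)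
    qed
    then show ?thesis by (simp add: alternating_eq_0[OF alt])
  qed
  \<comment> \<open>In both remaining terms the other copy of \<open>w\<close> is brought to the
    front. It passes \<open>P\<close> and \<open>Q\<close> in the first term and only
    \<open>P\<close> in the second; with the signs of the omitted positions the results are
    opposite.\<close>
  have "?f ?a = (- 1) ^ ?a *\<^sub>R D w (P @ Q @ w # R)"
    using omit_append[of P w "Q @ w # R"] by (simp add: ws nth_append)
  also have "D w (P @ Q @ w # R) = (- 1) ^ (length P + length Q) *\<^sub>R D w (w # P @ Q @ R)"
    using alternating_move_to_front[OF alt, of w "P @ Q" w R] by simp
  finally have fa: "?f ?a = (- 1) ^ length Q *\<^sub>R D w (w # P @ Q @ R)"
    by (simp add: minus_one_power_iff)
  have "?f ?b = (- 1) ^ ?b *\<^sub>R D w (P @ w # Q @ R)"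
    using omit_append[of "P @ w # Q" w R] by (simp add: ws nth_append)
  also have "D w (P @ w # Q @ R) = (- 1) ^ length P *\<^sub>R D w (w # P @ Q @ R)"
    by (rule alternating_move_to_front[OF alt])
  finally have fb: "?f ?b = - ((- 1) ^ length Q *\<^sub>R D w (w # P @ Q @ R))"
    by (simp add: minus_one_power_iff)
  have "(\<Sum>i<length ws. ?f i) = (\<Sum>i\<in>{?a, ?b}. ?f i)"
    by (rule sum.mono_neutral_right) (use ab other in auto)
  also have "\<dots> = ?f ?a + ?f ?b" using ab(3) by simp
  also have "\<dots> = 0" unfolding fa fb by simp
  finally show "(\<Sum>i<length ws. ?f i) = 0" .
qed

section \<open>Manifolds\<close>

text \<open>Probes in the sense of diffeology: smoothness of maps out of powers of a manifold is
  tested by composing with plots, which keeps charts out of later arguments.\<close>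

definition plot ::
    "('m::topological_space, 'e::fin_dim_space) chart set \<Rightarrow> nat \<Rightarrow> (nat \<Rightarrow> 'p::fin_dim_space) set \<Rightarrow>
      ((nat \<Rightarrow> 'p) \<Rightarrow> 'm) \<Rightarrow> bool"
  where "plot A n S c \<longleftrightarrow> open S \<and> continuous_on S c \<and>
    (\<forall>d\<in>A. C_infinity n (S \<inter> c -` fst d) (\<lambda>x. snd d (c x)))"

lemma plotD:
  assumes "plot A n S c"
  shows "open S" "continuous_on S c" "d \<in> A \<Longrightarrow> C_infinity n (S \<inter> c -` fst d) (\<lambda>x. snd d (c x))"
  using assms by (auto simp: plot_def)

lemma smooth_atlas_chart:
  assumes "smooth_atlas A" "c \<in> A"
  shows "open (fst c)" "open (chart_image c)" "continuous_on (fst c) (snd c)"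
    "continuous_on (chart_image c) (chart_inv c)"
    "g \<in> fst c \<Longrightarrow> chart_inv c (snd c g) = g" "g \<in> fst c \<Longrightarrow> snd c g \<in> chart_image c"
    "y \<in> chart_image c \<Longrightarrow> snd c (chart_inv c y) = y" "y \<in> chart_image c \<Longrightarrow> chart_inv c y \<in> fst c"
proof -
  have h: "homeomorphism (fst c) (chart_image c) (snd c) (chart_inv c)" "open (fst c)" "open (chart_image c)"
    using assms by (auto simp: smooth_atlas_def)
  then show "open (fst c)" "open (chart_image c)" "continuous_on (fst c) (snd c)"
    "continuous_on (chart_image c) (chart_inv c)"
    "g \<in> fst c \<Longrightarrow> chart_inv c (snd c g) = g" "g \<in> fst c \<Longrightarrow> snd c g \<in> chart_image c"
    "y \<in> chart_image c \<Longrightarrow> snd c (chart_inv c y) = y" "y \<in> chart_image c \<Longrightarrow> chart_inv c y \<in> fst c"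
    unfolding homeomorphism_def by blast+
qed

lemma smooth_atlas_cover:
  assumes "smooth_atlas A"
  obtains c where "c \<in> A" "g \<in> fst c"
proof -
  have "g \<in> \<Union>(fst ` A)" using assms by (simp add: smooth_atlas_def)
  then show ?thesis using that by blast
qed

lemma smooth_atlas_transition:
  assumes "smooth_atlas A" "c \<in> A" "d \<in> A"
  shows "smooth_on (snd c ` (fst c \<inter> fst d)) (\<lambda>y. snd d (chart_inv c y))"
  using assms by (simp add: smooth_atlas_def smooth_on_def)

text \<open>Continuity need not be checked separately: near each point the map is a chart inverse
  applied to smooth coordinates.\<close>

lemma plotI_local:
  assumes A: "smooth_atlas A" and S: "open S"
    and loc: "\<And>x d. x \<in> S \<Longrightarrow> d \<in> A \<Longrightarrow> c x \<in> fst d \<Longrightarrow>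
      \<exists>W. open W \<and> x \<in> W \<and> W \<subseteq> S \<and> c ` W \<subseteq> fst d \<and> C_infinity n W (\<lambda>x. snd d (c x))"
  shows "plot A n S c"
  unfolding plot_def
proof (intro conjI ballI S)
  have "isCont c x" if x: "x \<in> S" for x
  proof -
    obtain d where d: "d \<in> A" "c x \<in> fst d" by (rule smooth_atlas_cover[OF A])
    obtain W where W: "open W" "x \<in> W" "W \<subseteq> S" "c ` W \<subseteq> fst d" "C_infinity n W (\<lambda>x. snd d (c x))"
      using loc[OF x d] by blast
    have "continuous_on W (\<lambda>x. chart_inv d (snd d (c x)))"
      by (rule continuous_on_compose2[OF smooth_atlas_chart(4)[OF A d(1)] C_infinity_continuous[OF W(5)]])
        (use W(4) smooth_atlas_chart(6)[OF A d(1)] in blast)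
    moreover have "chart_inv d (snd d (c x)) = c x" if "x \<in> W" for x
      using W(4) smooth_atlas_chart(5)[OF A d(1)] that by blast
    ultimately have "continuous_on W c" by (rule continuous_on_eq)
    then show ?thesis using W(1,2) continuous_on_eq_continuous_at by blast
  qed
  then show cont: "continuous_on S c" using continuous_at_imp_continuous_on by blast
  fix d assume d: "d \<in> A"
  have "open (S \<inter> c -` fst d)"
    by (rule continuous_open_preimage[OF cont S smooth_atlas_chart(1)[OF A d]])
  then show "C_infinity n (S \<inter> c -` fst d) (\<lambda>x. snd d (c x))"
  proof (rule C_infinity_local)
    fix x assume "x \<in> S \<inter> c -` fst d"
    then obtain W where W: "open W" "x \<in> W" "C_infinity n W (\<lambda>x. snd d (c x))"
      using loc[OF _ d] by blast
    then show "\<exists>U. open U \<and> x \<in> U \<and> C_infinity n (S \<inter> c -` fst d \<inter> U) (\<lambda>x. snd d (c x))"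
      using C_infinity_subset[OF W(3)] by blast
  qed
qed

lemma plot_subset:
  assumes "plot A n S c" "open T" "T \<subseteq> S"
  shows "plot A n T c"
  unfolding plot_def
proof (intro conjI ballI assms(2))
  show "continuous_on T c" using plotD(2)[OF assms(1)] assms(3) by (rule continuous_on_subset)
  show "C_infinity n (T \<inter> c -` fst d) (\<lambda>x. snd d (c x))" if "d \<in> A" for d
    by (rule C_infinity_subset[OF plotD(3)[OF assms(1) that]]) (use assms(3) in blast)
qed

lemma plot_compose:
  fixes c :: "(nat \<Rightarrow> 'p::fin_dim_space) \<Rightarrow> 'm::{t2_space, second_countable_topology}"
    and u :: "(nat \<Rightarrow> 'q::fin_dim_space) \<Rightarrow> nat \<Rightarrow> 'p"
  assumes A: "smooth_atlas A" and c: "plot A n S c" and T: "open T"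
    and maps: "\<And>x. x \<in> T \<Longrightarrow> u x \<in> S"
    and u: "\<And>i. i < n \<Longrightarrow> C_infinity n' T (\<lambda>x. u x i)"
    and cont: "\<And>i. n \<le> i \<Longrightarrow> continuous_on T (\<lambda>x. u x i)"
    and indep: "\<And>i j x y. n \<le> i \<Longrightarrow> j < n' \<Longrightarrow> u (x(j := y)) i = u x i"
  shows "plot A n' T (\<lambda>x. c (u x))"
  unfolding plot_def
proof (intro conjI ballI T)
  have "continuous_on T (\<lambda>x. u x i)" for i
    using C_infinity_continuous[OF u[of i]] cont[of i] not_le by blast
  then have uc: "continuous_on T u" by (rule continuous_on_coordinatewise_then_product)
  show cc: "continuous_on T (\<lambda>x. c (u x))"
    by (rule continuous_on_compose2[OF plotD(2)[OF c] uc]) (use maps in blast)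
  fix d assume d: "d \<in> A"
  note dom = smooth_atlas_chart(1)[OF A d]
  show "C_infinity n' (T \<inter> (\<lambda>x. c (u x)) -` fst d) (\<lambda>x. snd d (c (u x)))"
  proof (rule C_infinity_compose[where S' = "S \<inter> c -` fst d" and u = u and f = "\<lambda>y. snd d (c y)" and n = n, OF _ _ _ plotD(3)[OF c d] _ _ indep])
    show "open (S \<inter> c -` fst d)" by (rule continuous_open_preimage[OF plotD(2,1)[OF c] dom])
    show "open (T \<inter> (\<lambda>x. c (u x)) -` fst d)" by (rule continuous_open_preimage[OF cc T dom])
    show "C_infinity n' (T \<inter> (\<lambda>x. c (u x)) -` fst d) (\<lambda>x. u x i)" if "i < n" for i
      by (rule C_infinity_subset[OF u[OF that]]) blast
    show "continuous_on (T \<inter> (\<lambda>x. c (u x)) -` fst d) (\<lambda>x. u x i)" if "n \<le> i" for i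
      by (rule continuous_on_subset[OF cont[OF that]]) blast
  qed (use maps in auto)
qed

lemma plot_const: "open S \<Longrightarrow> plot A n S (\<lambda>_. g)"
  by (simp add: plot_def)

lemma plot_chart_inv:
  assumes A: "smooth_atlas A" "c \<in> A" and S: "open S" and u: "C_infinity n S u"
    and maps: "\<And>x. x \<in> S \<Longrightarrow> u x \<in> chart_image c"
  shows "plot A n S (\<lambda>x. chart_inv c (u x))"
  unfolding plot_def
proof (intro conjI ballI S)
  show cont: "continuous_on S (\<lambda>x. chart_inv c (u x))"
    by (rule continuous_on_compose2[OF smooth_atlas_chart(4)[OF A] C_infinity_continuous[OF u]]) (use maps in blast)
  fix d assume d: "d \<in> A"
  let ?U = "snd c ` (fst c \<inter> fst d)" and ?T = "S \<inter> (\<lambda>x. chart_inv c (u x)) -` fst d"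
  have "?U = chart_image c \<inter> chart_inv c -` fst d"
  proof (rule subset_antisym; rule subsetI)
    fix y assume "y \<in> ?U"
    then obtain g where "g \<in> fst c" "g \<in> fst d" "y = snd c g" by blast
    then show "y \<in> chart_image c \<inter> chart_inv c -` fst d"
      by (simp add: smooth_atlas_chart(5,6)[OF A])
  next
    fix y assume y: "y \<in> chart_image c \<inter> chart_inv c -` fst d"
    then have "y = snd c (chart_inv c y)" "chart_inv c y \<in> fst c"
      by (simp_all add: smooth_atlas_chart(7,8)[OF A])
    with y show "y \<in> ?U" by blast
  qed
  then have "open ?U"
    using continuous_open_preimage[OF smooth_atlas_chart(4,2)[OF A] smooth_atlas_chart(1)[OF A(1) d]] by simp
  moreover have "open ?T" by (rule continuous_open_preimage[OF cont S smooth_atlas_chart(1)[OF A(1) d]])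
  moreover have "C_infinity n ?T u" by (rule C_infinity_subset[OF u]) blast
  moreover have "u x \<in> ?U" if "x \<in> ?T" for x
    using that maps[of x] \<open>?U = _\<close> by blast
  ultimately show "C_infinity n ?T (\<lambda>x. snd d (chart_inv c (u x)))"
    using smooth_on_compose_C_infinity[OF _ smooth_atlas_transition[OF A d]] by blast
qed

lemma smooth_atlas_vector: "smooth_atlas (vector_atlas :: ('f::fin_dim_space, 'f) chart set)"
proof -
  have "chart_inv (UNIV, \<lambda>x. x) = (\<lambda>x. x :: 'f)"
    by (simp add: chart_inv_def fun_eq_iff inv_into_f_eq)
  then show ?thesis
    by (auto simp: smooth_atlas_def vector_atlas_def chart_image_def homeomorphism_def)
qed

lemma plot_vector: "plot vector_atlas n S f \<longleftrightarrow> open S \<and> C_infinity n S f"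
  by (auto simp: plot_def vector_atlas_def dest: C_infinity_continuous)

lemma map_upt_cong: "(\<And>i. i < k \<Longrightarrow> f i = g i) \<Longrightarrow> map f [0..<k] = map g [0..<k]"
  by simp

text \<open>Near a given point each \<open>cs i\<close> stays in one chart, and the composite
  becomes the coordinate expression of \<open>F\<close> applied to the coordinates of the
  plots.\<close>

lemma smooth_map_plot:
  fixes cs :: "nat \<Rightarrow> (nat \<Rightarrow> 'p::fin_dim_space) \<Rightarrow> 'm::{t2_space, second_countable_topology}"
    and B :: "('n::{t2_space, second_countable_topology}, 'f::fin_dim_space) chart set"
  assumes A: "smooth_atlas A" and B: "smooth_atlas B" and F: "smooth_map A B k F" and S: "open S"
    and cs: "\<And>i. i < k \<Longrightarrow> plot A n S (cs i)"
  shows "plot B n S (\<lambda>x. F (map (\<lambda>i. cs i x) [0..<k]))"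
proof (rule plotI_local[OF B S])
  fix x0 d assume x0: "x0 \<in> S" and d: "d \<in> B" "F (map (\<lambda>i. cs i x0) [0..<k]) \<in> fst d"
  have "\<forall>i. \<exists>c. c \<in> A \<and> cs i x0 \<in> fst c" using smooth_atlas_cover[OF A] by metis
  then obtain c where c: "\<And>i. c i \<in> A" "\<And>i. cs i x0 \<in> fst (c i)" by metis
  define f where "f y = F (map (\<lambda>i. chart_inv (c i) (y i)) [0..<k])" for y
  define Sd where "Sd = {y. (\<forall>i<k. y i \<in> chart_image (c i)) \<and> f y \<in> fst d}"
  have Sd: "open Sd" "C_infinity k Sd (\<lambda>y. snd d (f y))"
    using F c(1) d(1) unfolding smooth_map_def Let_def Sd_def f_def by blast+
  \<comment> \<open>The outer \<open>S\<close> matters for \<open>k = 0\<close>, where the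
    intersection over \<open>i\<close> is the whole space.\<close>
  define U where "U = S \<inter> (\<Inter>i<k. S \<inter> cs i -` fst (c i))"
  \<comment> \<open>The default 0 makes the conditions on the coordinates from \<open>k\<close> on
    trivial.\<close>
  define u where "u x i = (if i < k then snd (c i) (cs i x) else 0)" for x i
  have "open (\<Inter>i<k. S \<inter> cs i -` fst (c i))"
    by (intro open_INT finite_lessThan ballI)
      (use continuous_open_preimage[OF plotD(2)[OF cs] S smooth_atlas_chart(1)[OF A c(1)]] in blast)
  then have "open U" unfolding U_def by (rule open_Int[OF S])
  then have U: "open U" "U \<subseteq> S" "x0 \<in> U" using x0 c(2) by (auto simp: U_def)
  have Uc: "cs i x \<in> fst (c i)" if "x \<in> U" "i < k" for i x
    using that unfolding U_def by blast
  have u_smooth: "C_infinity n U (\<lambda>x. u x i)" for i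
  proof (cases "i < k")
    case True
    then have "C_infinity n U (\<lambda>x. snd (c i) (cs i x))"
      by (intro C_infinity_subset[OF plotD(3)[OF cs c(1)]]) (auto simp: U_def)
    then show ?thesis using True by (simp add: u_def)
  qed (simp add: u_def)
  have fu: "f (u x) = F (map (\<lambda>i. cs i x) [0..<k])" if "x \<in> U" for x
    unfolding f_def
    by (rule arg_cong[where f = F], rule map_upt_cong) (simp add: u_def smooth_atlas_chart(5)[OF A c(1)] Uc[OF that])
  define W where "W = U \<inter> u -` Sd"
  have uc: "continuous_on U u"
    by (intro continuous_on_coordinatewise_then_product C_infinity_continuous[OF u_smooth])
  have W: "open W" unfolding W_def by (rule continuous_open_preimage[OF uc U(1) Sd(1)])
  have "u x0 \<in> Sd" using d(2) fu[OF U(3)] U(3) smooth_atlas_chart(6)[OF A c(1)]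
    by (auto simp: Sd_def u_def c(2))
  then have "x0 \<in> W" using U(3) by (simp add: W_def)
  moreover have "C_infinity n W (\<lambda>x. snd d (f (u x)))"
  proof (rule C_infinity_compose[where u = u, OF Sd(1) W _ Sd(2)])
    show "C_infinity n W (\<lambda>x. u x i)" for i
      by (rule C_infinity_subset[OF u_smooth]) (simp add: W_def)
  qed (auto simp: W_def u_def)
  then have "C_infinity n W (\<lambda>x. snd d (F (map (\<lambda>i. cs i x) [0..<k])))"
    by (rule iffD1[OF C_infinity_cong[OF W], rotated]) (simp add: fu W_def)
  moreover have "(\<lambda>x. F (map (\<lambda>i. cs i x) [0..<k])) ` W \<subseteq> fst d"
    using fu by (auto simp: W_def Sd_def)
  ultimately show "\<exists>W. open W \<and> x0 \<in> W \<and> W \<subseteq> S \<and> (\<lambda>x. F (map (\<lambda>i. cs i x) [0..<k])) ` W \<subseteq> fst d \<and>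
      C_infinity n W (\<lambda>x. snd d (F (map (\<lambda>i. cs i x) [0..<k])))"
    using W U(2) by (intro exI[of _ W]) (auto simp: W_def)
qed

text \<open>The converse test. It suffices to take \<open>k\<close> parameters in the model space,
  because the inverse charts in the separate coordinates are plots of this kind.\<close>

lemma smooth_mapI:
  fixes A :: "('m::{t2_space, second_countable_topology}, 'e::fin_dim_space) chart set" and F :: "'m list \<Rightarrow> 'f::fin_dim_space"
  assumes A: "smooth_atlas A"
    and F: "\<And>(S :: (nat \<Rightarrow> 'e) set) cs. open S \<Longrightarrow> (\<And>i. i < k \<Longrightarrow> plot A k S (cs i)) \<Longrightarrow>
      C_infinity k S (\<lambda>x. F (map (\<lambda>i. cs i x) [0..<k]))"
  shows "smooth_map A vector_atlas k F"
  unfolding smooth_map_def Let_def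
proof (intro allI impI)
  fix cs :: "nat \<Rightarrow> ('m, 'e) chart" and c :: "('f, 'f) chart"
  assume asm: "(\<forall>i<k. cs i \<in> A) \<and> c \<in> vector_atlas"
  let ?S = "{x. \<forall>i<k. x i \<in> chart_image (cs i)}"
  have "?S = (\<Inter>i<k. {x. x i \<in> chart_image (cs i)})" by auto
  moreover have "open (\<Inter>i<k. {x. x i \<in> chart_image (cs i)})"
    by (intro open_INT finite_lessThan ballI open_proj_vimage) (use asm smooth_atlas_chart(2)[OF A] in blast)
  ultimately have S: "open ?S" by simp
  have "C_infinity k ?S (\<lambda>x. F (map (\<lambda>i. chart_inv (cs i) (x i)) [0..<k]))"
    by (rule F[OF S], rule plot_chart_inv[OF A _ S C_infinity_proj]) (use asm in auto)
  with S asm show "open {x. (\<forall>i<k. x i \<in> chart_image (cs i)) \<and> F (map (\<lambda>i. chart_inv (cs i) (x i)) [0..<k]) \<in> fst c} \<and>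
    C_infinity k {x. (\<forall>i<k. x i \<in> chart_image (cs i)) \<and> F (map (\<lambda>i. chart_inv (cs i) (x i)) [0..<k]) \<in> fst c}
     (\<lambda>x. snd c (F (map (\<lambda>i. chart_inv (cs i) (x i)) [0..<k])))"
    by (simp add: vector_atlas_def)
qed

text \<open>The extra parameter \<open>t\<close> is stored in coordinate \<open>0\<close>; the old parameters are shifted by one.\<close>

lemma parameter_derivative:
  fixes H :: "real \<Rightarrow> (nat \<Rightarrow> 'p::fin_dim_space) \<Rightarrow> 'b::fin_dim_space"
  assumes T: "open T" and S: "open S"
    and H: "C_infinity (Suc n) T (\<lambda>y. H (snd (y 0)) (\<lambda>i. fst (y (Suc i))))"
    and ST: "\<And>x y. x \<in> S \<Longrightarrow> (\<And>i. fst (y (Suc i)) = x i) \<Longrightarrow> snd (y 0) = 0 \<Longrightarrow> y \<in> T"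
  shows "C_infinity n S (\<lambda>x. vector_derivative (\<lambda>t. H t x) (at 0))"
    and "x \<in> S \<Longrightarrow> ((\<lambda>t. H t x) has_vector_derivative vector_derivative (\<lambda>t. H t x) (at 0)) (at 0)"
proof -
  define y :: "(nat \<Rightarrow> 'p) \<Rightarrow> nat \<Rightarrow> 'p \<times> real" where "y x i = (case i of 0 \<Rightarrow> (0, 0) | Suc j \<Rightarrow> (x j, 0))" for x i
  let ?G = "\<lambda>y. H (snd (y 0)) (\<lambda>i. fst (y (Suc i)))"
  have y: "y x \<in> T" if "x \<in> S" for x by (rule ST[OF that]) (simp_all add: y_def)
  have G: "?G ((y x)(0 := y x 0 + t *\<^sub>R (0, 1))) = H t x" for x t
    by (simp add: y_def)
  have pd: "pd 0 (0, 1) ?G (y x) = vector_derivative (\<lambda>t. H t x) (at 0)" for x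
    unfolding pd_def G ..
  have "C_infinity n S (\<lambda>x. pd 0 (0, 1) ?G (y x))"
  proof (rule C_infinity_compose[where u = y, OF T S y C_infinity_pd[OF T H zero_less_Suc]])
    show "C_infinity n S (\<lambda>x. y x i)" for i
    proof (cases i)
      case (Suc j)
      have "bounded_linear (\<lambda>v :: 'p. (v, 0 :: real))"
        by (intro bounded_linear_Pair bounded_linear_ident bounded_linear_zero)
      from C_infinity_bounded_linear[OF this C_infinity_proj] show ?thesis by (simp add: y_def Suc)
    qed (simp add: y_def)
    then show "continuous_on S (\<lambda>x. y x i)" for i by (rule C_infinity_continuous)
    show "y (x(j := z)) i = y x i" if "Suc n \<le> i" "j < n" for i j x z
      using that by (auto simp: y_def split: nat.splits)
  qed
  then show "C_infinity n S (\<lambda>x. vector_derivative (\<lambda>t. H t x) (at 0))" unfolding pd .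
  show "((\<lambda>t. H t x) has_vector_derivative vector_derivative (\<lambda>t. H t x) (at 0)) (at 0)" if "x \<in> S"
    using pd_has_vector_derivative[OF T H zero_less_Suc y[OF that], of "(0, 1)"] unfolding G pd .
qed

section \<open>Calculus on a Lie group\<close>

lemma smooth_map_cong:
  assumes "\<And>gs. length gs = n \<Longrightarrow> F gs = F' gs"
  shows "smooth_map A B n F \<longleftrightarrow> smooth_map A B n F'"
  unfolding smooth_map_def by (simp add: assms)

lemma has_vector_derivative_chain:
  assumes "(f has_derivative f') (at (h 0))" "(h has_vector_derivative X) (at 0)"
  shows "((\<lambda>t. f (h t)) has_vector_derivative f' X) (at 0)"
proof -
  have "((\<lambda>t. f (h t)) has_derivative (\<lambda>t. f' (t *\<^sub>R X))) (at 0)"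
    using has_derivative_compose[OF assms(2)[unfolded has_vector_derivative_def] assms(1)] .
  then show ?thesis
    unfolding has_vector_derivative_def
    by (simp only: linear_scale[OF has_derivative_linear[OF assms(1)]])
qed

lemma has_vector_derivative_transform_eventually:
  assumes "(f has_vector_derivative d) (at x)" "\<forall>\<^sub>F t in at x. f t = g t" "f x = g x"
  shows "(g has_vector_derivative d) (at x)"
  using has_derivative_transform_eventually[OF assms(1)[unfolded has_vector_derivative_def] assms(2,3)]
  unfolding has_vector_derivative_def by simp

locale lie_group_calculus = lie_group G
  for G :: "('g::{t2_space, second_countable_topology}, 'e::fin_dim_space) smooth_group" (structure)
begin

lemma in_carrier [simp]: "g \<in> carrier G"
  by (simp add: carrier_UNIV)

abbreviation "\<u> \<equiv> snd (unit_chart G)"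
abbreviation "\<U> \<equiv> fst (unit_chart G)"
abbreviation "\<E> \<equiv> chart_image (unit_chart G)"

lemma unit_chart: "unit_chart G \<in> charts G" "\<one> \<in> \<U>"
proof -
  obtain c where "c \<in> charts G \<and> \<one> \<in> fst c" using smooth_atlas_cover[OF atlas] by metis
  from someI[of "\<lambda>c. c \<in> charts G \<and> \<one> \<in> fst c", OF this]
  show "unit_chart G \<in> charts G" "\<one> \<in> \<U>" by (simp_all add: unit_chart_def)
qed

lemmas unit_chart_facts = smooth_atlas_chart[OF atlas unit_chart(1)]

text \<open>The inverse of the unit chart, recentred so that 0 goes to the unit; valid on \<D>. It
  is not the exponential map, but its rays are the tangent curves.\<close>

definition ec :: "'e \<Rightarrow> 'g" where "ec v = chart_inv (unit_chart G) (\<u> \<one> + v)"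

definition \<D> :: "'e set" where "\<D> = {v. \<u> \<one> + v \<in> \<E>}"

lemma open_D: "open \<D>"
proof -
  have "continuous_on UNIV (\<lambda>v. \<u> \<one> + v)" by (intro continuous_intros)
  from open_vimage[OF unit_chart_facts(2) this] show ?thesis by (simp add: \<D>_def vimage_def)
qed

lemma zero_in_D [simp]: "0 \<in> \<D>"
  using unit_chart_facts(6)[OF unit_chart(2)] by (simp add: \<D>_def)

lemma ec_0 [simp]: "ec 0 = \<one>"
  using unit_chart_facts(5)[OF unit_chart(2)] by (simp add: ec_def)

lemma tangent_curve_ec: "tangent_curve G X t = ec (t *\<^sub>R X)"
  by (simp add: tangent_curve_def ec_def)

lemma chart_ec: "v \<in> \<D> \<Longrightarrow> \<u> (ec v) = \<u> \<one> + v" "v \<in> \<D> \<Longrightarrow> ec v \<in> \<U>"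
  by (simp_all add: ec_def \<D>_def unit_chart_facts)

lemma ec_chart: "g \<in> \<U> \<Longrightarrow> ec (\<u> g - \<u> \<one>) = g" "g \<in> \<U> \<Longrightarrow> \<u> g - \<u> \<one> \<in> \<D>"
  by (simp_all add: ec_def \<D>_def unit_chart_facts)

abbreviation gplot :: "nat \<Rightarrow> (nat \<Rightarrow> 'p::fin_dim_space) set \<Rightarrow> ((nat \<Rightarrow> 'p) \<Rightarrow> 'g) \<Rightarrow> bool"
  where "gplot \<equiv> plot (charts G)"

lemma gplot_ec:
  assumes "open S" "C_infinity n S v" "\<And>x. x \<in> S \<Longrightarrow> v x \<in> \<D>"
  shows "gplot n S (\<lambda>x. ec (v x))"
  unfolding ec_def
  by (rule plot_chart_inv[OF atlas unit_chart(1) assms(1) C_infinity_add[OF C_infinity_const assms(2)]])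
    (use assms(3) in \<open>simp add: \<D>_def\<close>)

lemma gplot_mult:
  assumes "gplot n S c" "gplot n S d"
  shows "gplot n S (\<lambda>x. c x \<otimes> d x)"
proof -
  have "gplot n S (\<lambda>x. (\<lambda>gs. gs ! 0 \<otimes> gs ! 1) (map (\<lambda>i. (if i = 0 then c else d) x) [0..<2]))"
    by (rule smooth_map_plot[OF atlas atlas smooth_mult plotD(1)[OF assms(1)]]) (use assms in simp)
  then show ?thesis by simp
qed

lemma gplot_inv:
  assumes "gplot n S c"
  shows "gplot n S (\<lambda>x. inv (c x))"
proof -
  have "gplot n S (\<lambda>x. (\<lambda>gs. inv (gs ! 0)) (map (\<lambda>i. c x) [0..<1]))"
    by (rule smooth_map_plot[OF atlas atlas smooth_inv plotD(1)[OF assms(1)]]) (use assms in simp)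
  then show ?thesis by simp
qed

section \<open>Smooth families on the group and left-invariant derivatives\<close>

text \<open>The last group argument is kept apart because derivatives act on it alone; this is the
  smoothness clause of \<open>double_cochains_basic\<close>.\<close>

definition smooth_family :: "nat \<Rightarrow> ('g list \<Rightarrow> 'g \<Rightarrow> 'f::fin_dim_space) \<Rightarrow> bool"
  where "smooth_family p \<Psi> \<longleftrightarrow> smooth_map (charts G) vector_atlas (p + 1) (\<lambda>hs. \<Psi> (butlast hs) (last hs))"

lemma smooth_familyD:
  assumes "smooth_family p \<Psi>" "\<And>i. i < p \<Longrightarrow> gplot n S (cs i)" "gplot n S c"
  shows "C_infinity n S (\<lambda>x. \<Psi> (map (\<lambda>i. cs i x) [0..<p]) (c x))"
proof -
  have eq: "map (\<lambda>i. (if i < p then cs i else c) x) [0..<p + 1] = map (\<lambda>i. cs i x) [0..<p] @ [c x]" for x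
    by simp
  have "plot vector_atlas n S (\<lambda>x. (\<lambda>hs. \<Psi> (butlast hs) (last hs)) (map (\<lambda>i. (if i < p then cs i else c) x) [0..<p + 1]))"
    by (rule smooth_map_plot[OF atlas smooth_atlas_vector assms(1)[unfolded smooth_family_def] plotD(1)[OF assms(3)]])
      (use assms in simp)
  then show ?thesis unfolding eq by (simp add: plot_vector)
qed

lemma smooth_familyI:
  fixes \<Psi> :: "'g list \<Rightarrow> 'g \<Rightarrow> 'f::fin_dim_space"
  assumes "\<And>(S :: (nat \<Rightarrow> 'e) set) cs c. open S \<Longrightarrow> (\<And>i. i < p \<Longrightarrow> gplot (p + 1) S (cs i)) \<Longrightarrow> gplot (p + 1) S c \<Longrightarrow>
      C_infinity (p + 1) S (\<lambda>x. \<Psi> (map (\<lambda>i. cs i x) [0..<p]) (c x))"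
  shows "smooth_family p \<Psi>"
  unfolding smooth_family_def
proof (rule smooth_mapI[OF atlas])
  fix S :: "(nat \<Rightarrow> 'e) set" and cs :: "nat \<Rightarrow> (nat \<Rightarrow> 'e) \<Rightarrow> 'g"
  assume "open S" "\<And>i. i < p + 1 \<Longrightarrow> gplot (p + 1) S (cs i)"
  then have "C_infinity (p + 1) S (\<lambda>x. \<Psi> (map (\<lambda>i. cs i x) [0..<p]) (cs p x))"
    by (intro assms) simp_all
  then show "C_infinity (p + 1) S (\<lambda>x. \<Psi> (butlast (map (\<lambda>i. cs i x) [0..<p + 1])) (last (map (\<lambda>i. cs i x) [0..<p + 1])))"
    by simp
qed

text \<open>Adjoin the time of the tangent curve as a parameter, so that \<open>c x\<close> times
  \<open>ec (t *\<^sub>R X)\<close> is a plot, and differentiate in that parameter.\<close>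

lemma left_deriv_family:
  fixes \<Psi> :: "'g list \<Rightarrow> 'g \<Rightarrow> 'f::fin_dim_space" and c :: "(nat \<Rightarrow> 'p::fin_dim_space) \<Rightarrow> 'g"
  assumes \<Psi>: "smooth_family p \<Psi>" and cs: "\<And>i. i < p \<Longrightarrow> gplot n S (cs i)" and c: "gplot n S c"
  shows "C_infinity n S (\<lambda>x. left_deriv G (\<Psi> (map (\<lambda>i. cs i x) [0..<p])) (c x) X)"
proof -
  let ?H = "\<lambda>t x. \<Psi> (map (\<lambda>i. cs i x) [0..<p]) (c x \<otimes> tangent_curve G X t)"
  let ?u = "\<lambda>y :: nat \<Rightarrow> 'p \<times> real. \<lambda>i. fst (y (Suc i))"
  \<comment> \<open>Times are restricted so that \<open>ec\<close> is used inside \<D> only; the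
    slice at time 0 over \<open>S\<close> remains inside.\<close>
  let ?T = "(?u -` S) \<inter> {y :: nat \<Rightarrow> 'p \<times> real. snd (y 0) *\<^sub>R X \<in> \<D>}"
  note S = plotD(1)[OF c]
  have cont_u: "continuous_on UNIV ?u"
    by (intro continuous_on_coordinatewise_then_product continuous_on_fst continuous_on_product_coordinates)
  have cont_t: "continuous_on UNIV (\<lambda>y :: nat \<Rightarrow> 'p \<times> real. snd (y 0) *\<^sub>R X)"
    by (intro continuous_on_scaleR continuous_on_const continuous_on_snd continuous_on_product_coordinates)
  have T: "open ?T"
    using open_vimage[OF S cont_u] open_vimage[OF open_D cont_t] by (auto simp: vimage_def)
  have t_smooth: "C_infinity (Suc n) ?T (\<lambda>y. snd (y 0))"
    by (rule C_infinity_bounded_linear[OF bounded_linear_snd C_infinity_proj])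
  have lift: "gplot (Suc n) ?T (\<lambda>y. d (?u y))" if "gplot n S d" for d
  proof (rule plot_compose[where u = ?u, OF atlas that T])
    show "C_infinity (Suc n) ?T (\<lambda>y. ?u y i)" for i
      by (rule C_infinity_bounded_linear[OF bounded_linear_fst C_infinity_proj])
    then show "continuous_on ?T (\<lambda>y. ?u y i)" for i by (rule C_infinity_continuous)
  qed auto
  have "gplot (Suc n) ?T (\<lambda>y. c (?u y) \<otimes> ec (snd (y 0) *\<^sub>R X))"
    by (intro gplot_mult lift[OF c] gplot_ec T C_infinity_scaleR t_smooth C_infinity_const) simp
  from smooth_familyD[OF \<Psi> lift[OF cs] this]
  have "C_infinity (Suc n) ?T (\<lambda>y. ?H (snd (y 0)) (?u y))" by (simp add: tangent_curve_ec)
  then have "C_infinity n S (\<lambda>x. vector_derivative (\<lambda>t. ?H t x) (at 0))"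
    by (rule parameter_derivative(1)[where H = ?H, OF T S]) (simp add: vimage_def)
  then show ?thesis by (simp only: left_deriv_def)
qed

lemma smooth_family_left_deriv:
  assumes "smooth_family p \<Psi>"
  shows "smooth_family p (\<lambda>gs g. left_deriv G (\<Psi> gs) g X)"
  by (rule smooth_familyI) (rule left_deriv_family[OF assms])

abbreviation smooth_fn :: "('g \<Rightarrow> 'f::fin_dim_space) \<Rightarrow> bool"
  where "smooth_fn F \<equiv> smooth_family 0 (\<lambda>_. F)"

lemma smooth_fn_iff: "smooth_fn F \<longleftrightarrow> smooth_map (charts G) vector_atlas 1 (\<lambda>gs. F (gs ! 0))"
  unfolding smooth_family_def
  by (simp, rule smooth_map_cong) (auto simp: length_Suc_conv)

lemma smooth_fnD: "smooth_fn F \<Longrightarrow> gplot n S c \<Longrightarrow> C_infinity n S (\<lambda>x. F (c x))"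
  using smooth_familyD[of 0 "\<lambda>_. F"] by simp

lemma smooth_family_fix:
  assumes "smooth_family p \<Psi>" "length gs = p"
  shows "smooth_fn (\<Psi> gs)"
proof (rule smooth_familyI)
  fix S :: "(nat \<Rightarrow> 'e) set" and cs c
  assume "open S" "gplot (0 + 1) S c"
  then have "C_infinity (0 + 1) S (\<lambda>x. \<Psi> (map (\<lambda>i. gs ! i) [0..<p]) (c x))"
    by (intro smooth_familyD[OF assms(1)] plot_const)
  then show "C_infinity (0 + 1) S (\<lambda>x. \<Psi> gs (c x))"
    using assms(2) map_nth[of gs] by simp
qed

lemma smooth_fn_left_translate: 
  assumes "smooth_fn F"
  shows "smooth_fn (\<lambda>h. F (g \<otimes> h))"
  by (rule smooth_familyI) (intro smooth_fnD[OF assms] gplot_mult plot_const)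

lemma smooth_fn_at:
  assumes "smooth_fn F"
  shows "smooth_on \<D> (\<lambda>v. F (g \<otimes> ec v))"
  unfolding smooth_on_def
  by (intro smooth_fnD[OF assms] gplot_mult plot_const gplot_ec C_infinity_proj open_proj_vimage open_D) simp

lemma left_deriv_dd: "left_deriv G F g X = dd (\<lambda>v. F (g \<otimes> ec v)) 0 X"
  by (simp add: left_deriv_def dd_def tangent_curve_ec)

lemma linear_left_deriv: "smooth_fn F \<Longrightarrow> linear (left_deriv G F g)"
  unfolding left_deriv_dd[abs_def] by (rule smooth_on_dd(3)[OF open_D smooth_fn_at zero_in_D])

text \<open>Allows curves other than \<open>tangent_curve\<close>: one-parameter subgroups of
  \<open>K\<close> and conjugated curves. Continuity is a hypothesis of its own, because the chart
  map takes arbitrary values outside \<U> and its derivative along \<gamma> would not force \<gamma>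
  into \<U>.\<close>

lemma left_deriv_curve:
  assumes F: "smooth_fn F" and \<gamma>: "isCont \<gamma> 0" "\<gamma> 0 = \<one>" "((\<lambda>t. \<u> (\<gamma> t)) has_vector_derivative X) (at 0)"
  shows "((\<lambda>t. F (g \<otimes> \<gamma> t)) has_vector_derivative left_deriv G F g X) (at 0)"
proof -
  let ?h = "\<lambda>t. \<u> (\<gamma> t) - \<u> \<one>"
  have "(?h has_vector_derivative X - 0) (at 0)"
    by (intro has_vector_derivative_diff \<gamma>(3) has_vector_derivative_const)
  then have h: "(?h has_vector_derivative X) (at 0)" by simp
  have "((\<lambda>v. F (g \<otimes> ec v)) has_derivative dd (\<lambda>v. F (g \<otimes> ec v)) 0) (at (?h 0))"
    using smooth_on_has_derivative[OF open_D smooth_fn_at[OF F] zero_in_D] \<gamma>(2) by simp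
  from has_vector_derivative_chain[OF this h]
  have "((\<lambda>t. F (g \<otimes> ec (?h t))) has_vector_derivative left_deriv G F g X) (at 0)"
    by (simp add: left_deriv_dd)
  then show ?thesis
  proof (rule has_vector_derivative_transform_eventually)
    have "\<forall>\<^sub>F t in at 0. \<gamma> t \<in> \<U>"
      using \<gamma>(1,2) unit_chart(2) unit_chart_facts(1) by (auto simp: isCont_def dest: topological_tendstoD)
    then show "\<forall>\<^sub>F t in at 0. F (g \<otimes> ec (?h t)) = F (g \<otimes> \<gamma> t)"
      by eventually_elim (simp add: ec_chart)
    show "F (g \<otimes> ec (?h 0)) = F (g \<otimes> \<gamma> 0)" by (simp add: \<gamma>(2) ec_chart unit_chart)
  qed
qed

lemma open_line_D: "open {t. t *\<^sub>R X \<in> \<D>}"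
proof -
  have "continuous_on UNIV (\<lambda>t. t *\<^sub>R X)" by (intro continuous_intros)
  from open_vimage[OF open_D this] show ?thesis by (simp add: vimage_def)
qed

lemma left_deriv_tangent_curve:
  assumes "smooth_fn F"
  shows "((\<lambda>t. F (g \<otimes> tangent_curve G X t)) has_vector_derivative left_deriv G F g X) (at 0)"
  using smooth_on_dd(2)[OF open_D smooth_fn_at[OF assms] zero_in_D, of g X]
  by (simp add: left_deriv_dd tangent_curve_ec)

lemma gplot_curve_continuous:
  assumes "gplot 1 {x. x 0 \<in> I} (\<lambda>x. \<gamma> (x 0))"
  shows "continuous_on I \<gamma>"
proof -
  have "continuous_on I (\<lambda>t. (\<lambda>x. \<gamma> (x 0)) (\<lambda>_::nat. t))"
    by (rule continuous_on_compose2[OF plotD(2)[OF assms] continuous_on_diag]) auto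
  then show ?thesis by simp
qed

lemma gplot_curve:
  fixes \<gamma> :: "real \<Rightarrow> 'g"
  assumes "open I" "0 \<in> I" "gplot 1 {x. x 0 \<in> I} (\<lambda>x. \<gamma> (x 0))" "\<gamma> 0 = \<one>"
  shows "isCont \<gamma> 0" "((\<lambda>t. \<u> (\<gamma> t)) has_vector_derivative vector_derivative (\<lambda>t. \<u> (\<gamma> t)) (at 0)) (at 0)"
proof -
  note cont = gplot_curve_continuous[OF assms(3)]
  then show "isCont \<gamma> 0" using assms(1,2) by (simp add: continuous_on_eq_continuous_at)
  let ?I = "I \<inter> \<gamma> -` \<U>"
  have I: "open ?I" by (rule continuous_open_preimage[OF cont assms(1) unit_chart_facts(1)])
  have "C_infinity 1 {x. x 0 \<in> ?I} (\<lambda>x. \<u> (\<gamma> (x 0)))"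
    by (rule C_infinity_subset[OF plotD(3)[OF assms(3) unit_chart(1)]]) auto
  then have "smooth_on ?I (\<lambda>t. \<u> (\<gamma> t))" by (simp add: smooth_on_def)
  from smooth_on_dd(2)[OF I this, of 0 1] assms(2,4) unit_chart(2)
  show "((\<lambda>t. \<u> (\<gamma> t)) has_vector_derivative vector_derivative (\<lambda>t. \<u> (\<gamma> t)) (at 0)) (at 0)"
    by (simp add: dd_def)
qed

lemma left_deriv_Ad:
  assumes "smooth_fn F"
  shows "((\<lambda>t. F (g \<otimes> (a \<otimes> tangent_curve G X t \<otimes> inv a))) has_vector_derivative left_deriv G F g (Ad G a X)) (at 0)"
proof (rule left_deriv_curve[OF assms])
  let ?I = "{t. t *\<^sub>R X \<in> \<D>}" and ?\<gamma> = "\<lambda>t. a \<otimes> tangent_curve G X t \<otimes> inv a"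
  have "gplot 1 {x. x 0 \<in> ?I} (\<lambda>x. ?\<gamma> (x 0))"
    unfolding tangent_curve_ec
    by (intro gplot_mult plot_const gplot_ec C_infinity_scaleR C_infinity_proj C_infinity_const open_proj_vimage open_line_D) simp
  moreover have "?\<gamma> 0 = \<one>" by (simp add: tangent_curve_ec)
  ultimately show "isCont ?\<gamma> 0" "?\<gamma> 0 = \<one>" "((\<lambda>t. \<u> (?\<gamma> t)) has_vector_derivative Ad G a X) (at 0)"
    using gplot_curve[OF open_line_D, of X ?\<gamma>] by (simp_all add: Ad_def)
qed

end

context lie_group_calculus
begin

subsection \<open>The commutator of left-invariant vector fields\<close>

text \<open>The left-invariant vector field of \<open>Y\<close> in the coordinates of the unit
  chart.\<close>

definition chart_field :: "'e \<Rightarrow> 'e \<Rightarrow> 'e"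
  where "chart_field Y v = left_deriv G \<u> (ec v) Y"

lemma chart_field:
  shows "smooth_on \<D> (chart_field Y)"
    and "v \<in> \<D> \<Longrightarrow> ((\<lambda>t. \<u> (ec v \<otimes> tangent_curve G Y t)) has_vector_derivative chart_field Y v) (at 0)"
proof -
  let ?H = "\<lambda>t x :: nat \<Rightarrow> 'e. \<u> (ec (x 0) \<otimes> tangent_curve G Y t)"
  let ?P = "\<lambda>y :: nat \<Rightarrow> 'e \<times> real. ec (fst (y (Suc 0))) \<otimes> ec (snd (y 0) *\<^sub>R Y)"
  let ?Q = "{y :: nat \<Rightarrow> 'e \<times> real. fst (y (Suc 0)) \<in> \<D>} \<inter> {y. snd (y 0) *\<^sub>R Y \<in> \<D>}"
  let ?T = "?Q \<inter> ?P -` \<U>" and ?S = "{x :: nat \<Rightarrow> 'e. x 0 \<in> \<D>}"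
  have "continuous_on UNIV (\<lambda>y :: nat \<Rightarrow> 'e \<times> real. fst (y (Suc 0)))"
    by (intro continuous_on_fst continuous_on_product_coordinates)
  moreover have "continuous_on UNIV (\<lambda>y :: nat \<Rightarrow> 'e \<times> real. snd (y 0) *\<^sub>R Y)"
    by (intro continuous_on_scaleR continuous_on_const continuous_on_snd continuous_on_product_coordinates)
  ultimately have T0: "open ?Q"
    using open_vimage[OF open_D] by (auto simp: vimage_def)
  have P: "gplot (Suc 1) ?Q ?P"
    by (intro gplot_mult gplot_ec T0 C_infinity_scaleR C_infinity_const
        C_infinity_bounded_linear[OF bounded_linear_snd] C_infinity_bounded_linear[OF bounded_linear_fst] C_infinity_proj) auto
  have T: "open ?T" by (rule continuous_open_preimage[OF plotD(2)[OF P] T0 unit_chart_facts(1)])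
  have "C_infinity (Suc 1) ?T (\<lambda>y. \<u> (?P y))" by (rule plotD(3)[OF P unit_chart(1)])
  then have H: "C_infinity (Suc 1) ?T (\<lambda>y. ?H (snd (y 0)) (\<lambda>i. fst (y (Suc i))))"
    by (simp add: tangent_curve_ec)
  have ST: "y \<in> ?T" if "x \<in> ?S" "\<And>i. fst (y (Suc i)) = x i" "snd (y 0) = 0" for x y
    using that chart_ec(2)[of "x 0"] by simp
  note S = open_proj_vimage[OF open_D, of 0]
  have "C_infinity 1 ?S (\<lambda>x. vector_derivative (\<lambda>t. ?H t x) (at 0))"
    by (rule parameter_derivative(1)[where H = ?H, OF T S H ST])
  then show "smooth_on \<D> (chart_field Y)"
    by (simp add: smooth_on_def chart_field_def left_deriv_def)
  assume "v \<in> \<D>"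
  then have "((\<lambda>t. ?H t (\<lambda>_. v)) has_vector_derivative vector_derivative (\<lambda>t. ?H t (\<lambda>_. v)) (at 0)) (at 0)"
    by (intro parameter_derivative(2)[where H = ?H, OF T S H ST]) simp_all
  then show "((\<lambda>t. \<u> (ec v \<otimes> tangent_curve G Y t)) has_vector_derivative chart_field Y v) (at 0)"
    by (simp add: chart_field_def left_deriv_def)
qed

lemma chart_field_0: "chart_field Y 0 = Y"
proof -
  have "((\<lambda>t. \<u> \<one> + t *\<^sub>R Y) has_vector_derivative Y) (at 0)"
    by (auto intro!: derivative_eq_intros)
  then have "((\<lambda>t. \<u> (ec 0 \<otimes> tangent_curve G Y t)) has_vector_derivative Y) (at 0)"
    by (rule has_vector_derivative_transform_within_open[OF _ open_line_D[of Y]])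
      (simp_all add: tangent_curve_ec chart_ec)
  from vector_derivative_unique_at[OF this chart_field(2)[OF zero_in_D]] show ?thesis by simp
qed

lemma left_deriv_in_chart:
  assumes F: "smooth_fn F" and v: "v \<in> \<D>"
  shows "left_deriv G F (ec v) Y = dd (\<lambda>v. F (ec v)) v (chart_field Y v)"
proof -
  let ?I = "{t. t *\<^sub>R Y \<in> \<D>}" and ?\<gamma> = "\<lambda>t. ec v \<otimes> tangent_curve G Y t"
  let ?h = "\<lambda>t. \<u> (?\<gamma> t) - \<u> \<one>"
  have f: "smooth_on \<D> (\<lambda>v. F (ec v))" using smooth_fn_at[OF F, of \<one>] by simp
  have "(?h has_vector_derivative chart_field Y v - 0) (at 0)"
    by (intro has_vector_derivative_diff chart_field(2) v has_vector_derivative_const)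
  then have h: "(?h has_vector_derivative chart_field Y v) (at 0)" by simp
  have h0: "?h 0 = v" using v by (simp add: tangent_curve_ec chart_ec)
  have "((\<lambda>v. F (ec v)) has_derivative dd (\<lambda>v. F (ec v)) v) (at (?h 0))"
    unfolding h0 by (rule smooth_on_has_derivative[OF open_D f v])
  from has_vector_derivative_chain[OF this h]
  have "((\<lambda>t. F (ec (?h t))) has_vector_derivative dd (\<lambda>v. F (ec v)) v (chart_field Y v)) (at 0)" .
  then have "((\<lambda>t. F (?\<gamma> t)) has_vector_derivative dd (\<lambda>v. F (ec v)) v (chart_field Y v)) (at 0)"
  proof (rule has_vector_derivative_transform_eventually)
    have "gplot 1 {x. x 0 \<in> ?I} (\<lambda>x. ?\<gamma> (x 0))"
      unfolding tangent_curve_ec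
      by (intro gplot_mult plot_const gplot_ec C_infinity_scaleR C_infinity_proj C_infinity_const open_proj_vimage open_line_D) simp
    from gplot_curve_continuous[OF this] have "isCont ?\<gamma> 0"
      using open_line_D[of Y] by (simp add: continuous_on_eq_continuous_at)
    then have "\<forall>\<^sub>F t in at 0. ?\<gamma> t \<in> \<U>"
      using unit_chart_facts(1) chart_ec(2)[OF v]
      by (auto simp: isCont_def tangent_curve_ec dest: topological_tendstoD)
    then show "\<forall>\<^sub>F t in at 0. F (ec (?h t)) = F (?\<gamma> t)"
      by eventually_elim (simp add: ec_chart)
    show "F (ec (?h 0)) = F (?\<gamma> 0)" unfolding h0 by (simp add: tangent_curve_ec)
  qed
  then show ?thesis by (simp add: left_deriv_def vector_derivative_at)
qed

text \<open>In the chart, differentiating the field \<open>Y\<close> applied to \<open>F\<close>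
  gives the Hessian of \<open>F\<close>, which is symmetric, and a first-order term in which the
  coefficients of \<open>Y\<close> are differentiated. The first-order term is one half of
  \<open>lie_bracket\<close>.\<close>

lemma second_left_deriv_at_unit:
  assumes F: "smooth_fn F"
  shows "left_deriv G (\<lambda>h. left_deriv G F h Y) \<one> X =
    dd (\<lambda>v. dd (\<lambda>v. F (ec v)) v X) 0 Y + left_deriv G F \<one> (left_deriv G (\<lambda>h. left_deriv G \<u> h Y) \<one> X)"
proof -
  let ?f = "\<lambda>v. F (ec v)" and ?W = "chart_field Y"
  have f: "smooth_on \<D> ?f" using smooth_fn_at[OF F, of \<one>] by simp
  have lin: "linear (dd ?f v)" if "v \<in> \<D>" for v by (rule smooth_on_dd(3)[OF open_D f that])
  have W: "((\<lambda>t. ?W (0 + t *\<^sub>R X)) has_vector_derivative dd ?W 0 X) (at 0)"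
    by (rule smooth_on_dd(2)[OF open_D chart_field(1) zero_in_D])
  have Wb: "((\<lambda>t. ?W (0 + t *\<^sub>R X) \<bullet> b) has_vector_derivative dd ?W 0 X \<bullet> b) (at 0)" for b
    by (rule bounded_linear.has_vector_derivative[OF bounded_linear_inner_left W])
  have fb: "((\<lambda>t. dd ?f (0 + t *\<^sub>R X) b) has_vector_derivative dd (\<lambda>v. dd ?f v b) 0 X) (at 0)" for b
    by (rule smooth_on_dd(2)[OF open_D smooth_on_dd(1)[OF open_D f] zero_in_D])
  have "((\<lambda>t. \<Sum>b\<in>frame. (?W (0 + t *\<^sub>R X) \<bullet> b) *\<^sub>R dd ?f (0 + t *\<^sub>R X) b) has_vector_derivative
      (\<Sum>b\<in>frame. (?W (0 + 0 *\<^sub>R X) \<bullet> b) *\<^sub>R dd (\<lambda>v. dd ?f v b) 0 X + (dd ?W 0 X \<bullet> b) *\<^sub>R dd ?f (0 + 0 *\<^sub>R X) b)) (at 0)"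
    by (intro has_vector_derivative_sum bounded_bilinear.has_vector_derivative[OF bounded_bilinear_scaleR] Wb fb)
  moreover have "(\<Sum>b\<in>frame. (?W (0 + 0 *\<^sub>R X) \<bullet> b) *\<^sub>R dd (\<lambda>v. dd ?f v b) 0 X + (dd ?W 0 X \<bullet> b) *\<^sub>R dd ?f (0 + 0 *\<^sub>R X) b) =
      dd (\<lambda>v. dd ?f v X) 0 Y + dd ?f 0 (dd ?W 0 X)"
  proof -
    have "dd (\<lambda>v. dd ?f v b) 0 X = dd (\<lambda>v. dd ?f v X) 0 b" for b
      by (rule dd_commute[OF open_D zero_in_D f])
    then show ?thesis
      using linear_frame_expansion[OF smooth_on_dd(3)[OF open_D smooth_on_dd(1)[OF open_D f] zero_in_D], of X Y]
        linear_frame_expansion[OF lin[OF zero_in_D], of "dd ?W 0 X"]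
      by (simp add: sum.distrib chart_field_0)
  qed
  ultimately have "((\<lambda>t. \<Sum>b\<in>frame. (?W (0 + t *\<^sub>R X) \<bullet> b) *\<^sub>R dd ?f (0 + t *\<^sub>R X) b) has_vector_derivative
      dd (\<lambda>v. dd ?f v X) 0 Y + dd ?f 0 (dd ?W 0 X)) (at 0)" by simp
  then have "((\<lambda>t. left_deriv G F (\<one> \<otimes> tangent_curve G X t) Y) has_vector_derivative
      dd (\<lambda>v. dd ?f v X) 0 Y + dd ?f 0 (dd ?W 0 X)) (at 0)"
  proof (rule has_vector_derivative_transform_within_open[OF _ open_line_D[of X]])
    show "(\<Sum>b\<in>frame. (?W (0 + t *\<^sub>R X) \<bullet> b) *\<^sub>R dd ?f (0 + t *\<^sub>R X) b) = left_deriv G F (\<one> \<otimes> tangent_curve G X t) Y"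
      if "t \<in> {t. t *\<^sub>R X \<in> \<D>}" for t
      using that linear_frame_expansion[OF lin, of "t *\<^sub>R X" "?W (t *\<^sub>R X)"]
      by (simp add: tangent_curve_ec left_deriv_in_chart[OF F])
  qed simp
  then have "left_deriv G (\<lambda>h. left_deriv G F h Y) \<one> X = dd (\<lambda>v. dd ?f v X) 0 Y + dd ?f 0 (dd ?W 0 X)"
    unfolding left_deriv_def[of G "\<lambda>h. left_deriv G F h Y"] by (rule vector_derivative_at)
  moreover have "dd ?W 0 X = left_deriv G (\<lambda>h. left_deriv G \<u> h Y) \<one> X"
    by (simp add: dd_def left_deriv_def[of G "\<lambda>h. left_deriv G \<u> h Y"] chart_field_def tangent_curve_ec)
  moreover have "dd ?f 0 Z = left_deriv G F \<one> Z" for Z by (simp add: left_deriv_dd)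
  ultimately show ?thesis by simp
qed

lemma left_deriv_translate: "left_deriv G F (g \<otimes> h) Y = left_deriv G (\<lambda>h. F (g \<otimes> h)) h Y"
  by (simp add: left_deriv_def m_assoc)

text \<open>Left-invariance moves the claim to the unit, for the translated function. There the
  Hessians cancel and the first-order terms form the bracket.\<close>

lemma left_deriv_commutator:
  assumes F: "smooth_fn F"
  shows "left_deriv G (\<lambda>h. left_deriv G F h Y) g X - left_deriv G (\<lambda>h. left_deriv G F h X) g Y =
    left_deriv G F g (lie_bracket G X Y)"
proof -
  let ?F = "\<lambda>h. F (g \<otimes> h)"
  have F': "smooth_fn ?F" by (rule smooth_fn_left_translate[OF F])
  have f: "smooth_on \<D> (\<lambda>v. ?F (ec v))" by (rule smooth_fn_at[OF F])
  have eq: "left_deriv G (\<lambda>h. left_deriv G F h Y) g X = left_deriv G (\<lambda>h. left_deriv G ?F h Y) \<one> X" for X Y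
    using left_deriv_translate[of "\<lambda>h. left_deriv G F h Y" g \<one> X] by (simp add: left_deriv_translate[symmetric])
  have eq1: "left_deriv G F g Z = left_deriv G ?F \<one> Z" for Z
    using left_deriv_translate[of F g \<one> Z] by simp
  show ?thesis
    unfolding eq eq1 second_left_deriv_at_unit[OF F'] lie_bracket_def
    by (simp add: linear_diff[OF linear_left_deriv[OF F']] dd_commute[OF open_D zero_in_D f, of X Y])
qed

end

section \<open>Pullback of alternating maps and horizontality\<close>

lemma alternating_compose:
  fixes \<alpha> :: "'w::real_vector list \<Rightarrow> 'v::real_vector"
  assumes "alternating_multilinear \<alpha>" "linear L" "linear M"
  shows "alternating_multilinear (\<lambda>Xs. M (\<alpha> (map L Xs)))"
  unfolding alternating_multilinear_def
proof (intro conjI allI impI)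
  fix Xs :: "'a list" and i assume "i < length Xs"
  then have "linear (\<lambda>w. \<alpha> ((map L Xs)[i := w]))" using assms(1) by (simp add: alternating_multilinear_def)
  from linear_compose[OF linear_compose[OF assms(2) this] assms(3)]
  show "linear (\<lambda>X. M (\<alpha> (map L (Xs[i := X]))))" by (simp add: o_def map_update)
next
  fix Xs :: "'a list" assume "\<not> distinct Xs"
  then have "\<not> distinct (map L Xs)" by (simp add: distinct_map)
  then show "M (\<alpha> (map L Xs)) = 0" using assms(1) linear_0[OF assms(3)] by (simp add: alternating_eq_0)
qed

text \<open>Arguments are exchanged one at a time; the difference lies in \<kk> and is moved to the
  front, where the map vanishes.\<close>

lemma multilinear_horizontal_cong:
  assumes ml: "alternating_multilinear \<alpha>" and hor: "\<And>X Xs. X \<in> \<kk> \<Longrightarrow> \<alpha> (X # Xs) = 0"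
  shows "list_all2 (\<lambda>X Y. X - Y \<in> \<kk>) Xs Ys \<Longrightarrow> \<alpha> (Zs @ Xs) = \<alpha> (Zs @ Ys)"
proof (induction Xs Ys arbitrary: Zs rule: list_all2_induct)
  case (Cons X Xs Y Ys)
  have "\<alpha> (Zs @ X # Xs) - \<alpha> (Zs @ Y # Xs) = \<alpha> (Zs @ (X - Y) # Xs)"
    by (rule linear_diff[OF multilinear_middle[OF alternating_imp_multilinear[OF ml]], symmetric])
  also have "\<dots> = 0" by (simp add: alternating_move_to_front[OF ml] hor[OF Cons.hyps(1)])
  finally show ?case using Cons.IH[of "Zs @ [Y]"] by simp
qed simp

section \<open>Basic cochains and forms on the homogeneous space\<close>

locale homogeneous = lie_group_calculus G
  for G :: "('g::{t2_space, second_countable_topology}, 'e::fin_dim_space) smooth_group" (structure) +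
  fixes K :: "'g set" and \<rho> :: "'g \<Rightarrow> 'v::fin_dim_space \<Rightarrow> 'v"
    and pr :: "'e \<Rightarrow> 'w::fin_dim_space" and \<Phi> :: "'g set \<Rightarrow> 'w"
  assumes K: "subgroup K G" and rep: "smooth_representation G \<rho>"
    and pr: "quotient_projection G K pr" and \<Phi>: "homogeneous_space_diffeo G K \<Phi>" and \<Phi>_K: "\<Phi> K = 0"
begin

abbreviation "\<pi> \<equiv> lift_to_group G K \<Phi>"
abbreviation "d\<pi> \<equiv> left_deriv G \<pi>"
abbreviation "\<kk> \<equiv> lie_subalgebra G K"
abbreviation "D \<equiv> double_cochains_basic G \<rho> K"
abbreviation "fo \<equiv> form_of G K \<rho> \<Phi>"

lemma rho_linear: "linear (\<rho> g)" and rho_one [simp]: "\<rho> \<one> v = v"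
  and rho_mult: "\<rho> (g \<otimes> h) v = \<rho> g (\<rho> h v)" and rho_smooth_fn: "smooth_fn (\<lambda>g. \<rho> g v)"
  using rep by (simp_all add: smooth_representation_def smooth_fn_iff)

lemma rho_inv [simp]: "\<rho> g (\<rho> (inv g) v) = v" "\<rho> (inv g) (\<rho> g v) = v"
  by (simp_all add: rho_mult[symmetric])

lemma rho_C_infinity:
  assumes "gplot n S c" "C_infinity n S f"
  shows "C_infinity n S (\<lambda>x. \<rho> (c x) (f x))"
proof -
  have "C_infinity n S (\<lambda>x. \<Sum>b\<in>frame. (f x \<bullet> b) *\<^sub>R \<rho> (c x) b)"
    by (intro C_infinity_sum C_infinity_scaleR C_infinity_inner_left assms(2) smooth_fnD[OF rho_smooth_fn assms(1)])
  then show ?thesis by (simp only: linear_frame_expansion[OF rho_linear, symmetric])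
qed

lemma pi_smooth: "smooth_fn \<pi>" and dpi_surj: "surj (d\<pi> g)"
  using \<Phi> by (simp_all add: homogeneous_space_diffeo_def smooth_fn_iff)

lemma dpi_linear: "linear (d\<pi> g)"
  by (rule linear_left_deriv[OF pi_smooth])

lemma coset_mult_K: "a \<in> K \<Longrightarrow> (g \<otimes> a) <# K = g <# K"
proof -
  assume a: "a \<in> K"
  have "\<exists>k'\<in>K. g \<otimes> a \<otimes> k = g \<otimes> k'" if "k \<in> K" for k
    using subgroup.m_closed[OF K a that] by (intro bexI[of _ "a \<otimes> k"]) (simp_all add: m_assoc)
  moreover have "\<exists>k'\<in>K. g \<otimes> k = g \<otimes> a \<otimes> k'" if "k \<in> K" for k
    using subgroup.m_closed[OF K subgroup.m_inv_closed[OF K a] that]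
    by (intro bexI[of _ "inv a \<otimes> k"]) (simp_all add: m_assoc flip: m_assoc[of a "inv a"])
  ultimately show ?thesis unfolding l_coset_def by blast
qed

lemma pi_mult_K [simp]: "a \<in> K \<Longrightarrow> \<pi> (g \<otimes> a) = \<pi> g"
  by (simp add: lift_to_group_def coset_mult_K)

lemma pi_one [simp]: "\<pi> \<one> = 0"
proof -
  have "\<one> <# K = K" unfolding l_coset_def by simp
  then show ?thesis by (simp add: lift_to_group_def \<Phi>_K)
qed

lemma pi_K [simp]: "a \<in> K \<Longrightarrow> \<pi> a = 0"
  using pi_mult_K[of a \<one>] by simp

lemma pi_eqD:
  assumes "\<pi> g = \<pi> h"
  obtains a where "a \<in> K" "h = g \<otimes> a"
proof -
  have "inj_on \<Phi> (lcosets K)" using \<Phi> by (simp add: homogeneous_space_diffeo_def bij_betw_def)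
  moreover have "g <# K \<in> lcosets K" "h <# K \<in> lcosets K" by (auto simp: LCOSETS_def)
  ultimately have "g <# K = h <# K" using assms by (simp add: lift_to_group_def inj_on_def)
  then have "h \<in> g <# K" using lcos_self[OF _ K, of h] by simp
  then show ?thesis using that by (auto simp: l_coset_def)
qed

lemma pi_surj: obtains g where "\<pi> g = w"
proof -
  have "w \<in> \<Phi> ` (lcosets K)" using \<Phi> by (simp add: homogeneous_space_diffeo_def bij_betw_def)
  then show ?thesis using that by (auto simp: LCOSETS_def lift_to_group_def)
qed

lemma dpi_lie_subalgebra:
  assumes "X \<in> \<kk>"
  shows "d\<pi> g X = 0"
proof -
  obtain \<gamma> where \<gamma>: "continuous_on UNIV \<gamma>" "\<And>t. \<gamma> t \<in> K" "\<And>s t. \<gamma> (s + t) = \<gamma> s \<otimes> \<gamma> t"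
    "((\<lambda>t::real. \<u> (\<gamma> t)) has_vector_derivative X) (at 0)"
    using assms unfolding lie_subalgebra_def by blast
  \<comment> \<open>An idempotent of a group is the unit; the defining conditions of
    \<open>lie_subalgebra\<close> do not state where \<gamma> starts.\<close>
  have "inv (\<gamma> 0) \<otimes> (\<gamma> 0 \<otimes> \<gamma> 0) = \<gamma> 0" by (simp flip: m_assoc)
  then have "\<gamma> 0 = \<one>" using \<gamma>(3)[of 0 0] by simp
  moreover have "isCont \<gamma> 0" using \<gamma>(1) by (simp add: continuous_on_eq_continuous_at)
  ultimately have "((\<lambda>t. \<pi> (g \<otimes> \<gamma> t)) has_vector_derivative d\<pi> g X) (at 0)"
    using left_deriv_curve[OF pi_smooth] \<gamma>(4) by blast
  then have "((\<lambda>t. \<pi> g) has_vector_derivative d\<pi> g X) (at 0)" by (simp add: \<gamma>(2))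
  from vector_derivative_unique_at[OF this has_vector_derivative_const] show ?thesis .
qed

text \<open>Equality of the two subspaces holds for dimension reasons: both \<open>pr\<close> and \<open>d\<pi> g\<close> map onto \<open>'w\<close>.\<close>

lemma dpi_kernel:
  assumes "d\<pi> g X = 0"
  shows "X \<in> \<kk>"
proof -
  have pr': "linear pr" "surj pr" "{X. pr X = 0} = \<kk>" using pr by (auto simp: quotient_projection_def)
  obtain s where s: "linear s" "pr \<circ> s = id"
    using linear_surjective_right_inverse[OF pr'(1,2)] by blast
  have prs: "pr (s w) = w" for w using s(2) by (simp add: fun_eq_iff)
  have eq: "d\<pi> g Y = d\<pi> g (s (pr Y))" for Y
  proof -
    have "pr (Y - s (pr Y)) = 0" by (simp add: linear_diff[OF pr'(1)] prs)
    then have "d\<pi> g (Y - s (pr Y)) = 0" using pr'(3) by (intro dpi_lie_subalgebra) blast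
    then show ?thesis by (simp add: linear_diff[OF dpi_linear])
  qed
  have lin: "linear (\<lambda>w. d\<pi> g (s w))" using linear_compose[OF s(1) dpi_linear] by (simp add: o_def)
  have "surj (\<lambda>w. d\<pi> g (s w))"
    unfolding surj_def
  proof
    fix w
    obtain Y where "w = d\<pi> g Y" using dpi_surj[of g] by (rule surjE)
    then show "\<exists>x. w = d\<pi> g (s x)" using eq[of Y] by (intro exI[of _ "pr Y"]) simp
  qed
  then have "inj (\<lambda>w. d\<pi> g (s w))" by (rule linear_surj_imp_inj[OF lin])
  moreover have "d\<pi> g (s (pr X)) = d\<pi> g (s 0)"
    using assms eq[of X] linear_0[OF lin] by simp
  ultimately have "pr X = 0" by (rule injD)
  then show ?thesis using pr'(3) by blast
qed

text \<open>Conjugating the curve by \<open>inv a\<close> turns right translation of the base point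
  by \<open>a\<close> into a right factor \<open>a\<close> at the end, which \<pi> ignores.\<close>

lemma dpi_Ad:
  assumes "a \<in> K"
  shows "d\<pi> (g \<otimes> a) (Ad G (inv a) X) = d\<pi> g X"
proof -
  have "((\<lambda>t. \<pi> (g \<otimes> a \<otimes> (inv a \<otimes> tangent_curve G X t \<otimes> inv (inv a)))) has_vector_derivative
      d\<pi> (g \<otimes> a) (Ad G (inv a) X)) (at 0)"
    by (rule left_deriv_Ad[OF pi_smooth])
  moreover have "\<pi> (g \<otimes> a \<otimes> (inv a \<otimes> h \<otimes> inv (inv a))) = \<pi> (g \<otimes> h)" for h
  proof -
    have "g \<otimes> a \<otimes> (inv a \<otimes> h \<otimes> inv (inv a)) = g \<otimes> h \<otimes> a"
      by (simp add: m_assoc flip: m_assoc[of a "inv a"])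
    then show ?thesis using assms by simp
  qed
  ultimately have "((\<lambda>t. \<pi> (g \<otimes> tangent_curve G X t)) has_vector_derivative d\<pi> (g \<otimes> a) (Ad G (inv a) X)) (at 0)"
    by simp
  from vector_derivative_unique_at[OF this left_deriv_tangent_curve[OF pi_smooth]] show ?thesis .
qed

subsection \<open>Local sections\<close>

text \<open>Composing with a right inverse \<open>L\<close> of \<open>d\<pi> g0\<close> makes the
  derivative at 0 the identity, as \<open>smooth_local_inverse\<close> requires.\<close>

lemma local_section:
  obtains V s and L :: "'w \<Rightarrow> 'e" where "open V" "\<pi> g0 \<in> V" "smooth_on V s" "linear L"
    "\<And>w. w \<in> V \<Longrightarrow> L (s w) \<in> \<D>" "\<And>w. w \<in> V \<Longrightarrow> \<pi> (g0 \<otimes> ec (L (s w))) = w"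
proof -
  obtain L where L: "linear L" "d\<pi> g0 \<circ> L = id"
    using linear_surjective_right_inverse[OF dpi_linear dpi_surj] by blast
  let ?f = "\<lambda>v. \<pi> (g0 \<otimes> ec (L v))" and ?U = "{v. L v \<in> \<D>}"
  have U: "open ?U"
    using open_vimage[OF open_D linear_continuous_on[OF linear_imp_bounded_linear[OF L(1)], of UNIV]]
    by (simp add: vimage_def)
  have U0: "0 \<in> ?U" by (simp add: linear_0[OF L(1)])
  have f: "smooth_on ?U ?f"
    unfolding smooth_on_def
    by (intro smooth_fnD[OF pi_smooth] gplot_mult plot_const gplot_ec C_infinity_linear[OF L(1)] C_infinity_proj
        open_proj_vimage U) simp
  have "dd ?f 0 v = v" for v
  proof -
    have "dd ?f 0 v = d\<pi> g0 (L v)"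
      by (simp add: dd_def left_deriv_def tangent_curve_ec linear_scale[OF L(1)])
    then show ?thesis using L(2) by (simp add: fun_eq_iff)
  qed
  note inverse = smooth_local_inverse[OF U U0 f this]
  obtain V s where V: "open V" "?f 0 \<in> V" "smooth_on V s" "s (?f 0) = 0"
    "\<And>y. y \<in> V \<Longrightarrow> s y \<in> ?U" "\<And>y. y \<in> V \<Longrightarrow> ?f (s y) = y"
    by (rule inverse) (rule that, assumption, assumption, assumption, assumption, blast, blast)
  have V0: "\<pi> g0 \<in> V" using V(2) by (simp add: linear_0[OF L(1)])
  have VD: "L (s w) \<in> \<D>" if "w \<in> V" for w using V(5)[OF that] by simp
  show ?thesis by (rule that[OF V(1) V0 V(3) L(1)]) (erule VD, erule V(6))
qed

lemma local_lift:
  fixes w :: "(nat \<Rightarrow> 'p::fin_dim_space) \<Rightarrow> 'w"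
  assumes S: "open S" "x0 \<in> S" and w: "C_infinity n S w"
  obtains U c where "open U" "x0 \<in> U" "U \<subseteq> S" "gplot n U c" "\<And>x. x \<in> U \<Longrightarrow> \<pi> (c x) = w x"
proof -
  obtain g0 where g0: "\<pi> g0 = w x0" by (rule pi_surj)
  obtain V s and L :: "'w \<Rightarrow> 'e" where V: "open V" "\<pi> g0 \<in> V" "smooth_on V s" "linear L"
    "\<And>w. w \<in> V \<Longrightarrow> L (s w) \<in> \<D>" "\<And>w. w \<in> V \<Longrightarrow> \<pi> (g0 \<otimes> ec (L (s w))) = w"
    by (rule local_section[of g0]) blast
  let ?U = "S \<inter> w -` V"
  have U: "open ?U" by (rule continuous_open_preimage[OF C_infinity_continuous[OF w] S(1) V(1)])
  have "gplot n ?U (\<lambda>x. g0 \<otimes> ec (L (s (w x))))"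
  proof (intro gplot_mult plot_const gplot_ec U C_infinity_linear[OF V(4)])
    show "C_infinity n ?U (\<lambda>x. s (w x))"
      by (rule smooth_on_compose_C_infinity[OF V(1,3) U C_infinity_subset[OF w]]) auto
  qed (use V(5) in simp)
  then show ?thesis using that[OF U _ _ _] S(2) g0 V(2,6) by simp
qed

text \<open>At \<open>x0\<close> the map \<open>d\<pi> (c x0)\<close> composed with \<open>L\<close>
  is the identity. Nearby it is a \<open>near_identity\<close>, and \<open>L\<close> after its
  inverse is a smoothly varying right inverse.\<close>

lemma local_vector_lift:
  fixes c :: "(nat \<Rightarrow> 'p::fin_dim_space) \<Rightarrow> 'g"
  assumes c: "gplot n S c" and x0: "x0 \<in> S"
  obtains U R where "open U" "x0 \<in> U" "U \<subseteq> S" "\<And>v. C_infinity n U (\<lambda>x. R x v)"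
    "\<And>x v. x \<in> U \<Longrightarrow> d\<pi> (c x) (R x v) = v"
proof -
  obtain L where L: "linear L" "d\<pi> (c x0) \<circ> L = id"
    using linear_surjective_right_inverse[OF dpi_linear dpi_surj] by blast
  have smooth: "C_infinity n S (\<lambda>x. d\<pi> (c x) (L v))" for v
    using left_deriv_family[OF pi_smooth _ c, of _ "L v"] by simp
  have lin: "linear (\<lambda>v. d\<pi> (c x) (L v))" for x using linear_compose[OF L(1) dpi_linear] by (simp add: o_def)
  obtain U where U: "open U" "x0 \<in> U" "U \<subseteq> S" "\<And>x. x \<in> U \<Longrightarrow> near_identity (\<lambda>v. d\<pi> (c x) (L v))"
    by (rule near_identity_neighbourhood[OF plotD(1)[OF c] x0, of "\<lambda>x v. d\<pi> (c x) (L v)"])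
      (use lin C_infinity_continuous[OF smooth] L(2) in \<open>auto simp: fun_eq_iff\<close>)
  let ?R = "\<lambda>x v. L (inv_into UNIV (\<lambda>v. d\<pi> (c x) (L v)) v)"
  have "C_infinity n U (\<lambda>x. ?R x v)" for v
    by (intro C_infinity_linear[OF L(1)] near_identity_inverse U C_infinity_subset[OF smooth])
  moreover have "d\<pi> (c x) (?R x v) = v" if "x \<in> U" for x v
    using near_identity.inv_right[OF U(4)[OF that], of v] .
  ultimately show ?thesis by (rule that[of U ?R, OF U(1-3)])
qed

subsection \<open>The correspondence of basic cochains and forms\<close>

lemma basicD:
  assumes "\<psi> \<in> D"
  shows "alternating_multilinear (\<psi> gs g)" "smooth_family p (\<lambda>gs g. \<psi> gs g Xs)"
    "X \<in> \<kk> \<Longrightarrow> \<psi> gs g (X # Xs) = 0"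
    "a \<in> K \<Longrightarrow> \<rho> a (\<psi> gs (g \<otimes> a) (map (Ad G (inv a)) Xs)) = \<psi> gs g Xs"
    "\<exists>N. \<forall>gs g Xs. N < length gs + length Xs \<longrightarrow> \<psi> gs g Xs = 0"
  using assms unfolding double_cochains_basic_def smooth_family_def by blast+

lemma basicI:
  assumes "\<exists>N. \<forall>gs g Xs. N < length gs + length Xs \<longrightarrow> \<psi> gs g Xs = 0"
    "\<And>gs g. alternating_multilinear (\<psi> gs g)" "\<And>p Xs. smooth_family p (\<lambda>gs g. \<psi> gs g Xs)"
    "\<And>X gs g Xs. X \<in> \<kk> \<Longrightarrow> \<psi> gs g (X # Xs) = 0"
    "\<And>a gs g Xs. a \<in> K \<Longrightarrow> \<rho> a (\<psi> gs (g \<otimes> a) (map (Ad G (inv a)) Xs)) = \<psi> gs g Xs"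
  shows "\<psi> \<in> D"
  using assms unfolding double_cochains_basic_def smooth_family_def by blast

text \<open>A pulled back form is horizontal because \<open>d\<pi>\<close> kills \<kk>, and
  invariant by \<open>dpi_Ad\<close>; the twist by \<open>\<rho> (inv g)\<close> absorbs the factor
  \<open>\<rho> a\<close>.\<close>

lemma of_form_basic:
  assumes "\<exists>N. \<forall>gs w ws. N < length gs + length ws \<longrightarrow> \<beta> gs w ws = 0"
    and alt: "\<And>gs w. alternating_multilinear (\<beta> gs w)"
    and "\<And>p Xs. smooth_family p (\<lambda>gs g. of_form G K \<rho> \<Phi> \<beta> gs g Xs)"
  shows "of_form G K \<rho> \<Phi> \<beta> \<in> D"
proof (rule basicI)
  obtain N where "\<And>gs w ws. N < length gs + length ws \<Longrightarrow> \<beta> gs w ws = 0" using assms(1) by blast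
  then show "\<exists>N. \<forall>gs g Xs. N < length gs + length Xs \<longrightarrow> of_form G K \<rho> \<Phi> \<beta> gs g Xs = 0"
    by (intro exI[of _ N]) (simp add: of_form_def linear_0[OF rho_linear])
  show "alternating_multilinear (of_form G K \<rho> \<Phi> \<beta> gs g)" for gs g
    unfolding of_form_def[abs_def] by (rule alternating_compose[OF alt dpi_linear rho_linear])
  show "of_form G K \<rho> \<Phi> \<beta> gs g (X # Xs) = 0" if "X \<in> \<kk>" for X gs g Xs
    using linear_0[OF multilinear_middle[OF alternating_imp_multilinear[OF alt], of gs "\<pi> g" "[]" "map (d\<pi> g) Xs"]]
    by (simp add: of_form_def dpi_lie_subalgebra[OF that] linear_0[OF rho_linear])
  show "\<rho> a (of_form G K \<rho> \<Phi> \<beta> gs (g \<otimes> a) (map (Ad G (inv a)) Xs)) = of_form G K \<rho> \<Phi> \<beta> gs g Xs" if "a \<in> K" for a gs g Xs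
  proof -
    have "map (d\<pi> (g \<otimes> a)) (map (Ad G (inv a)) Xs) = map (d\<pi> g) Xs"
      by (simp add: dpi_Ad[OF that])
    moreover have "a \<otimes> inv (g \<otimes> a) = inv g"
      by (simp add: inv_mult_group flip: m_assoc)
    ultimately show ?thesis
      by (simp only: of_form_def pi_mult_K[OF that] rho_mult[symmetric])
  qed
qed (rule assms(3))

text \<open>Well-definedness. Two representatives of the same point and vectors differ by some
  \<open>a\<close> in \<open>K\<close> and by elements of the kernel of \<open>d\<pi>\<close>, which
  is \<kk>: the first is harmless by invariance, the second by horizontality.\<close>

lemma form_of_eq:
  assumes \<psi>: "\<psi> \<in> D"
  shows "fo \<psi> gs (\<pi> g) (map (d\<pi> g) Xs) = \<rho> g (\<psi> gs g Xs)"
  unfolding form_of_def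
proof (rule the_equality)
  show "\<exists>g' Xs'. \<pi> g' = \<pi> g \<and> map (d\<pi> g') Xs' = map (d\<pi> g) Xs \<and> \<rho> g (\<psi> gs g Xs) = \<rho> g' (\<psi> gs g' Xs')"
    by blast
  fix v assume "\<exists>g' Xs'. \<pi> g' = \<pi> g \<and> map (d\<pi> g') Xs' = map (d\<pi> g) Xs \<and> v = \<rho> g' (\<psi> gs g' Xs')"
  then obtain g' Xs' where g': "\<pi> g = \<pi> g'" "map (d\<pi> g') Xs' = map (d\<pi> g) Xs" "v = \<rho> g' (\<psi> gs g' Xs')"
    by metis
  obtain a where a: "a \<in> K" "g' = g \<otimes> a" using pi_eqD[OF g'(1)] .
  have len: "length Xs' = length Xs" using g'(2) by (metis length_map)
  have "Xs' ! i - Ad G (inv a) (Xs ! i) \<in> \<kk>" if "i < length Xs" for i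
  proof -
    have "d\<pi> g' (Xs' ! i) = d\<pi> g (Xs ! i)" using arg_cong[OF g'(2), of "\<lambda>l. l ! i"] that len by simp
    then have "d\<pi> g' (Xs' ! i - Ad G (inv a) (Xs ! i)) = 0"
      by (simp add: linear_diff[OF dpi_linear] a dpi_Ad)
    then show ?thesis by (rule dpi_kernel)
  qed
  then have "list_all2 (\<lambda>X Y. X - Y \<in> \<kk>) Xs' (map (Ad G (inv a)) Xs)"
    by (simp add: list_all2_conv_all_nth len)
  from multilinear_horizontal_cong[OF basicD(1)[OF \<psi>] basicD(3)[OF \<psi>] this, of gs g' "[]"]
  have "\<psi> gs g' Xs' = \<psi> gs g' (map (Ad G (inv a)) Xs)" by simp
  then show "v = \<rho> g (\<psi> gs g Xs)"
    using basicD(4)[OF \<psi> a(1), of gs g Xs] by (simp add: g'(3) a(2) rho_mult)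
qed

lemma vectors_surj: obtains Xs where "map (d\<pi> g) Xs = ws"
proof -
  obtain L where L: "linear L" "d\<pi> g \<circ> L = id"
    using linear_surjective_right_inverse[OF dpi_linear dpi_surj] by blast
  then have "map (d\<pi> g) (map L ws) = ws" by (simp only: map_map list.map_id)
  then show ?thesis by (rule that)
qed

lemma form_of_of_form: "fo (of_form G K \<rho> \<Phi> \<beta>) gs w ws = \<beta> gs w ws"
proof -
  obtain g where g: "\<pi> g = w" by (rule pi_surj)
  obtain Xs where Xs: "map (d\<pi> g) Xs = ws" by (rule vectors_surj)
  show ?thesis
    unfolding form_of_def
    by (rule the_equality) (use g Xs in \<open>auto simp: of_form_def intro!: exI[of _ g] exI[of _ Xs]\<close>)
qed

lemma form_of_alternating:
  assumes \<psi>: "\<psi> \<in> D"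
  shows "alternating_multilinear (fo \<psi> gs w)"
proof -
  obtain g where g: "\<pi> g = w" by (rule pi_surj)
  obtain L where L: "linear L" "d\<pi> g \<circ> L = id"
    using linear_surjective_right_inverse[OF dpi_linear dpi_surj] by blast
  then have "map (d\<pi> g) (map L ws) = ws" for ws by (simp only: map_map list.map_id)
  then have "fo \<psi> gs w = (\<lambda>ws. \<rho> g (\<psi> gs g (map L ws)))"
    using form_of_eq[OF \<psi>, of gs g] g by (metis (no_types))
  then show ?thesis by (simp only: alternating_compose[OF basicD(1)[OF \<psi>] L(1) rho_linear])
qed

text \<open>Locally a smooth choice of representatives exists: \<open>local_lift\<close> for the
  point and \<open>local_vector_lift\<close> for the vectors. Constant vectors come first; moving
  ones follow by multilinearity.\<close>

lemma form_of_smooth: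
  fixes w :: "(nat \<Rightarrow> 'p::fin_dim_space) \<Rightarrow> 'w"
  assumes \<psi>: "\<psi> \<in> D" and S: "open S" and cs: "\<And>i. i < p \<Longrightarrow> gplot n S (cs i)" and w: "C_infinity n S w"
    and Ws: "\<And>F. F \<in> set Ws \<Longrightarrow> C_infinity n S F"
  shows "C_infinity n S (\<lambda>x. fo \<psi> (map (\<lambda>i. cs i x) [0..<p]) (w x) (map (\<lambda>F. F x) Ws))"
proof -
  have "C_infinity n S (\<lambda>x. fo \<psi> (map (\<lambda>i. cs i x) [0..<p]) (w x) ws)" for ws
  proof (rule C_infinity_local[OF S])
    fix x0 assume x0: "x0 \<in> S"
    obtain U1 c where U1: "open U1" "x0 \<in> U1" "U1 \<subseteq> S" "gplot n U1 c" "\<And>x. x \<in> U1 \<Longrightarrow> \<pi> (c x) = w x"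
      by (rule local_lift[OF S x0 w]) blast
    obtain U R where U: "open U" "x0 \<in> U" "U \<subseteq> U1" "\<And>v. C_infinity n U (\<lambda>x. R x v)"
      "\<And>x v. x \<in> U \<Longrightarrow> d\<pi> (c x) (R x v) = v"
      by (rule local_vector_lift[OF U1(4,2)]) blast
    have c: "gplot n U c" by (rule plot_subset[OF U1(4) U(1,3)])
    have cs': "gplot n U (cs i)" if "i < p" for i
      by (rule plot_subset[OF cs[OF that] U(1)]) (use U U1 in blast)
    have "C_infinity n U (\<lambda>x. \<psi> (map (\<lambda>i. cs i x) [0..<p]) (c x) ([] @ map (\<lambda>F. F x) (map (\<lambda>v x. R x v) ws)))"
    proof (rule multilinear_C_infinity[OF U(1)])
      show "multilinear (\<psi> (map (\<lambda>i. cs i x) [0..<p]) (c x))" for x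
        by (rule alternating_imp_multilinear[OF basicD(1)[OF \<psi>]])
      show "C_infinity n U (\<lambda>x. \<psi> (map (\<lambda>i. cs i x) [0..<p]) (c x) Zs)" for Zs
        by (rule smooth_familyD[OF basicD(2)[OF \<psi>] cs' c])
    qed (use U(4) in auto)
    then have "C_infinity n U (\<lambda>x. \<rho> (c x) (\<psi> (map (\<lambda>i. cs i x) [0..<p]) (c x) (map (R x) ws)))"
      by (intro rho_C_infinity c) (simp add: o_def)
    moreover have "\<rho> (c x) (\<psi> (map (\<lambda>i. cs i x) [0..<p]) (c x) (map (R x) ws)) =
        fo \<psi> (map (\<lambda>i. cs i x) [0..<p]) (w x) ws" if "x \<in> U" for x
    proof -
      have "map (d\<pi> (c x)) (map (R x) ws) = ws" by (simp add: U(5)[OF that] o_def)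
      with form_of_eq[OF \<psi>, of "map (\<lambda>i. cs i x) [0..<p]" "c x" "map (R x) ws"] show ?thesis
        using U1(5) U(3) that by (simp add: subset_iff)
    qed
    ultimately have "C_infinity n U (\<lambda>x. fo \<psi> (map (\<lambda>i. cs i x) [0..<p]) (w x) ws)"
      by (rule iffD1[OF C_infinity_cong[OF U(1)], rotated])
    then have "C_infinity n (S \<inter> U) (\<lambda>x. fo \<psi> (map (\<lambda>i. cs i x) [0..<p]) (w x) ws)"
      by (rule C_infinity_subset) simp
    then show "\<exists>U. open U \<and> x0 \<in> U \<and> C_infinity n (S \<inter> U) (\<lambda>x. fo \<psi> (map (\<lambda>i. cs i x) [0..<p]) (w x) ws)"
      using U(1,2) by (intro exI[of _ U] conjI)
  qed
  then have "C_infinity n S (\<lambda>x. fo \<psi> (map (\<lambda>i. cs i x) [0..<p]) (w x) ([] @ map (\<lambda>F. F x) Ws))"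
    by (rule multilinear_C_infinity[where \<alpha> = "\<lambda>x. fo \<psi> (map (\<lambda>i. cs i x) [0..<p]) (w x)",
          OF S alternating_imp_multilinear[OF form_of_alternating[OF \<psi>]] _ Ws])
  then show ?thesis by simp
qed

end

lemma multilinear_scale:
  assumes "multilinear \<alpha>"
  shows "\<alpha> (Zs @ map (\<lambda>u. r *\<^sub>R u) Ws) = r ^ length Ws *\<^sub>R \<alpha> (Zs @ Ws)"
proof (induction Ws arbitrary: Zs)
  case (Cons W Ws)
  have "\<alpha> (Zs @ r *\<^sub>R W # map (\<lambda>u. r *\<^sub>R u) Ws) = r *\<^sub>R \<alpha> (Zs @ W # map (\<lambda>u. r *\<^sub>R u) Ws)"
    by (rule linear_scale[OF multilinear_middle[OF assms]])
  also have "\<dots> = r *\<^sub>R r ^ length Ws *\<^sub>R \<alpha> (Zs @ W # Ws)"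
    using Cons.IH[of "Zs @ [W]"] by simp
  finally show ?case by simp
qed simp

lemma integral_power_01: "integral {0..1} (\<lambda>t::real. t ^ q) = 1 / (real q + 1)"
proof -
  have "((\<lambda>t::real. t ^ q) has_integral 1 ^ Suc q / (real q + 1) - 0 ^ Suc q / (real q + 1)) {0..1}"
  proof (rule fundamental_theorem_of_calculus)
    fix t :: real
    have "((\<lambda>t. t ^ Suc q / (real q + 1)) has_real_derivative real (Suc q) * t ^ q / (real q + 1)) (at t within {0..1})"
      using DERIV_cdivide[OF DERIV_pow[of "Suc q" t "{0..1}"], of "real q + 1"] by simp
    moreover have "real (Suc q) * t ^ q / (real q + 1) = t ^ q"
      using of_nat_neq_0[of q, where ?'a = real] by (simp add: add.commute)
    ultimately have "((\<lambda>t. t ^ Suc q / (real q + 1)) has_real_derivative t ^ q) (at t within {0..1})"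
      by (simp only:)
    then show "((\<lambda>t. t ^ Suc q / (real q + 1)) has_vector_derivative t ^ q) (at t within {0..1})"
      by (simp only: has_real_derivative_iff_has_vector_derivative)
  qed simp
  then show ?thesis by (simp add: integral_unique)
qed

context homogeneous
begin

subsection \<open>The homotopy operator on forms\<close>

lemma form_of_smooth_fixed:
  fixes w :: "(nat \<Rightarrow> 'p::fin_dim_space) \<Rightarrow> 'w"
  assumes "\<psi> \<in> D" "open S" "C_infinity n S w" "\<And>F. F \<in> set Ws \<Longrightarrow> C_infinity n S F"
  shows "C_infinity n S (\<lambda>x. fo \<psi> gs (w x) (map (\<lambda>F. F x) Ws))"
  using form_of_smooth[where p = "length gs" and cs = "\<lambda>i _. gs ! i", OF assms(1,2) plot_const[OF assms(2)] assms(3,4)]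
  unfolding map_nth .

definition hform :: "('g, 'e, 'v) double_cochain \<Rightarrow> 'g list \<Rightarrow> ('w, 'v) form"
  where "hform \<psi> gs w ws = (- 1) ^ length gs *\<^sub>R homotopy_op (fo \<psi> gs) w ws"

lemma k_op_hform: "k_op G K \<rho> \<Phi> \<psi> = of_form G K \<rho> \<Phi> (hform \<psi>)"
  unfolding k_op_def hform_def[abs_def] ..

lemma homotopy_integrand_continuous:
  assumes "\<psi> \<in> D"
  shows "continuous_on {0..1} (\<lambda>t. fo \<psi> gs (t *\<^sub>R w) (w # map (\<lambda>u. t *\<^sub>R u) ws))"
proof -
  let ?Ws = "(\<lambda>_. w) # map (\<lambda>u (x :: nat \<Rightarrow> real). x 0 *\<^sub>R u) ws"
  have "C_infinity 1 UNIV (\<lambda>x :: nat \<Rightarrow> real. fo \<psi> gs (x 0 *\<^sub>R w) (map (\<lambda>F. F x) ?Ws))"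
    by (intro form_of_smooth_fixed[OF assms] open_UNIV C_infinity_scaleR C_infinity_proj C_infinity_const)
      (auto intro!: C_infinity_scaleR)
  then have "C_infinity 1 UNIV (\<lambda>x :: nat \<Rightarrow> real. fo \<psi> gs (x 0 *\<^sub>R w) (w # map (\<lambda>u. x 0 *\<^sub>R u) ws))"
    by (simp add: o_def)
  from continuous_on_compose2[OF C_infinity_continuous[OF this] continuous_on_diag[of "{0..1}"]]
  show ?thesis by simp
qed

lemma hform_alternating:
  assumes \<psi>: "\<psi> \<in> D"
  shows "alternating_multilinear (hform \<psi> gs w)"
  unfolding alternating_multilinear_def
proof (intro conjI allI impI)
  let ?f = "\<lambda>ws t. fo \<psi> gs (t *\<^sub>R w) (w # map (\<lambda>u. t *\<^sub>R u) ws)"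
  have int: "?f ws integrable_on {0..1}" for ws
    by (rule integrable_continuous_real[OF homotopy_integrand_continuous[OF \<psi>]])
  fix ws :: "'w list" and i assume i: "i < length ws"
  have lin: "linear (\<lambda>X. ?f (ws[i := X]) t)" for t
  proof -
    have "linear (\<lambda>X. fo \<psi> gs (t *\<^sub>R w) ((w # map (\<lambda>u. t *\<^sub>R u) ws)[Suc i := X]))"
      using alternating_imp_multilinear[OF form_of_alternating[OF \<psi>]] i unfolding multilinear_def
      by (metis Suc_less_eq length_Cons length_map)
    from linear_compose[OF linear_scaleR this, of t] show ?thesis
      by (simp add: o_def map_update)
  qed
  show "linear (\<lambda>X. hform \<psi> gs w (ws[i := X]))"
  proof (rule linearI)
    fix X Y :: 'w and r :: real
    have "integral {0..1} (?f (ws[i := X + Y])) = integral {0..1} (?f (ws[i := X])) + integral {0..1} (?f (ws[i := Y]))"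
      unfolding linear_add[OF lin] by (rule integral_add[OF int int])
    then show "hform \<psi> gs w (ws[i := X + Y]) = hform \<psi> gs w (ws[i := X]) + hform \<psi> gs w (ws[i := Y])"
      by (simp add: hform_def homotopy_op_def scaleR_add_right)
    have "integral {0..1} (?f (ws[i := r *\<^sub>R X])) = r *\<^sub>R integral {0..1} (?f (ws[i := X]))"
      unfolding linear_scale[OF lin] by (rule integral_cmul)
    then show "hform \<psi> gs w (ws[i := r *\<^sub>R X]) = r *\<^sub>R hform \<psi> gs w (ws[i := X])"
      by (simp add: hform_def homotopy_op_def)
  qed
next
  fix ws :: "'w list" assume "\<not> distinct ws"
  then have "\<not> distinct (w # map (\<lambda>u. t *\<^sub>R u) ws)" for t by (simp add: distinct_map)
  then show "hform \<psi> gs w ws = 0"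
    by (simp add: hform_def homotopy_op_def alternating_eq_0[OF form_of_alternating[OF \<psi>]])
qed

lemma form_of_bounded:
  assumes "\<psi> \<in> D"
  obtains N where "\<And>gs w ws. N < length gs + length ws \<Longrightarrow> fo \<psi> gs w ws = 0"
proof -
  obtain N where N: "\<And>gs g Xs. N < length gs + length Xs \<Longrightarrow> \<psi> gs g Xs = 0" using basicD(5)[OF assms] by blast
  have "fo \<psi> gs w ws = 0" if "N < length gs + length ws" for gs w ws
  proof -
    obtain g where g: "\<pi> g = w" by (rule pi_surj)
    obtain Xs where Xs: "map (d\<pi> g) Xs = ws" by (rule vectors_surj)
    then have "length Xs = length ws" by auto
    then show ?thesis using form_of_eq[OF assms, of gs g Xs] N[of gs Xs g] that g Xs
      by (simp add: linear_0[OF rho_linear])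
  qed
  then show ?thesis using that by blast
qed

lemma dpi_plot: "gplot n S c \<Longrightarrow> C_infinity n S (\<lambda>x. d\<pi> (c x) X)"
  using left_deriv_family[OF pi_smooth, of n S "\<lambda>_ _. undefined" c X] by simp

text \<open>Smoothness is the main point: the integrand of the homotopy operator is smooth jointly
  in the group arguments and \<open>t\<close>, and \<open>C_infinity_integral\<close> integrates
  \<open>t\<close> out.\<close>

lemma k_op_basic:
  assumes \<psi>: "\<psi> \<in> D"
  shows "k_op G K \<rho> \<Phi> \<psi> \<in> D"
  unfolding k_op_hform
proof (rule of_form_basic)
  obtain N where N: "\<And>gs w ws. N < length gs + length ws \<Longrightarrow> fo \<psi> gs w ws = 0"
    by (rule form_of_bounded[OF \<psi>]) blast
  show "\<exists>N. \<forall>gs w ws. N < length gs + length ws \<longrightarrow> hform \<psi> gs w ws = 0"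
    by (intro exI[of _ N]) (simp add: hform_def homotopy_op_def N)
  show "alternating_multilinear (hform \<psi> gs w)" for gs w by (rule hform_alternating[OF \<psi>])
  show "smooth_family p (\<lambda>gs g. of_form G K \<rho> \<Phi> (hform \<psi>) gs g Xs)" for p Xs
  proof (rule smooth_familyI)
    fix S :: "(nat \<Rightarrow> 'e) set" and cs :: "nat \<Rightarrow> (nat \<Rightarrow> 'e) \<Rightarrow> 'g" and c
    assume S: "open S" and cs: "\<And>i. i < p \<Longrightarrow> gplot (p + 1) S (cs i)" and c: "gplot (p + 1) S c"
    let ?n = "p + 1"
    let ?gs = "\<lambda>x. map (\<lambda>i. cs i x) [0..<p]"
    let ?u = "\<lambda>y :: nat \<Rightarrow> 'e \<times> real. \<lambda>i. fst (y i)"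
    let ?T = "?u -` S"
    have "continuous_on UNIV ?u"
      by (intro continuous_on_coordinatewise_then_product continuous_on_fst continuous_on_product_coordinates)
    from open_vimage[OF S this] have T: "open ?T" .
    have u: "C_infinity ?n ?T (\<lambda>y. ?u y i)" for i
      by (rule C_infinity_bounded_linear[OF bounded_linear_fst C_infinity_proj])
    have t: "C_infinity ?n ?T (\<lambda>y. snd (y 0))"
      by (rule C_infinity_bounded_linear[OF bounded_linear_snd C_infinity_proj])
    have lift: "gplot ?n ?T (\<lambda>y. d (?u y))" if "gplot ?n S d" for d
      by (rule plot_compose[where u = ?u, OF atlas that T _ u C_infinity_continuous[OF u]]) auto
    have f1: "C_infinity ?n ?T (\<lambda>y. \<pi> (c (?u y)))"
      by (rule smooth_fnD[OF pi_smooth lift[OF c]])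
    have f2: "C_infinity ?n ?T (\<lambda>y. snd (y 0) *\<^sub>R d\<pi> (c (?u y)) X)" for X
      by (rule C_infinity_scaleR[OF t dpi_plot[OF lift[OF c]]])
    let ?Ws = "(\<lambda>y. \<pi> (c (?u y))) # map (\<lambda>X y. snd (y 0) *\<^sub>R d\<pi> (c (?u y)) X) Xs"
    have F: "C_infinity ?n ?T (\<lambda>y. fo \<psi> (map (\<lambda>i. cs i (?u y)) [0..<p]) (snd (y 0) *\<^sub>R \<pi> (c (?u y))) (map (\<lambda>F. F y) ?Ws))"
    proof (rule form_of_smooth[OF \<psi> T])
      show "gplot ?n ?T (\<lambda>y. cs i (?u y))" if "i < p" for i by (rule lift[OF cs[OF that]])
      show "C_infinity ?n ?T (\<lambda>y. snd (y 0) *\<^sub>R \<pi> (c (?u y)))"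
        by (rule C_infinity_scaleR[OF t f1])
      show "C_infinity ?n ?T F" if F: "F \<in> set ?Ws" for F
      proof -
        consider "F = (\<lambda>y. \<pi> (c (?u y)))" | X where "F = (\<lambda>y. snd (y 0) *\<^sub>R d\<pi> (c (?u y)) X)"
          using F by auto
        then show ?thesis
          by cases (simp_all only: f1 f2)
      qed
    qed
    have "C_infinity ?n S (\<lambda>x. integral {0..1} (\<lambda>t. fo \<psi> (?gs x) (t *\<^sub>R \<pi> (c x)) (map (\<lambda>F. F (\<lambda>i. (x i, t))) ?Ws)))"
      using C_infinity_integral[OF T S _ F] by simp
    then have "C_infinity ?n S (\<lambda>x. homotopy_op (fo \<psi> (?gs x)) (\<pi> (c x)) (map (d\<pi> (c x)) Xs))"
      by (simp add: homotopy_op_def o_def)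
    then have "C_infinity ?n S (\<lambda>x. hform \<psi> (?gs x) (\<pi> (c x)) (map (d\<pi> (c x)) Xs))"
      unfolding hform_def by (intro C_infinity_scaleR) simp_all
    then show "C_infinity ?n S (\<lambda>x. of_form G K \<rho> \<Phi> (hform \<psi>) (?gs x) (c x) Xs)"
      unfolding of_form_def by (rule rho_C_infinity[OF gplot_inv[OF c]])
  qed
qed

lemma hform_zero:
  assumes "\<psi> \<in> D"
  shows "hform \<psi> gs 0 ws = 0"
proof -
  have "fo \<psi> gs 0 ([] @ 0 # map (\<lambda>u. t *\<^sub>R u) ws) = 0" for t
    by (rule linear_0[OF multilinear_middle[OF alternating_imp_multilinear[OF form_of_alternating[OF assms]]]])
  then show ?thesis by (simp add: hform_def homotopy_op_def)
qed

lemma k_op_on_K: "\<psi> \<in> D \<Longrightarrow> k \<in> K \<Longrightarrow> k_op G K \<rho> \<Phi> \<psi> gs k Xs = 0"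
  by (simp add: k_op_hform of_form_def hform_zero linear_0[OF rho_linear])

text \<open>By linearity in the contracted slot the value at \<open>s *\<^sub>R v\<close> is
  \<open>s\<close> times a function continuous in \<open>s\<close>, so the derivative is that
  function at \<open>s = 0\<close>. There the integrand is \<open>t ^ length ws\<close> times a
  constant, whence the denominator.\<close>

lemma hform_derivative_0:
  assumes \<psi>: "\<psi> \<in> D"
  shows "dd (\<lambda>w. hform \<psi> gs w ws) 0 v = ((- 1) ^ length gs / (real (length ws) + 1)) *\<^sub>R fo \<psi> gs 0 (v # ws)"
proof -
  note ml = alternating_imp_multilinear[OF form_of_alternating[OF \<psi>]]
  let ?h = "\<lambda>s t. fo \<psi> gs ((t * s) *\<^sub>R v) (v # map (\<lambda>u. t *\<^sub>R u) ws)"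
  let ?G = "\<lambda>s::real. integral (cbox 0 1) (?h s)"
  have eq: "hform \<psi> gs (0 + s *\<^sub>R v) ws = s *\<^sub>R ((- 1) ^ length gs *\<^sub>R ?G s)" for s
  proof -
    have "fo \<psi> gs ((t * s) *\<^sub>R v) ([] @ (s *\<^sub>R v) # map (\<lambda>u. t *\<^sub>R u) ws) = s *\<^sub>R ?h s t" for t
    proof -
      have "linear (\<lambda>X. fo \<psi> gs ((t * s) *\<^sub>R v) ([] @ X # map (\<lambda>u. t *\<^sub>R u) ws))"
        by (rule multilinear_middle[OF ml])
      from linear_scale[OF this, of s v] show ?thesis by simp
    qed
    then show ?thesis by (simp add: hform_def homotopy_op_def)
  qed
  have "continuous_on UNIV ?G"
  proof (rule integral_continuous_on_param)
    \<comment> \<open>Both reals become coordinates, number 0 for \<open>s\<close> and 1 for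
      \<open>t\<close>; joint continuity is then an instance of smoothness of the form.\<close>
    let ?y = "\<lambda>(s::real, t::real). \<lambda>i::nat. if i = 0 then s else t"
    let ?Ws = "(\<lambda>_. v) # map (\<lambda>u (x :: nat \<Rightarrow> real). x 1 *\<^sub>R u) ws"
    have "C_infinity 2 UNIV (\<lambda>x :: nat \<Rightarrow> real. fo \<psi> gs ((x 1 * x 0) *\<^sub>R v) (map (\<lambda>F. F x) ?Ws))"
    proof (rule form_of_smooth_fixed[OF \<psi> open_UNIV])
      have "C_infinity 2 UNIV (\<lambda>x :: nat \<Rightarrow> real. x 1 *\<^sub>R x 0 *\<^sub>R v)"
        by (intro C_infinity_scaleR C_infinity_proj C_infinity_const)
      then show "C_infinity 2 UNIV (\<lambda>x :: nat \<Rightarrow> real. (x 1 * x 0) *\<^sub>R v)" by simp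
    qed (auto intro!: C_infinity_scaleR)
    moreover have "continuous_on (UNIV \<times> cbox 0 1) ?y"
    proof (rule continuous_on_coordinatewise_then_product)
      show "continuous_on (UNIV \<times> cbox 0 1) (\<lambda>p. ?y p i)" for i
        by (cases "i = 0") (auto simp: case_prod_beta intro!: continuous_intros)
    qed
    ultimately have "continuous_on (UNIV \<times> cbox 0 1) (\<lambda>p. fo \<psi> gs ((?y p 1 * ?y p 0) *\<^sub>R v) (map (\<lambda>F. F (?y p)) ?Ws))"
      by (intro continuous_on_compose2[OF C_infinity_continuous]) auto
    then show "continuous_on (UNIV \<times> cbox 0 1) (\<lambda>(s, t). ?h s t)"
      by (simp add: case_prod_beta o_def)
  qed
  then have "(?G \<longlongrightarrow> ?G 0) (at 0)" unfolding continuous_on by blast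
  moreover have "?G 0 = (1 / (real (length ws) + 1)) *\<^sub>R fo \<psi> gs 0 (v # ws)"
  proof -
    have "?h 0 t = t ^ length ws *\<^sub>R fo \<psi> gs 0 (v # ws)" for t
      using multilinear_scale[OF ml[of gs 0], of "[v]" t ws] by simp
    moreover have "(\<lambda>t::real. t ^ length ws) integrable_on {0..1}"
      by (intro integrable_continuous_real continuous_intros)
    ultimately show ?thesis
      using integral_linear[OF _ bounded_linear_scaleR_left, of "\<lambda>t. t ^ length ws" "{0..1}" "fo \<psi> gs 0 (v # ws)"]
      by (simp add: o_def integral_power_01)
  qed
  ultimately have lim: "((\<lambda>s. (- 1) ^ length gs *\<^sub>R ?G s) \<longlongrightarrow>
      (- 1) ^ length gs *\<^sub>R (1 / (real (length ws) + 1)) *\<^sub>R fo \<psi> gs 0 (v # ws)) (at 0)"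
    by (intro tendsto_scaleR tendsto_const) simp
  have "\<forall>\<^sub>F s in at 0. (- 1) ^ length gs *\<^sub>R ?G s =
      (hform \<psi> gs (0 + s *\<^sub>R v) ws - hform \<psi> gs (0 + 0 *\<^sub>R v) ws) /\<^sub>R s"
    unfolding eq by (simp add: eventually_at_filter)
  from Lim_transform_eventually[OF lim this]
  have "((\<lambda>s. hform \<psi> gs (0 + s *\<^sub>R v) ws) has_vector_derivative
      (- 1) ^ length gs *\<^sub>R (1 / (real (length ws) + 1)) *\<^sub>R fo \<psi> gs 0 (v # ws)) (at 0)"
    unfolding has_vector_derivative_iff_slope .
  then show ?thesis unfolding dd_def by (simp add: vector_derivative_at)
qed

end

subsection \<open>The Chevalley-Eilenberg differential in terms of forms\<close>

text \<open>Passes from positions \<open>k\<close> in a list with entry \<open>i\<close> removed to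
  positions \<open>j\<close> in the full list.\<close>

lemma sum_omit_reindex:
  fixes g :: "nat \<Rightarrow> 'a::comm_monoid_add"
  assumes "i < q"
  shows "(\<Sum>k<q - 1. g k) = (\<Sum>j\<in>{..<q} - {i}. g (if j < i then j else j - 1))"
  by (rule sum.reindex_bij_witness[where i = "\<lambda>j. if j < i then j else j - 1" and j = "\<lambda>k. if k < i then k else Suc k"])
    (use assms in auto)

lemma sum_triangle:
  fixes T :: "nat \<Rightarrow> nat \<Rightarrow> 'a::comm_monoid_add"
  shows "(\<Sum>i<q. \<Sum>j\<in>{..<q} - {i}. T i j) = (\<Sum>j<q. \<Sum>i<j. T j i + T i j)"
proof -
  have "(\<Sum>i<q. \<Sum>j\<in>{..<q} - {i}. T i j) = (\<Sum>i<q. \<Sum>j<q. (if j < i then T i j else 0) + (if i < j then T i j else 0))"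
  proof (rule sum.cong[OF refl])
    fix i assume i: "i \<in> {..<q}"
    have "(\<Sum>j\<in>{..<q} - {i}. T i j) = (\<Sum>j\<in>{..<q} - {i}. (if j < i then T i j else 0) + (if i < j then T i j else 0))"
      by (rule sum.cong) auto
    also have "\<dots> = (\<Sum>j<q. (if j < i then T i j else 0) + (if i < j then T i j else 0))"
      by (rule sum.mono_neutral_left) auto
    finally show "(\<Sum>j\<in>{..<q} - {i}. T i j) = (\<Sum>j<q. (if j < i then T i j else 0) + (if i < j then T i j else 0))" .
  qed
  also have "\<dots> = (\<Sum>i<q. \<Sum>j<q. if j < i then T i j else 0) + (\<Sum>i<q. \<Sum>j<q. if i < j then T i j else 0)"
    by (simp add: sum.distrib)
  also have "(\<Sum>i<q. \<Sum>j<q. if i < j then T i j else 0) = (\<Sum>j<q. \<Sum>i<q. if i < j then T i j else 0)"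
    by (rule sum.swap)
  also have "(\<Sum>i<q. \<Sum>j<q. if j < i then T i j else 0) = (\<Sum>j<q. \<Sum>i<j. T j i)"
  proof (rule sum.cong[OF refl])
    fix i assume "i \<in> {..<q}"
    then show "(\<Sum>j<q. if j < i then T i j else 0) = (\<Sum>j<i. T i j)"
      by (intro sum.mono_neutral_cong_right) auto
  qed
  also have "(\<Sum>j<q. \<Sum>i<q. if i < j then T i j else 0) = (\<Sum>j<q. \<Sum>i<j. T i j)"
  proof (rule sum.cong[OF refl])
    fix j assume "j \<in> {..<q}"
    then show "(\<Sum>i<q. if i < j then T i j else 0) = (\<Sum>i<j. T i j)"
      by (intro sum.mono_neutral_cong_right) auto
  qed
  finally show ?thesis by (simp add: sum.distrib)
qed

lemma nth_omit:
  assumes "i < length ws" "k < length ws - 1"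
  shows "omit i ws ! k = ws ! (if k < i then k else Suc k)"
proof (cases "k < i")
  case True
  then show ?thesis using assms(1) by (simp add: omit_def nth_append)
next
  case False
  then have "Suc i + (k - i) = Suc k" by simp
  then show ?thesis using False assms by (simp add: omit_def nth_append min_def)
qed

lemma omit_omit:
  assumes "i < j" "j < length ws"
  shows "omit (j - 1) (omit i ws) = omit i (omit j ws)"
proof (rule nth_equalityI)
  have len: "length (omit i ws) = length ws - 1" "length (omit j ws) = length ws - 1"
    using assms by (simp_all add: length_omit)
  have len2: "length (omit (j - 1) (omit i ws)) = length ws - 1 - 1" "length (omit i (omit j ws)) = length ws - 1 - 1"
    using length_omit[of "j - 1" "omit i ws"] length_omit[of i "omit j ws"] assms unfolding len by simp_all
  then show "length (omit (j - 1) (omit i ws)) = length (omit i (omit j ws))" by simp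
  fix k assume "k < length (omit (j - 1) (omit i ws))"
  then have k: "k < length ws - 1 - 1" unfolding len2 .
  define k1 where "k1 = (if k < j - 1 then k else Suc k)"
  define k2 where "k2 = (if k < i then k else Suc k)"
  have "omit (j - 1) (omit i ws) ! k = omit i ws ! k1"
    unfolding k1_def by (rule nth_omit) (use assms k len in simp_all)
  also have "\<dots> = ws ! (if k1 < i then k1 else Suc k1)"
    by (rule nth_omit) (use assms k k1_def in auto)
  also have "(if k1 < i then k1 else Suc k1) = (if k2 < j then k2 else Suc k2)"
    using assms by (auto simp: k1_def k2_def)
  also have "ws ! (if k2 < j then k2 else Suc k2) = omit j ws ! k2"
    by (rule nth_omit[symmetric]) (use assms k k2_def in auto)
  also have "\<dots> = omit i (omit j ws) ! k"
    unfolding k2_def by (rule nth_omit[symmetric]) (use assms k len in simp_all)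
  finally show "omit (j - 1) (omit i ws) ! k = omit i (omit j ws) ! k" .
qed

lemma alternating_update:
  assumes "alternating_multilinear \<alpha>" "k < length ws"
  shows "\<alpha> (ws[k := b]) = (- 1) ^ k *\<^sub>R \<alpha> (b # omit k ws)"
proof -
  have "\<alpha> (b # omit k ws) = (- 1) ^ k *\<^sub>R \<alpha> (ws[k := b])"
    using alternating_nth_omit[OF assms(1), of k "ws[k := b]"] assms(2) by (simp add: omit_list_update)
  then show ?thesis by (simp add: minus_one_power_iff)
qed

text \<open>This is where the terms of the Leibniz rule that contain second derivatives cancel against the bracket terms.\<close>

lemma leibniz_bracket_cancel:
  assumes alt: "alternating_multilinear \<alpha>"
  shows "(\<Sum>i<length ws. (- 1) ^ i *\<^sub>R (\<Sum>k<length ws - 1. \<alpha> ((omit i ws)[k := B i (if k < i then k else Suc k)])))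
    + (\<Sum>j<length ws. \<Sum>i<j. (- 1) ^ (i + j) *\<^sub>R \<alpha> ((B i j - B j i) # omit i (omit j ws))) = 0"
proof -
  let ?q = "length ws"
  let ?T = "\<lambda>(i::nat) (j::nat). (if j < i then (- 1) ^ (i + j) *\<^sub>R \<alpha> (B i j # omit j (omit i ws))
    else - ((- 1) ^ (i + j) *\<^sub>R \<alpha> (B i j # omit i (omit j ws))))"
  have "(\<Sum>i<?q. (- 1) ^ i *\<^sub>R (\<Sum>k<?q - 1. \<alpha> ((omit i ws)[k := B i (if k < i then k else Suc k)])))
      = (\<Sum>i<?q. \<Sum>j\<in>{..<?q} - {i}. ?T i j)"
  proof (rule sum.cong[OF refl])
    fix i assume "i \<in> {..<?q}"
    then have i: "i < ?q" by simp
    have "(- 1) ^ i *\<^sub>R (\<Sum>k<?q - 1. \<alpha> ((omit i ws)[k := B i (if k < i then k else Suc k)])) =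
      (\<Sum>k<?q - 1. (- 1) ^ (i + k) *\<^sub>R \<alpha> (B i (if k < i then k else Suc k) # omit k (omit i ws)))"
      unfolding scaleR_sum_right
    proof (rule sum.cong[OF refl])
      fix k assume "k \<in> {..<?q - 1}"
      then have "k < length (omit i ws)" using i by (simp add: length_omit)
      from alternating_update[OF alt this] show
        "(- 1) ^ i *\<^sub>R \<alpha> ((omit i ws)[k := B i (if k < i then k else Suc k)]) =
         (- 1) ^ (i + k) *\<^sub>R \<alpha> (B i (if k < i then k else Suc k) # omit k (omit i ws))"
        by (simp only: power_add scaleR_scaleR)
    qed
    also have "\<dots> = (\<Sum>j\<in>{..<?q} - {i}. ?T i j)"
      unfolding sum_omit_reindex[OF i]
    proof (rule sum.cong[OF refl])
      fix j assume j: "j \<in> {..<?q} - {i}"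
      let ?k = "if j < i then j else j - 1"
      show "(- 1) ^ (i + ?k) *\<^sub>R \<alpha> (B i (if ?k < i then ?k else Suc ?k) # omit ?k (omit i ws)) = ?T i j"
      proof (cases "j < i")
        case False
        with j have ij: "i < j" "j < ?q" by auto
        obtain l where l: "j = Suc l" using ij(1) by (cases j) auto
        show ?thesis using False ij omit_omit[OF ij] by (simp add: l)
      qed simp
    qed
    finally show "(- 1) ^ i *\<^sub>R (\<Sum>k<?q - 1. \<alpha> ((omit i ws)[k := B i (if k < i then k else Suc k)])) =
      (\<Sum>j\<in>{..<?q} - {i}. ?T i j)" .
  qed
  also have "\<dots> = (\<Sum>j<?q. \<Sum>i<j. ?T j i + ?T i j)" by (rule sum_triangle)
  also have "\<dots> = - (\<Sum>j<?q. \<Sum>i<j. (- 1) ^ (i + j) *\<^sub>R \<alpha> ((B i j - B j i) # omit i (omit j ws)))"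
    unfolding sum_negf[symmetric]
  proof (intro sum.cong refl)
    fix j i :: nat assume "i \<in> {..<j}"
    moreover have "\<alpha> ((B i j - B j i) # omit i (omit j ws)) = \<alpha> (B i j # omit i (omit j ws)) - \<alpha> (B j i # omit i (omit j ws))"
      using linear_diff[OF multilinear_middle[OF alternating_imp_multilinear[OF alt], of "[]"]] by simp
    ultimately show "?T j i + ?T i j = - ((- 1) ^ (i + j) *\<^sub>R \<alpha> ((B i j - B j i) # omit i (omit j ws)))"
      by (simp add: add.commute scaleR_diff_right)
  qed
  finally show ?thesis by simp
qed

context homogeneous
begin

text \<open>The exterior derivative evaluated on constant vector fields of \<open>'w\<close>; these
  commute, so no bracket term occurs.\<close>

definition dform :: "('g, 'e, 'v) double_cochain \<Rightarrow> 'g list \<Rightarrow> ('w, 'v) form"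
  where "dform \<xi> gs w ws = (\<Sum>i<length ws. (- 1) ^ i *\<^sub>R dd (\<lambda>w. fo \<xi> gs w (omit i ws)) w (ws ! i))"

lemma form_of_smooth_on:
  assumes "\<xi> \<in> D"
  shows "smooth_on UNIV (\<lambda>w. fo \<xi> gs w ws)"
proof -
  have "C_infinity 1 UNIV (\<lambda>x :: nat \<Rightarrow> 'w. fo \<xi> gs (x 0) (map (\<lambda>F. F x) (map (\<lambda>w _. w) ws)))"
    by (rule form_of_smooth_fixed[OF assms open_UNIV]) auto
  then show ?thesis by (simp add: smooth_on_def o_def)
qed

lemma dform_alternating:
  assumes \<xi>: "\<xi> \<in> D"
  shows "alternating_multilinear (dform \<xi> gs w)"
  unfolding dform_def[abs_def]
proof (rule alternation)
  show "linear (dd (\<lambda>w. fo \<xi> gs w ws) w)" for ws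
    by (rule smooth_on_dd(3)[OF open_UNIV form_of_smooth_on[OF \<xi>] UNIV_I])
  show "alternating_multilinear (\<lambda>ws. dd (\<lambda>w. fo \<xi> gs w ws) w v)" for v
  proof -
    have "multilinear (\<lambda>ws. dd (\<lambda>w. fo \<xi> gs w ws) w v)"
      by (rule multilinear_limit[where \<alpha> = "\<lambda>t. fo \<xi> gs (w + t *\<^sub>R v)"])
        (rule alternating_imp_multilinear[OF form_of_alternating[OF \<xi>]],
         rule smooth_on_dd(2)[OF open_UNIV form_of_smooth_on[OF \<xi>] UNIV_I])
    then show ?thesis
      by (simp add: alternating_multilinear_def multilinear_def alternating_eq_0[OF form_of_alternating[OF \<xi>]] dd_def)
  qed
qed

lemma rho_derivative:
  "((\<lambda>t. \<rho> (tangent_curve G X t) v) has_vector_derivative left_deriv G (\<lambda>g'. \<rho> g' v) \<one> X) (at 0)"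
  using left_deriv_tangent_curve[OF rho_smooth_fn, of \<one> X] by simp

lemma linear_rho_deriv: "linear (\<lambda>v. left_deriv G (\<lambda>g'. \<rho> g' v) \<one> X)"
proof (rule linearI)
  note dr = rho_derivative[of X]
  fix u v and r :: real
  have "((\<lambda>t. \<rho> (tangent_curve G X t) (u + v)) has_vector_derivative
      left_deriv G (\<lambda>g'. \<rho> g' u) \<one> X + left_deriv G (\<lambda>g'. \<rho> g' v) \<one> X) (at 0)"
    unfolding linear_add[OF rho_linear] by (rule has_vector_derivative_add[OF dr dr])
  from vector_derivative_unique_at[OF dr this]
  show "left_deriv G (\<lambda>g'. \<rho> g' (u + v)) \<one> X = left_deriv G (\<lambda>g'. \<rho> g' u) \<one> X + left_deriv G (\<lambda>g'. \<rho> g' v) \<one> X" .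
  have "((\<lambda>t. \<rho> (tangent_curve G X t) (r *\<^sub>R u)) has_vector_derivative r *\<^sub>R left_deriv G (\<lambda>g'. \<rho> g' u) \<one> X) (at 0)"
    unfolding linear_scale[OF rho_linear]
    by (rule bounded_linear.has_vector_derivative[OF bounded_linear_scaleR_right dr])
  from vector_derivative_unique_at[OF dr this]
  show "left_deriv G (\<lambda>g'. \<rho> g' (r *\<^sub>R u)) \<one> X = r *\<^sub>R left_deriv G (\<lambda>g'. \<rho> g' u) \<one> X" .
qed

text \<open>The derivative of the representation at \<open>g\<close> is \<open>\<rho> g\<close>
  applied to its derivative at the unit. By the product rule the two first-order terms of
  \<open>d_CE\<close> are thus the derivative of the untwisted cochain.\<close>

lemma twisted_left_deriv:
  assumes \<xi>: "\<xi> \<in> D"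
  shows "left_deriv G (\<lambda>g'. \<xi> gs g' Ys) g X + left_deriv G (\<lambda>g'. \<rho> g' (\<xi> gs g Ys)) \<one> X =
    \<rho> (inv g) (left_deriv G (\<lambda>g'. \<rho> g' (\<xi> gs g' Ys)) g X)"
proof -
  let ?c = "tangent_curve G X"
  let ?r = "\<lambda>v. left_deriv G (\<lambda>g'. \<rho> g' v) \<one> X"
  let ?v = "\<lambda>g'. \<xi> gs g' Ys"
  have v: "smooth_fn ?v" using smooth_family_fix[OF basicD(2)[OF \<xi>] refl] .
  have c0: "?c 0 = \<one>" by (simp add: tangent_curve_ec)
  note dr = rho_derivative[of X]
  have dv: "((\<lambda>t. ?v (g \<otimes> ?c t)) has_vector_derivative left_deriv G ?v g X) (at 0)"
    by (rule left_deriv_tangent_curve[OF v])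
  have r_lin: "(\<Sum>b\<in>frame. (u \<bullet> b) *\<^sub>R ?r b) = ?r u" for u
    by (rule linear_frame_expansion[OF linear_rho_deriv, symmetric])
  have "((\<lambda>t. \<Sum>b\<in>frame. (?v (g \<otimes> ?c t) \<bullet> b) *\<^sub>R \<rho> (?c t) b) has_vector_derivative
      (\<Sum>b\<in>frame. (?v (g \<otimes> ?c 0) \<bullet> b) *\<^sub>R ?r b + (left_deriv G ?v g X \<bullet> b) *\<^sub>R \<rho> (?c 0) b)) (at 0)"
    by (intro has_vector_derivative_sum bounded_bilinear.has_vector_derivative[OF bounded_bilinear_scaleR] dr
        bounded_linear.has_vector_derivative[OF bounded_linear_inner_left dv])
  then have "((\<lambda>t. \<rho> (?c t) (?v (g \<otimes> ?c t))) has_vector_derivative ?r (?v g) + left_deriv G ?v g X) (at 0)"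
    by (simp add: linear_frame_expansion[OF rho_linear, symmetric] sum.distrib r_lin c0 frame_expansion)
  from bounded_linear.has_vector_derivative[OF linear_imp_bounded_linear[OF rho_linear] this, of g]
  have "((\<lambda>t. \<rho> (g \<otimes> ?c t) (?v (g \<otimes> ?c t))) has_vector_derivative \<rho> g (?r (?v g) + left_deriv G ?v g X)) (at 0)"
    by (simp only: rho_mult)
  then have "left_deriv G (\<lambda>g'. \<rho> g' (\<xi> gs g' Ys)) g X = \<rho> g (?r (?v g) + left_deriv G ?v g X)"
    unfolding left_deriv_def[of G "\<lambda>g'. \<rho> g' (\<xi> gs g' Ys)"] by (rule vector_derivative_at)
  then show ?thesis by (simp add: add.commute)
qed

text \<open>The untwisted cochain is the form at \<open>\<pi> h\<close> on the vectors
  \<open>d\<pi> h Y\<close>. Moving \<open>h\<close> moves the base point, which gives the first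
  term, and each vector, which gives the sum with second derivatives of \<pi>.\<close>

lemma form_left_deriv:
  assumes \<xi>: "\<xi> \<in> D"
  shows "left_deriv G (\<lambda>g'. \<rho> g' (\<xi> gs g' Ys)) g X =
    dd (\<lambda>w. fo \<xi> gs w (map (d\<pi> g) Ys)) (\<pi> g) (d\<pi> g X) +
    (\<Sum>k<length Ys. fo \<xi> gs (\<pi> g) ((map (d\<pi> g) Ys)[k := left_deriv G (\<lambda>h. d\<pi> h (Ys ! k)) g X]))"
proof -
  let ?c = "\<lambda>t. g \<otimes> tangent_curve G X t"
  let ?\<alpha> = "\<lambda>t. fo \<xi> gs (\<pi> (?c t))"
  let ?\<alpha>' = "\<lambda>Zs. dd (\<lambda>w. fo \<xi> gs w Zs) (\<pi> g) (d\<pi> g X)"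
  let ?Fs = "map (\<lambda>Y t. d\<pi> (?c t) Y) Ys"
  have c0: "?c 0 = g" by (simp add: tangent_curve_ec)
  have ml: "multilinear (?\<alpha> t)" for t by (rule alternating_imp_multilinear[OF form_of_alternating[OF \<xi>]])
  have der: "((\<lambda>t. ?\<alpha> t Zs) has_vector_derivative ?\<alpha>' Zs) (at 0)" for Zs
  proof -
    have "((\<lambda>w. fo \<xi> gs w Zs) has_derivative dd (\<lambda>w. fo \<xi> gs w Zs) (\<pi> (?c 0))) (at (\<pi> (?c 0)))"
      by (rule smooth_on_has_derivative[OF open_UNIV form_of_smooth_on[OF \<xi>] UNIV_I])
    from has_vector_derivative_chain[OF this left_deriv_tangent_curve[OF pi_smooth]] show ?thesis by (simp only: c0)
  qed
  have ml': "multilinear ?\<alpha>'" by (rule multilinear_limit[OF ml der])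
  have "smooth_fn (\<lambda>h. d\<pi> h Y)" for Y by (rule smooth_family_left_deriv[OF pi_smooth])
  note dY = left_deriv_tangent_curve[OF this]
  have "((\<lambda>t. ?\<alpha> t ([] @ map (\<lambda>F. F t) ?Fs)) has_vector_derivative
      ?\<alpha>' ([] @ map (\<lambda>F. F 0) ?Fs) +
      (\<Sum>j<length ?Fs. ?\<alpha> 0 ([] @ (map (\<lambda>F. F 0) ?Fs)[j := vector_derivative (?Fs ! j) (at 0)]))) (at 0)"
  proof (rule multilinear_derivative[where F' = "\<lambda>F. vector_derivative F (at 0)", OF ml ml' der])
    fix F assume "F \<in> set ?Fs"
    then obtain Y where "F = (\<lambda>t. d\<pi> (?c t) Y)" by auto
    then show "(F has_vector_derivative vector_derivative F (at 0)) (at 0)"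
      using dY[of g X Y] vector_derivative_at[OF dY[of g X Y]] by simp
  qed
  then have "((\<lambda>t. ?\<alpha> t (map (d\<pi> (?c t)) Ys)) has_vector_derivative
      ?\<alpha>' (map (d\<pi> g) Ys) +
      (\<Sum>k<length Ys. fo \<xi> gs (\<pi> g) ((map (d\<pi> g) Ys)[k := left_deriv G (\<lambda>h. d\<pi> h (Ys ! k)) g X]))) (at 0)"
    by (simp add: o_def c0 left_deriv_def[of G "\<lambda>h. d\<pi> h (_ ! _)"])
  moreover have "?\<alpha> t (map (d\<pi> (?c t)) Ys) = \<rho> (?c t) (\<xi> gs (?c t) Ys)" for t
    by (rule form_of_eq[OF \<xi>])
  ultimately show ?thesis
    unfolding left_deriv_def[of G "\<lambda>g'. \<rho> g' (\<xi> gs g' Ys)"] by (simp add: vector_derivative_at)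
qed

text \<open>After untwisting, the base point terms assemble to \<open>dform\<close>; the second
  derivatives of \<pi> cancel against the bracket terms by
  \<open>leibniz_bracket_cancel\<close>.\<close>

lemma d_CE_dform:
  assumes \<xi>: "\<xi> \<in> D"
  shows "d_CE G \<rho> \<xi> gs g Xs = of_form G K \<rho> \<Phi> (dform \<xi>) gs g Xs"
proof -
  let ?ws = "map (d\<pi> g) Xs" and ?\<alpha> = "fo \<xi> gs (\<pi> g)" and ?R = "\<rho> (inv g)"
  \<comment> \<open>Second derivatives of \<pi>; their antisymmetric part is \<open>d\<pi>\<close>
    of the bracket.\<close>
  define B where "B i j = left_deriv G (\<lambda>h. d\<pi> h (Xs ! j)) g (Xs ! i)" for i j
  have \<xi>_eq: "\<xi> gs g Zs = ?R (?\<alpha> (map (d\<pi> g) Zs))" for Zs by (simp add: form_of_eq[OF \<xi>])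
  have bracket: "d\<pi> g (lie_bracket G (Xs ! i) (Xs ! j)) = B i j - B j i" for i j
    unfolding B_def by (rule left_deriv_commutator[OF pi_smooth, symmetric])
  have "d_CE G \<rho> \<xi> gs g Xs = ?R ((\<Sum>i<length Xs. (- 1) ^ i *\<^sub>R left_deriv G (\<lambda>g'. \<rho> g' (\<xi> gs g' (omit i Xs))) g (Xs ! i))
      + (\<Sum>j<length Xs. \<Sum>i<j. (- 1) ^ (i + j) *\<^sub>R ?\<alpha> (map (d\<pi> g) (lie_bracket G (Xs ! i) (Xs ! j) # omit i (omit j Xs)))))"
    unfolding d_CE_def twisted_left_deriv[OF \<xi>] \<xi>_eq[of "_ # _"]
    by (simp only: linear_add[OF rho_linear] linear_sum[OF rho_linear] linear_scale[OF rho_linear])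
  also have "(\<Sum>i<length Xs. (- 1) ^ i *\<^sub>R left_deriv G (\<lambda>g'. \<rho> g' (\<xi> gs g' (omit i Xs))) g (Xs ! i)) =
      dform \<xi> gs (\<pi> g) ?ws + (\<Sum>i<length ?ws. (- 1) ^ i *\<^sub>R (\<Sum>k<length ?ws - 1. ?\<alpha> ((omit i ?ws)[k := B i (if k < i then k else Suc k)])))"
    unfolding dform_def sum.distrib[symmetric] length_map
  proof (rule sum.cong[OF refl])
    fix i assume "i \<in> {..<length Xs}"
    then have i: "i < length Xs" by simp
    have "left_deriv G (\<lambda>h. d\<pi> h (omit i Xs ! k)) g (Xs ! i) = B i (if k < i then k else Suc k)" if "k < length Xs - 1" for k
      unfolding B_def by (simp only: nth_omit[OF i that])
    then have "(\<Sum>k<length (omit i Xs). ?\<alpha> ((map (d\<pi> g) (omit i Xs))[k := left_deriv G (\<lambda>h. d\<pi> h (omit i Xs ! k)) g (Xs ! i)])) =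
        (\<Sum>k<length Xs - 1. ?\<alpha> ((omit i ?ws)[k := B i (if k < i then k else Suc k)]))"
      unfolding length_omit[OF i] by (intro sum.cong refl) (simp only: lessThan_iff map_omit)
    then show "(- 1) ^ i *\<^sub>R left_deriv G (\<lambda>g'. \<rho> g' (\<xi> gs g' (omit i Xs))) g (Xs ! i) =
        (- 1) ^ i *\<^sub>R dd (\<lambda>w. fo \<xi> gs w (omit i ?ws)) (\<pi> g) (?ws ! i) +
        (- 1) ^ i *\<^sub>R (\<Sum>k<length Xs - 1. ?\<alpha> ((omit i ?ws)[k := B i (if k < i then k else Suc k)]))"
      using i by (simp only: form_left_deriv[OF \<xi>] scaleR_add_right map_omit nth_map)
  qed
  also have "(\<Sum>j<length Xs. \<Sum>i<j. (- 1) ^ (i + j) *\<^sub>R ?\<alpha> (map (d\<pi> g) (lie_bracket G (Xs ! i) (Xs ! j) # omit i (omit j Xs)))) =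
      (\<Sum>j<length ?ws. \<Sum>i<j. (- 1) ^ (i + j) *\<^sub>R ?\<alpha> ((B i j - B j i) # omit i (omit j ?ws)))"
    by (simp only: list.map bracket map_omit length_map)
  finally show ?thesis
    using leibniz_bracket_cancel[OF form_of_alternating[OF \<xi>], of gs "\<pi> g" ?ws B]
    by (simp only: of_form_def add.assoc add_0_right)
qed

lemma smooth_family_const_add:
  assumes "smooth_family p \<Psi>" "smooth_family p \<Psi>'"
  shows "smooth_family p (\<lambda>gs g. \<Psi> gs g + \<Psi>' gs g)"
  by (rule smooth_familyI) (intro C_infinity_add smooth_familyD[OF assms(1)] smooth_familyD[OF assms(2)])

lemma smooth_family_scale:
  assumes "smooth_family p \<Psi>"
  shows "smooth_family p (\<lambda>gs g. r *\<^sub>R \<Psi> gs g)"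
  by (rule smooth_familyI) (intro C_infinity_scaleR C_infinity_const smooth_familyD[OF assms])

lemma smooth_family_sum:
  assumes "\<And>a. a \<in> A \<Longrightarrow> smooth_family p (\<Psi> a)"
  shows "smooth_family p (\<lambda>gs g. \<Sum>a\<in>A. \<Psi> a gs g)"
  by (rule smooth_familyI) (intro C_infinity_sum smooth_familyD[OF assms])

lemma d_CE_smooth:
  assumes \<xi>: "\<xi> \<in> D"
  shows "smooth_family p (\<lambda>gs g. d_CE G \<rho> \<xi> gs g Xs)"
proof -
  have "smooth_family p (\<lambda>gs g. left_deriv G (\<lambda>g'. \<rho> g' (\<xi> gs g Ys)) \<one> X)" for Ys X
    by (rule smooth_familyI) (rule C_infinity_linear[OF linear_rho_deriv], rule smooth_familyD[OF basicD(2)[OF \<xi>]])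
  then show ?thesis
    unfolding d_CE_def
    by (intro smooth_family_const_add smooth_family_sum smooth_family_scale smooth_family_left_deriv basicD(2)[OF \<xi>])
qed

lemma d_CE_basic:
  assumes \<xi>: "\<xi> \<in> D"
  shows "d_CE G \<rho> \<xi> \<in> D"
proof -
  have eq: "d_CE G \<rho> \<xi> = of_form G K \<rho> \<Phi> (dform \<xi>)"
    by (intro ext) (rule d_CE_dform[OF \<xi>])
  show ?thesis unfolding eq
  proof (rule of_form_basic)
    obtain N where N: "\<And>gs w ws. N < length gs + length ws \<Longrightarrow> fo \<xi> gs w ws = 0"
      by (rule form_of_bounded[OF \<xi>]) blast
    \<comment> \<open>The bound rises by one, since \<open>dform\<close> reads the form with one
      vector fewer.\<close>
    have "dform \<xi> gs w ws = 0" if "Suc N < length gs + length ws" for gs w ws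
      unfolding dform_def
    proof (rule sum.neutral, rule ballI)
      fix i assume "i \<in> {..<length ws}"
      then have "fo \<xi> gs w' (omit i ws) = 0" for w' using that by (intro N) (simp add: length_omit)
      then show "(- 1) ^ i *\<^sub>R dd (\<lambda>w. fo \<xi> gs w (omit i ws)) w (ws ! i) = 0" by (simp add: dd_def)
    qed
    then show "\<exists>N. \<forall>gs w ws. N < length gs + length ws \<longrightarrow> dform \<xi> gs w ws = 0" by blast
    show "alternating_multilinear (dform \<xi> gs w)" for gs w by (rule dform_alternating[OF \<xi>])
    show "smooth_family p (\<lambda>gs g. of_form G K \<rho> \<Phi> (dform \<xi>) gs g Xs)" for p Xs
      using d_CE_smooth[OF \<xi>] unfolding eq .
  qed
qed

text \<open>Each of the \<open>length Xs\<close> terms of the exterior derivative contributes the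
  fraction \<open>1 / length Xs\<close> of the same value, its sign being undone by alternation. The
  signs \<open>(- 1) ^ length gs\<close> of \<open>d\<close> and \<open>k\<close> cancel.\<close>

lemma d_op_k_op_on_K:
  assumes \<psi>: "\<psi> \<in> D" and k: "k \<in> K" and Xs: "Xs \<noteq> []"
  shows "d_op G \<rho> (k_op G K \<rho> \<Phi> \<psi>) gs k Xs = \<psi> gs k Xs"
proof -
  let ?ws = "map (d\<pi> k) Xs" and ?q = "length Xs"
  note alt = form_of_alternating[OF \<psi>]
  have fo_k: "fo (k_op G K \<rho> \<Phi> \<psi>) gs w ws = hform \<psi> gs w ws" for w ws
    unfolding k_op_hform by (rule form_of_of_form)
  have "dform (k_op G K \<rho> \<Phi> \<psi>) gs 0 ?ws = (\<Sum>i<?q. ((- 1) ^ length gs / real ?q) *\<^sub>R fo \<psi> gs 0 ?ws)"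
    unfolding dform_def fo_k length_map
  proof (rule sum.cong[OF refl])
    fix i assume "i \<in> {..<?q}"
    then have i: "i < length ?ws" by simp
    have len: "real (length (omit i ?ws)) + 1 = real ?q"
      using i by (simp add: length_omit)
    show "(- 1) ^ i *\<^sub>R dd (\<lambda>w. hform \<psi> gs w (omit i ?ws)) 0 (?ws ! i) = ((- 1) ^ length gs / real ?q) *\<^sub>R fo \<psi> gs 0 ?ws"
      unfolding hform_derivative_0[OF \<psi>] len alternating_nth_omit[OF alt i]
      by (simp add: minus_one_power_iff)
  qed
  also have "\<dots> = (- 1) ^ length gs *\<^sub>R fo \<psi> gs 0 ?ws" using Xs by (simp add: sum_constant_scaleR)
  finally have "d_op G \<rho> (k_op G K \<rho> \<Phi> \<psi>) gs k Xs = \<rho> (inv k) (fo \<psi> gs (\<pi> k) ?ws)"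
    unfolding d_op_def d_CE_dform[OF k_op_basic[OF \<psi>]] of_form_def
    by (simp add: k linear_scale[OF rho_linear] flip: power_add mult_2 power_mult)
  then show ?thesis by (simp add: form_of_eq[OF \<psi>])
qed

end

section \<open>The van Est maps\<close>

lemma alternating_zero: "alternating_multilinear (\<lambda>Xs. 0)"
  by (simp add: alternating_multilinear_def linear_zero)

lemma alternating_add:
  "alternating_multilinear \<alpha> \<Longrightarrow> alternating_multilinear \<beta> \<Longrightarrow> alternating_multilinear (\<lambda>Xs. \<alpha> Xs + \<beta> Xs)"
  by (simp add: alternating_multilinear_def linear_compose_add)

lemma alternating_scale:
  "alternating_multilinear \<alpha> \<Longrightarrow> alternating_multilinear (\<lambda>Xs. r *\<^sub>R \<alpha> Xs)"
  by (simp add: alternating_multilinear_def linear_compose_scale_right)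

lemma alternating_sum:
  "(\<And>a. a \<in> A \<Longrightarrow> alternating_multilinear (\<alpha> a)) \<Longrightarrow> alternating_multilinear (\<lambda>Xs. \<Sum>a\<in>A. \<alpha> a Xs)"
  by (induction A rule: infinite_finite_induct) (simp_all add: alternating_zero alternating_add)

lemma length_merge_at: "1 \<le> i \<Longrightarrow> i < length gs \<Longrightarrow> length (merge_at G i gs) = length gs - 1"
  by (simp add: merge_at_def)

text \<open>Every term of the coboundary reads a list exactly one shorter; this drives the degree
  arguments below.\<close>

lemma delta_op_cong:
  assumes "\<And>gs' g. length gs' = length gs - 1 \<Longrightarrow> \<psi> gs' g Xs = \<psi>' gs' g Xs"
  shows "delta_op G \<psi> gs g Xs = delta_op G \<psi>' gs g Xs"
proof (cases "gs = []")
  case False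
  have "(\<Sum>i=1..length gs - 1. (- 1) ^ i *\<^sub>R \<psi> (merge_at G i gs) g Xs) =
      (\<Sum>i=1..length gs - 1. (- 1) ^ i *\<^sub>R \<psi>' (merge_at G i gs) g Xs)"
  proof (rule sum.cong[OF refl])
    fix i assume "i \<in> {1..length gs - 1}"
    then have "1 \<le> i" "i < length gs" using False by (auto simp: le_less_trans)
    from assms[OF length_merge_at[OF this]]
    show "(- 1) ^ i *\<^sub>R \<psi> (merge_at G i gs) g Xs = (- 1) ^ i *\<^sub>R \<psi>' (merge_at G i gs) g Xs" by simp
  qed
  then show ?thesis using assms[of "tl gs"] assms[of "butlast gs"] by (simp add: delta_op_def Let_def)
qed (simp add: delta_op_def)

lemma nth_map_upt_list: "length gs = k \<Longrightarrow> (\<And>i. i < k \<Longrightarrow> gs ! i = f i) \<Longrightarrow> gs = map f [0..<k]"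
  by (rule nth_equalityI) simp_all

lemma normalized_Haar_measureD:
  assumes "normalized_Haar_measure G K \<mu>"
  shows "space \<mu> = K" "measure \<mu> (space \<mu>) = 1"
proof -
  show "space \<mu> = K"
    using assms sets_eq_imp_space_eq[of \<mu> "restrict_space borel K"]
    by (simp add: normalized_Haar_measure_def space_restrict_space)
  then show "measure \<mu> (space \<mu>) = 1" using assms by (simp add: normalized_Haar_measure_def measure_def)
qed

context lie_group_calculus
begin

lemma smooth_family_cong:
  assumes "\<And>gs g. length gs = p \<Longrightarrow> \<Psi> gs g = \<Psi>' gs g"
  shows "smooth_family p \<Psi> \<longleftrightarrow> smooth_family p \<Psi>'"
  unfolding smooth_family_def by (rule smooth_map_cong) (simp add: assms)

lemma delta_op_smooth:
  assumes \<psi>: "\<And>q. smooth_family q (\<lambda>gs g. \<psi> gs g Xs)"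
  shows "smooth_family p (\<lambda>gs g. delta_op G \<psi> gs g Xs)"
proof (rule smooth_familyI)
  fix S :: "(nat \<Rightarrow> 'e) set" and cs :: "nat \<Rightarrow> (nat \<Rightarrow> 'e) \<Rightarrow> 'g" and c
  assume S: "open S" and cs: "\<And>i. i < p \<Longrightarrow> gplot (p + 1) S (cs i)" and c: "gplot (p + 1) S c"
  show "C_infinity (p + 1) S (\<lambda>x. delta_op G \<psi> (map (\<lambda>i. cs i x) [0..<p]) (c x) Xs)"
  proof (cases p)
    case 0
    then show ?thesis by (simp add: delta_op_def)
  next
    case (Suc q)
    let ?gs = "\<lambda>x. map (\<lambda>i. cs i x) [0..<p]"
    \<comment> \<open>The entries of the list after merging positions \<open>i - 1\<close> and
      \<open>i\<close>, each as a plot.\<close>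
    define ms where "ms i j x = (if j < i - 1 then cs j x else if j = i - 1 then cs (i - 1) x \<otimes> cs i x else cs (Suc j) x)" for i j x
    have tl: "tl (?gs x) = map (\<lambda>i. cs (Suc i) x) [0..<q]" for x
      by (rule nth_map_upt_list) (simp_all add: Suc nth_tl del: upt_Suc)
    have butlast: "butlast (?gs x) = map (\<lambda>i. cs i x) [0..<q]" for x by (simp add: Suc)
    have last: "last (?gs x) = cs q x" for x by (simp add: Suc)
    have merge: "merge_at G i (?gs x) = map (\<lambda>j. ms i j x) [0..<q]" if "i \<in> {1..q}" for i x
    proof (rule nth_map_upt_list)
      show "length (merge_at G i (?gs x)) = q" using that length_merge_at[of i "?gs x"] by (simp add: Suc)
      fix j assume "j < q"
      then show "merge_at G i (?gs x) ! j = ms i j x"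
        using that by (auto simp: merge_at_def ms_def nth_append nth_Cons' Suc min_def simp del: upt_Suc)
    qed
    have ms: "gplot (p + 1) S (ms i j)" if "i \<in> {1..q}" "j < q" for i j
    proof -
      have lt: "j < p" "i - 1 < p" "i < p" "Suc j < p" using that by (auto simp: Suc)
      note plots = cs[OF lt(1)] cs[OF lt(2)] cs[OF lt(3)] cs[OF lt(4)]
      consider "j < i - 1" | "j = i - 1" | "i - 1 < j" by linarith
      then show ?thesis
        unfolding ms_def using plots gplot_mult[OF plots(2,3)] by cases simp_all
    qed
    have eq: "delta_op G \<psi> (?gs x) (c x) Xs = \<psi> (map (\<lambda>i. cs (Suc i) x) [0..<q]) (c x) Xs
        + (\<Sum>i=1..q. (- 1) ^ i *\<^sub>R \<psi> (map (\<lambda>j. ms i j x) [0..<q]) (c x) Xs)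
        + (- 1) ^ (q + 1) *\<^sub>R \<psi> (map (\<lambda>i. cs i x) [0..<q]) (cs q x \<otimes> c x) Xs" for x
    proof -
      have ne: "?gs x \<noteq> []" "length (?gs x) - 1 = q" by (simp_all add: Suc)
      have "(\<Sum>i=1..q. (- 1) ^ i *\<^sub>R \<psi> (merge_at G i (?gs x)) (c x) Xs) =
          (\<Sum>i=1..q. (- 1) ^ i *\<^sub>R \<psi> (map (\<lambda>j. ms i j x) [0..<q]) (c x) Xs)"
        by (rule sum.cong[OF refl]) (simp only: merge)
      then show ?thesis
        unfolding delta_op_def Let_def ne(2) tl butlast last if_not_P[OF ne(1)] by (simp only:)
    qed
    show ?thesis unfolding eq
    proof (intro C_infinity_add C_infinity_sum C_infinity_scaleR C_infinity_const)
      show "C_infinity (p + 1) S (\<lambda>x. \<psi> (map (\<lambda>i. cs (Suc i) x) [0..<q]) (c x) Xs)"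
        by (rule smooth_familyD[OF \<psi> cs c]) (simp add: Suc)
      show "C_infinity (p + 1) S (\<lambda>x. \<psi> (map (\<lambda>j. ms i j x) [0..<q]) (c x) Xs)" if "i \<in> {1..q}" for i
        by (rule smooth_familyD[OF \<psi> ms c]) (use that in simp_all)
      show "C_infinity (p + 1) S (\<lambda>x. \<psi> (map (\<lambda>i. cs i x) [0..<q]) (cs q x \<otimes> c x) Xs)"
        by (rule smooth_familyD[OF \<psi> cs gplot_mult[OF cs c]]) (simp_all add: Suc)
    qed
  qed
qed

lemma left_deriv_minus: "smooth_fn F \<Longrightarrow> left_deriv G (\<lambda>g. - F g) g X = - left_deriv G F g X"
  unfolding left_deriv_def[of G "\<lambda>g. - F g"]
  by (rule vector_derivative_at) (rule has_vector_derivative_minus, rule left_deriv_tangent_curve)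

end

section \<open>Closure of the basic cochains under the operators\<close>

context homogeneous
begin

text \<open>Invariance survives because \<open>K\<close> acts on the last argument from the right,
  while the coboundary multiplies it from the left.\<close>

lemma delta_basic:
  assumes \<psi>: "\<psi> \<in> D"
  shows "delta_op G \<psi> \<in> D"
proof (rule basicI)
  obtain N where N: "\<And>gs g Xs. N < length gs + length Xs \<Longrightarrow> \<psi> gs g Xs = 0" using basicD(5)[OF \<psi>] by blast
  have zero: "delta_op G (\<lambda>_ _ _. 0 :: 'v) gs g Xs = 0" for gs g and Xs :: "'e list"
    by (simp add: delta_op_def)
  have "delta_op G \<psi> gs g Xs = 0" if "Suc N < length gs + length Xs" for gs g Xs
    using delta_op_cong[of gs \<psi> Xs "\<lambda>_ _ _. 0" G g] N that zero by fastforce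
  then show "\<exists>N. \<forall>gs g Xs. N < length gs + length Xs \<longrightarrow> delta_op G \<psi> gs g Xs = 0" by blast
  show "alternating_multilinear (delta_op G \<psi> gs g)" for gs g
  proof (cases "gs = []")
    case False
    then have eq: "delta_op G \<psi> gs g = (\<lambda>Xs. \<psi> (tl gs) g Xs
       + (\<Sum>i=1..length gs - 1. (- 1) ^ i *\<^sub>R \<psi> (merge_at G i gs) g Xs)
       + (- 1) ^ (length gs - 1 + 1) *\<^sub>R \<psi> (butlast gs) (last gs \<otimes> g) Xs)"
      by (intro ext) (simp only: delta_op_def Let_def False if_False)
    show ?thesis unfolding eq
      by (intro alternating_add alternating_sum alternating_scale basicD(1)[OF \<psi>])
  qed (simp add: delta_op_def[abs_def] alternating_zero)
  show "smooth_family p (\<lambda>gs g. delta_op G \<psi> gs g Xs)" for p Xs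
    by (rule delta_op_smooth) (rule basicD(2)[OF \<psi>])
  show "delta_op G \<psi> gs g (X # Xs) = 0" if "X \<in> \<kk>" for X gs g Xs
    by (simp add: delta_op_def Let_def basicD(3)[OF \<psi> that])
  show "\<rho> a (delta_op G \<psi> gs (g \<otimes> a) (map (Ad G (inv a)) Xs)) = delta_op G \<psi> gs g Xs" if a: "a \<in> K" for a gs g Xs
  proof -
    have "\<rho> a (\<psi> hs (h \<otimes> (g \<otimes> a)) (map (Ad G (inv a)) Xs)) = \<psi> hs (h \<otimes> g) Xs" for hs h
      using basicD(4)[OF \<psi> a, of hs "h \<otimes> g" Xs] by (simp add: m_assoc)
    then show ?thesis
      by (simp add: delta_op_def Let_def linear_0[OF rho_linear] linear_add[OF rho_linear]
          linear_sum[OF rho_linear] linear_scale[OF rho_linear] linear_diff[OF rho_linear] linear_neg[OF rho_linear] basicD(4)[OF \<psi> a])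
  qed
qed

text \<open>The factor may depend on the number of group arguments, since smoothness is a condition
  for each number separately; this covers the sign in \<open>d_op\<close>.\<close>

lemma basic_scale:
  fixes r :: "nat \<Rightarrow> real"
  assumes \<psi>: "\<psi> \<in> D"
  shows "(\<lambda>gs g Xs. r (length gs) *\<^sub>R \<psi> gs g Xs) \<in> D"
proof (rule basicI)
  show "\<exists>N. \<forall>gs g Xs. N < length gs + length Xs \<longrightarrow> r (length gs) *\<^sub>R \<psi> gs g Xs = 0"
    using basicD(5)[OF \<psi>] by auto
  show "alternating_multilinear (\<lambda>Xs. r (length gs) *\<^sub>R \<psi> gs g Xs)" for gs g
    by (rule alternating_scale[OF basicD(1)[OF \<psi>]])
  show "smooth_family p (\<lambda>gs g. r (length gs) *\<^sub>R \<psi> gs g Xs)" for p Xs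
    using smooth_family_scale[OF basicD(2)[OF \<psi>], of p "r p" Xs]
    by (subst smooth_family_cong[where \<Psi>' = "\<lambda>gs g. r p *\<^sub>R \<psi> gs g Xs"]) simp_all
qed (simp_all add: basicD(3)[OF \<psi>] linear_scale[OF rho_linear] basicD(4)[OF \<psi>])

lemma basic_minus: "\<psi> \<in> D \<Longrightarrow> (\<lambda>gs g Xs. - \<psi> gs g Xs) \<in> D"
  using basic_scale[of \<psi> "\<lambda>_. - 1"] by simp

lemma basic_add:
  assumes "\<psi> \<in> D" "\<psi>' \<in> D"
  shows "(\<lambda>gs g Xs. \<psi> gs g Xs + \<psi>' gs g Xs) \<in> D"
proof (rule basicI)
  obtain N N' where N: "\<And>gs g Xs. N < length gs + length Xs \<Longrightarrow> \<psi> gs g Xs = 0"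
    "\<And>gs g Xs. N' < length gs + length Xs \<Longrightarrow> \<psi>' gs g Xs = 0"
    using basicD(5)[OF assms(1)] basicD(5)[OF assms(2)] by blast
  then show "\<exists>N. \<forall>gs g Xs. N < length gs + length Xs \<longrightarrow> \<psi> gs g Xs + \<psi>' gs g Xs = 0"
    by (intro exI[of _ "max N N'"]) simp
  show "alternating_multilinear (\<lambda>Xs. \<psi> gs g Xs + \<psi>' gs g Xs)" for gs g
    by (intro alternating_add basicD(1)[OF assms(1)] basicD(1)[OF assms(2)])
  show "smooth_family p (\<lambda>gs g. \<psi> gs g Xs + \<psi>' gs g Xs)" for p Xs
    by (intro smooth_family_const_add basicD(2)[OF assms(1)] basicD(2)[OF assms(2)])
qed (simp_all add: basicD(3)[OF assms(1)] basicD(3)[OF assms(2)] linear_add[OF rho_linear]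
    basicD(4)[OF assms(1)] basicD(4)[OF assms(2)])

lemma d_op_basic: "\<psi> \<in> D \<Longrightarrow> d_op G \<rho> \<psi> \<in> D"
  unfolding d_op_def[abs_def] by (rule basic_scale[OF d_CE_basic])

section \<open>Degree shifts and injectivity of the perturbed identities\<close>

lemma form_of_cong:
  assumes "\<And>g Zs. length Zs = length ws \<Longrightarrow> \<psi> gs g Zs = \<psi>' gs g Zs"
  shows "fo \<psi> gs w ws = fo \<psi>' gs w ws"
proof -
  have "\<pi> g = w \<and> map (d\<pi> g) Xs = ws \<and> v = \<rho> g (\<psi> gs g Xs) \<longleftrightarrow>
      \<pi> g = w \<and> map (d\<pi> g) Xs = ws \<and> v = \<rho> g (\<psi>' gs g Xs)" for g Xs v
  proof (cases "map (d\<pi> g) Xs = ws")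
    case True
    then have "length Xs = length ws" by auto
    then show ?thesis by (simp add: assms)
  qed simp
  then show ?thesis by (simp only: form_of_def)
qed

text \<open>Values of \<open>k\<close> on \<open>q\<close> vectors depend only on the component with
  \<open>q + 1\<close> vectors and the same group arguments.\<close>

lemma k_op_cong:
  assumes "\<And>g Zs. length Zs = Suc (length Xs) \<Longrightarrow> \<psi> gs g Zs = \<psi>' gs g Zs"
  shows "k_op G K \<rho> \<Phi> \<psi> gs g Xs = k_op G K \<rho> \<Phi> \<psi>' gs g Xs"
proof -
  have "fo \<psi> gs w ws = fo \<psi>' gs w ws" if "length ws = Suc (length Xs)" for w ws
    by (rule form_of_cong) (simp add: assms that)
  then show ?thesis by (simp add: k_op_def of_form_def homotopy_op_def)
qed

lemma zero_basic: "(\<lambda>_ _ _. 0) \<in> D"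
proof (rule basicI)
  show "smooth_family p (\<lambda>gs g. 0 :: 'v)" for p by (rule smooth_familyI) simp
qed (simp_all add: alternating_zero linear_0[OF rho_linear])

lemma k_op_zero: "k_op G K \<rho> \<Phi> (\<lambda>_ _ _. 0) gs g Xs = 0"
proof -
  have "fo (\<lambda>_ _ _. 0) gs w ws = 0" for w ws
  proof -
    obtain g where g: "\<pi> g = w" by (rule pi_surj)
    obtain Xs where Xs: "map (d\<pi> g) Xs = ws" by (rule vectors_surj)
    show ?thesis using form_of_eq[OF zero_basic, of gs g Xs] g Xs by (simp add: linear_0[OF rho_linear])
  qed
  then show ?thesis by (simp add: k_op_def of_form_def homotopy_op_def linear_0[OF rho_linear])
qed

text \<open>The component with \<open>q\<close> vectors is determined by the right-hand side and the
  component with \<open>q + 1\<close> vectors. Both cochains vanish for many vectors, so equality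
  descends; \<open>d\<close> counts the distance from the bound.\<close>

lemma perturbation_k_inj: "inj_on (\<lambda>\<psi> gs g Xs. \<psi> gs g Xs + delta_op G (k_op G K \<rho> \<Phi> \<psi>) gs g Xs) D"
proof (rule inj_onI)
  fix \<psi> \<psi>' assume \<psi>: "\<psi> \<in> D" "\<psi>' \<in> D"
    and eq: "(\<lambda>gs g Xs. \<psi> gs g Xs + delta_op G (k_op G K \<rho> \<Phi> \<psi>) gs g Xs) =
      (\<lambda>gs g Xs. \<psi>' gs g Xs + delta_op G (k_op G K \<rho> \<Phi> \<psi>') gs g Xs)"
  obtain N N' where N: "\<And>gs g Xs. N < length gs + length Xs \<Longrightarrow> \<psi> gs g Xs = 0"
    "\<And>gs g Xs. N' < length gs + length Xs \<Longrightarrow> \<psi>' gs g Xs = 0"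
    using basicD(5)[OF \<psi>(1)] basicD(5)[OF \<psi>(2)] by blast
  have "\<psi> gs g Xs = \<psi>' gs g Xs" if "max N N' < length Xs + d" for d gs g Xs
    using that
  proof (induction d arbitrary: gs g Xs)
    case 0
    then show ?case by (simp add: N)
  next
    case (Suc d)
    have "delta_op G (k_op G K \<rho> \<Phi> \<psi>) gs g Xs = delta_op G (k_op G K \<rho> \<Phi> \<psi>') gs g Xs"
      by (intro delta_op_cong k_op_cong Suc.IH) (use Suc.prems in simp)
    then show ?case using fun_cong[OF fun_cong[OF fun_cong[OF eq, of gs], of g], of Xs] by simp
  qed
  note eq_if = this
  \<comment> \<open>Unification takes \<open>d\<close> to be \<open>Suc (max N N')\<close>, which
    suffices for every length.\<close>
  show "\<psi> = \<psi>'"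
    by (intro ext) (rule eq_if, rule trans_less_add2, rule lessI)
qed

lemma d_op_cong: "\<psi> gs = \<psi>' gs \<Longrightarrow> d_op G \<rho> \<psi> gs g Xs = d_op G \<rho> \<psi>' gs g Xs"
  by (simp add: d_op_def d_CE_def)

text \<open>The same descent in the number of group arguments: \<open>h\<close> reads one group
  argument more, and \<open>d\<close> leaves their number unchanged.\<close>

lemma perturbation_h_inj: "inj_on (\<lambda>\<psi> gs g Xs. \<psi> gs g Xs + d_op G \<rho> (h_op G \<mu> \<psi>) gs g Xs) D"
proof (rule inj_onI)
  fix \<psi> \<psi>' assume \<psi>: "\<psi> \<in> D" "\<psi>' \<in> D"
    and eq: "(\<lambda>gs g Xs. \<psi> gs g Xs + d_op G \<rho> (h_op G \<mu> \<psi>) gs g Xs) =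
      (\<lambda>gs g Xs. \<psi>' gs g Xs + d_op G \<rho> (h_op G \<mu> \<psi>') gs g Xs)"
  obtain N N' where N: "\<And>gs g Xs. N < length gs + length Xs \<Longrightarrow> \<psi> gs g Xs = 0"
    "\<And>gs g Xs. N' < length gs + length Xs \<Longrightarrow> \<psi>' gs g Xs = 0"
    using basicD(5)[OF \<psi>(1)] basicD(5)[OF \<psi>(2)] by blast
  have "\<psi> gs g Xs = \<psi>' gs g Xs" if "max N N' < length gs + d" for d gs g Xs
    using that
  proof (induction d arbitrary: gs g Xs)
    case 0
    then show ?case by (simp add: N)
  next
    case (Suc d)
    have "\<psi> (gs @ [h]) g Xs = \<psi>' (gs @ [h]) g Xs" for h g Xs
      using Suc.prems by (intro Suc.IH) simp
    then have "h_op G \<mu> \<psi> gs = h_op G \<mu> \<psi>' gs" by (intro ext) (simp add: h_op_def)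
    then have "d_op G \<rho> (h_op G \<mu> \<psi>) gs g Xs = d_op G \<rho> (h_op G \<mu> \<psi>') gs g Xs" by (rule d_op_cong)
    then show ?case using fun_cong[OF fun_cong[OF fun_cong[OF eq, of gs], of g], of Xs] by simp
  qed
  note eq_if = this
  show "\<psi> = \<psi>'"
    by (intro ext) (rule eq_if, rule trans_less_add2, rule lessI)
qed

lemma d_op_minus:
  assumes \<psi>: "\<psi> \<in> D"
  shows "d_op G \<rho> (\<lambda>gs g Xs. - \<psi> gs g Xs) gs g Xs = - d_op G \<rho> \<psi> gs g Xs"
proof -
  have "left_deriv G (\<lambda>g'. - \<psi> gs g' Ys) g X = - left_deriv G (\<lambda>g'. \<psi> gs g' Ys) g X" for Ys X
    by (rule left_deriv_minus[OF smooth_family_fix[OF basicD(2)[OF \<psi>] refl]])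
  moreover have "left_deriv G (\<lambda>g'. \<rho> g' (- v)) \<one> X = - left_deriv G (\<lambda>g'. \<rho> g' v) \<one> X" for v X
    unfolding linear_neg[OF rho_linear] by (rule left_deriv_minus[OF rho_smooth_fn])
  ultimately have "d_CE G \<rho> (\<lambda>gs g Xs. - \<psi> gs g Xs) gs g Xs = - d_CE G \<rho> \<psi> gs g Xs"
    by (simp add: d_CE_def sum_negf[symmetric] scaleR_diff_right scaleR_add_right)
  then show ?thesis by (simp add: d_op_def)
qed

text \<open>At points of \<open>K\<close>, all terms of \<open>\<delta>\<xi>\<close> but the last vanish.\<close>

lemma h_delta:
  assumes \<mu>: "normalized_Haar_measure G K \<mu>" and \<xi>: "\<And>gs k Xs. k \<in> K \<Longrightarrow> \<xi> gs k Xs = 0"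
  shows "h_op G \<mu> (delta_op G \<xi>) gs g Xs = \<xi> gs g Xs"
proof -
  note space = normalized_Haar_measureD(1)[OF \<mu>]
  have "delta_op G \<xi> (gs @ [g \<otimes> inv k]) k Xs = (- 1) ^ (length gs + 1) *\<^sub>R \<xi> gs g Xs" if "k \<in> K" for k
    by (simp add: delta_op_def Let_def \<xi>[OF that] m_assoc)
  then have "(\<integral>k. delta_op G \<xi> (gs @ [g \<otimes> inv k]) k Xs \<partial>\<mu>) = (\<integral>k. (- 1) ^ (length gs + 1) *\<^sub>R \<xi> gs g Xs \<partial>\<mu>)"
    by (intro Bochner_Integration.integral_cong refl) (simp add: space)
  then show ?thesis by (simp add: h_op_def normalized_Haar_measureD(2)[OF \<mu>])
qed

lemma h_op_cong_K:
  assumes \<mu>: "normalized_Haar_measure G K \<mu>" and "\<And>gs k. k \<in> K \<Longrightarrow> \<psi> gs k Xs = \<psi>' gs k Xs"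
  shows "h_op G \<mu> \<psi> gs g Xs = h_op G \<mu> \<psi>' gs g Xs" "p_op \<mu> \<psi> Xs = p_op \<mu> \<psi>' Xs"
proof -
  note space = normalized_Haar_measureD(1)[OF \<mu>]
  show "h_op G \<mu> \<psi> gs g Xs = h_op G \<mu> \<psi>' gs g Xs" "p_op \<mu> \<psi> Xs = p_op \<mu> \<psi>' Xs"
    unfolding h_op_def p_op_def
    by (intro arg_cong[where f = "(*\<^sub>R) _"] Bochner_Integration.integral_cong refl, simp add: assms(2) space)+
qed

subsection \<open>The zigzag of a Lie algebra cochain\<close>

text \<open>The terms of the Neumann series of \<open>(1 + \<delta> k)\<close> inverse applied to
  \<open>i \<alpha>\<close>.\<close>

primrec zigzag :: "('e list \<Rightarrow> 'v) \<Rightarrow> nat \<Rightarrow> ('g, 'e, 'v) double_cochain"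
  where
    "zigzag \<alpha> 0 = i_op \<alpha>"
  | "zigzag \<alpha> (Suc p) = (\<lambda>gs g Xs. - delta_op G (k_op G K \<rho> \<Phi> (zigzag \<alpha> p)) gs g Xs)"

text \<open>The sum of the series: the term with index \<open>p\<close> contributes in
  \<open>p\<close> group arguments, so one term is selected by length instead of adding all.\<close>

definition zig :: "('e list \<Rightarrow> 'v) \<Rightarrow> ('g, 'e, 'v) double_cochain"
  where "zig \<alpha> gs = zigzag \<alpha> (length gs) gs"

context
  fixes \<alpha> :: "'e list \<Rightarrow> 'v"
  assumes \<alpha>: "\<alpha> \<in> lie_cochains_basic G \<rho> K"
begin

lemma \<alpha>_alternating: "alternating_multilinear \<alpha>"
  and \<alpha>_horizontal: "X \<in> \<kk> \<Longrightarrow> \<alpha> (X # Xs) = 0"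
  and \<alpha>_invariant: "a \<in> K \<Longrightarrow> \<rho> a (\<alpha> (map (Ad G (inv a)) Xs)) = \<alpha> Xs"
  and \<alpha>_bounded: "\<exists>N. \<forall>Xs. N < length Xs \<longrightarrow> \<alpha> Xs = 0"
  using \<alpha> unfolding lie_cochains_basic_def by blast+

lemma i_op_basic: "i_op \<alpha> \<in> D"
proof (rule basicI)
  obtain N where "\<And>Xs. N < length Xs \<Longrightarrow> \<alpha> Xs = 0" using \<alpha>_bounded by blast
  then show "\<exists>N. \<forall>gs g Xs. N < length gs + length Xs \<longrightarrow> i_op \<alpha> gs (g :: 'g) Xs = 0"
    by (intro exI[of _ N]) (simp add: i_op_def)
  show "alternating_multilinear (i_op \<alpha> gs g)" for gs and g :: 'g
    by (cases "gs = []") (simp_all add: i_op_def[abs_def] \<alpha>_alternating alternating_zero)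
  show "smooth_family p (\<lambda>gs g. i_op \<alpha> gs g Xs)" for p Xs
    by (rule smooth_familyI) (simp add: i_op_def)
qed (simp_all add: i_op_def \<alpha>_horizontal \<alpha>_invariant linear_0[OF rho_linear])

lemma zigzag_basic: "zigzag \<alpha> p \<in> D"
  by (induction p) (simp_all add: i_op_basic basic_minus delta_basic k_op_basic)

lemma zig_basic: "zig \<alpha> \<in> D"
proof (rule basicI)
  obtain N where N: "\<And>Xs. N < length Xs \<Longrightarrow> \<alpha> Xs = 0" using \<alpha>_bounded by blast
  \<comment> \<open>Total degree is preserved, as each step trades one vector for one group
    argument; the bound for \<alpha> therefore serves for all terms.\<close>
  have "zigzag \<alpha> p gs g Xs = 0" if "length gs = p" "N < p + length Xs" for p gs g Xs
    using that
  proof (induction p arbitrary: gs g Xs)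
    case 0
    then show ?case by (simp add: i_op_def N)
  next
    case (Suc p)
    have "k_op G K \<rho> \<Phi> (zigzag \<alpha> p) gs' g' Xs = k_op G K \<rho> \<Phi> (\<lambda>_ _ _. 0) gs' g' Xs" if "length gs' = p" for gs' g'
      by (rule k_op_cong) (use Suc that in simp)
    then have "delta_op G (k_op G K \<rho> \<Phi> (zigzag \<alpha> p)) gs g Xs = delta_op G (\<lambda>_ _ _. 0) gs g Xs"
      using Suc.prems(1) by (intro delta_op_cong) (simp add: k_op_zero)
    also have "\<dots> = 0" by (simp add: delta_op_def)
    finally show ?case by simp
  qed
  then show "\<exists>N. \<forall>gs g Xs. N < length gs + length Xs \<longrightarrow> zig \<alpha> gs g Xs = 0"
    by (intro exI[of _ N]) (simp add: zig_def)
  show "smooth_family p (\<lambda>gs g. zig \<alpha> gs g Xs)" for p Xs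
    using basicD(2)[OF zigzag_basic[of p], of p Xs]
    by (subst smooth_family_cong[where \<Psi>' = "\<lambda>gs g. zigzag \<alpha> p gs g Xs"]) (simp_all add: zig_def)
qed (simp_all add: zig_def basicD[OF zigzag_basic])

lemma zig_Nil: "zig \<alpha> [] g Xs = \<alpha> Xs"
  by (simp add: zig_def i_op_def)

lemma zig_delta:
  assumes "gs \<noteq> []"
  shows "zig \<alpha> gs g Xs = - delta_op G (k_op G K \<rho> \<Phi> (zig \<alpha>)) gs g Xs"
proof -
  obtain p where p: "length gs = Suc p" using assms by (cases gs) auto
  have "delta_op G (k_op G K \<rho> \<Phi> (zigzag \<alpha> p)) gs g Xs = delta_op G (k_op G K \<rho> \<Phi> (zig \<alpha>)) gs g Xs"
    by (intro delta_op_cong k_op_cong) (simp add: zig_def p)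
  then show ?thesis by (simp add: zig_def p)
qed

lemma zig_equation: "(\<lambda>gs g Xs. zig \<alpha> gs g Xs + delta_op G (k_op G K \<rho> \<Phi> (zig \<alpha>)) gs g Xs) = i_op \<alpha>"
proof (intro ext)
  fix gs g Xs
  show "zig \<alpha> gs g Xs + delta_op G (k_op G K \<rho> \<Phi> (zig \<alpha>)) gs g Xs = i_op \<alpha> gs g Xs"
    by (cases "gs = []") (simp_all add: zig_Nil zig_delta i_op_def delta_op_def)
qed

lemma R_eq: "R G K \<rho> \<Phi> \<alpha> gs = zig \<alpha> gs \<one> []"
proof -
  have "inv_into D (\<lambda>\<psi> gs g Xs. \<psi> gs g Xs + delta_op G (k_op G K \<rho> \<Phi> \<psi>) gs g Xs) (i_op \<alpha>) = zig \<alpha>"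
    using inv_into_f_f[OF perturbation_k_inj zig_basic] by (simp only: zig_equation)
  then have "R G K \<rho> \<Phi> \<alpha> gs = fo (zig \<alpha>) gs (\<pi> \<one>) (map (d\<pi> \<one>) [])"
    by (simp add: R_def q_op_def)
  also have "\<dots> = zig \<alpha> gs \<one> []" unfolding form_of_eq[OF zig_basic] by simp
  finally show ?thesis .
qed

lemma R_cochain: "R G K \<rho> \<Phi> \<alpha> \<in> group_cochains G"
proof -
  obtain N where N: "\<And>gs g Xs. N < length gs + length Xs \<Longrightarrow> zig \<alpha> gs g Xs = 0" using basicD(5)[OF zig_basic] by blast
  have "smooth_map (charts G) vector_atlas p (R G K \<rho> \<Phi> \<alpha>)" for p
    unfolding R_eq[abs_def]
    by (rule smooth_mapI[OF atlas]) (rule smooth_familyD[OF basicD(2)[OF zig_basic] _ plot_const])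
  moreover have "\<exists>N. \<forall>gs. N < length gs \<longrightarrow> R G K \<rho> \<Phi> \<alpha> gs = 0"
    by (intro exI[of _ N]) (simp add: R_eq N)
  ultimately show ?thesis by (simp add: group_cochains_def)
qed

text \<open>A summand of \<open>zag\<close>, which must lie in \<open>D\<close> for
  \<open>inv_into\<close> to return it.\<close>

lemma j_op_R_basic: "j_op G \<rho> (R G K \<rho> \<Phi> \<alpha>) \<in> D"
proof (rule basicI)
  let ?f = "R G K \<rho> \<Phi> \<alpha>"
  obtain N where N: "\<And>gs. N < length gs \<Longrightarrow> ?f gs = 0"
    and f: "\<And>p. smooth_map (charts G) vector_atlas p ?f"
    using R_cochain unfolding group_cochains_def by blast
  show "\<exists>N. \<forall>gs g Xs. N < length gs + length Xs \<longrightarrow> j_op G \<rho> ?f gs g (Xs :: 'e list) = 0"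
    by (intro exI[of _ N]) (simp add: j_op_def N linear_0[OF rho_linear])
  show "alternating_multilinear (j_op G \<rho> ?f gs g :: 'e list \<Rightarrow> 'v)" for gs g
    by (auto simp: alternating_multilinear_def j_op_def linear_zero)
  show "smooth_family p (\<lambda>gs g. j_op G \<rho> ?f gs g (Xs :: 'e list))" for p Xs
  proof (rule smooth_familyI)
    fix S :: "(nat \<Rightarrow> 'e) set" and cs :: "nat \<Rightarrow> (nat \<Rightarrow> 'e) \<Rightarrow> 'g" and c
    assume S: "open S" and cs: "\<And>i. i < p \<Longrightarrow> gplot (p + 1) S (cs i)" and c: "gplot (p + 1) S c"
    have "C_infinity (p + 1) S (\<lambda>x. ?f (map (\<lambda>i. cs i x) [0..<p]))"
      using smooth_map_plot[OF atlas smooth_atlas_vector f S cs] by (simp add: plot_vector)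
    from rho_C_infinity[OF gplot_inv[OF c] this]
    show "C_infinity (p + 1) S (\<lambda>x. j_op G \<rho> ?f (map (\<lambda>i. cs i x) [0..<p]) (c x) Xs)"
      by (cases "Xs = []") (simp_all add: j_op_def)
  qed
  show "\<rho> a (j_op G \<rho> ?f gs (g \<otimes> a) (map (Ad G (inv a)) Xs)) = j_op G \<rho> ?f gs g Xs" if "a \<in> K" for a gs g Xs
  proof -
    have "a \<otimes> inv (g \<otimes> a) = inv g" by (simp add: inv_mult_group flip: m_assoc)
    then show ?thesis by (simp add: j_op_def linear_0[OF rho_linear] rho_mult[symmetric])
  qed
qed (simp add: j_op_def)

text \<open>The cochain called \<phi> in the overview: a closed formula for the inverse of
  \<open>1 + d h\<close> on \<open>j f\<close>, in place of its Neumann series.\<close>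

definition zag :: "('g, 'e, 'v) double_cochain"
  where "zag gs g Xs = j_op G \<rho> (R G K \<rho> \<Phi> \<alpha>) gs g Xs + d_op G \<rho> (k_op G K \<rho> \<Phi> (zig \<alpha>)) gs g Xs"

lemma zag_basic: "zag \<in> D"
  unfolding zag_def[abs_def] by (intro basic_add j_op_R_basic d_op_basic k_op_basic zig_basic)

lemma zag_on_K:
  assumes k: "k \<in> K"
  shows "zag gs k Xs = zig \<alpha> gs k Xs"
proof (cases "Xs = []")
  case True
  \<comment> \<open>Without vectors the \<open>d\<close> term is an empty sum. What remains is the
    value of \<open>zig\<close> at the unit, which \<open>K\<close>-invariance carries to
    \<open>k\<close>.\<close>
  have "\<rho> (inv k) (zig \<alpha> gs \<one> []) = zig \<alpha> gs k []"
    using basicD(4)[OF zig_basic k, of gs \<one> "[]"] by (metis in_carrier l_one list.map(1) rho_inv(2))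
  then show ?thesis by (simp add: zag_def j_op_def R_eq d_op_def d_CE_def True)
next
  case False
  then show ?thesis by (simp add: zag_def j_op_def d_op_k_op_on_K[OF zig_basic k])
qed

lemma VE_R_eq:
  assumes \<mu>: "normalized_Haar_measure G K \<mu>"
  shows "VE G K \<rho> \<mu> (R G K \<rho> \<Phi> \<alpha>) = \<alpha>"
proof -
  let ?\<xi> = "k_op G K \<rho> \<Phi> (zig \<alpha>)"
  have "h_op G \<mu> zag gs g Xs = - ?\<xi> gs g Xs" for gs g Xs
  proof -
    have "h_op G \<mu> zag gs g Xs = h_op G \<mu> (zig \<alpha>) gs g Xs"
      by (rule h_op_cong_K(1)[OF \<mu> zag_on_K])
    \<comment> \<open>\<open>h\<close> appends a group argument, so \<open>zig\<close> is read at
      nonempty lists only, where it equals minus the coboundary.\<close>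
    also have "\<dots> = - h_op G \<mu> (delta_op G ?\<xi>) gs g Xs"
      by (simp add: h_op_def zig_delta)
    also have "\<dots> = - ?\<xi> gs g Xs"
      by (simp only: h_delta[where \<xi> = ?\<xi>, OF \<mu> k_op_on_K[OF zig_basic]])
    finally show ?thesis .
  qed
  then have h: "h_op G \<mu> zag = (\<lambda>gs g Xs. - ?\<xi> gs g Xs)" by (intro ext)
  have "(\<lambda>gs g Xs. zag gs g Xs + d_op G \<rho> (h_op G \<mu> zag) gs g Xs) = j_op G \<rho> (R G K \<rho> \<Phi> \<alpha>)"
    unfolding h by (intro ext) (simp add: d_op_minus[OF k_op_basic[OF zig_basic]] zag_def)
  then have "inv_into D (\<lambda>\<psi> gs g Xs. \<psi> gs g Xs + d_op G \<rho> (h_op G \<mu> \<psi>) gs g Xs) (j_op G \<rho> (R G K \<rho> \<Phi> \<alpha>)) = zag"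
    using inv_into_f_f[OF perturbation_h_inj[of \<mu>] zag_basic] by simp
  then have "VE G K \<rho> \<mu> (R G K \<rho> \<Phi> \<alpha>) Xs = p_op \<mu> (zig \<alpha>) Xs" for Xs
    by (simp add: VE_def h_op_cong_K(2)[OF \<mu> zag_on_K])
  \<comment> \<open>Without group arguments \<open>zig\<close> is the constant \<alpha>, and \<mu>
    has total mass 1.\<close>
  moreover have "p_op \<mu> (zig \<alpha>) Xs = \<alpha> Xs" for Xs
    by (simp add: p_op_def zig_Nil normalized_Haar_measureD(2)[OF \<mu>])
  ultimately show ?thesis by (intro ext) simp
qed

end

end

theorem proposition3p4:
  fixes G :: "('g::{t2_space, second_countable_topology}, 'e::fin_dim_space) smooth_group"
    and K :: "'g set"
    and \<rho> :: "'g \<Rightarrow> 'v::fin_dim_space \<Rightarrow> 'v"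
    and \<mu> :: "'g measure"
    and pr :: "'e \<Rightarrow> 'w::fin_dim_space"
    and \<Phi> :: "'g set \<Rightarrow> 'w"
  assumes "lie_group G"
    and "finite (components (UNIV :: 'g set))"
    and "maximal_compact_subgroup G K"
    and "smooth_representation G \<rho>"
    and "normalized_Haar_measure G K \<mu>"
    and "quotient_projection G K pr"
    and "homogeneous_space_diffeo G K \<Phi>"
    and "\<Phi> K = 0"
    and "\<alpha> \<in> lie_cochains_basic G \<rho> K"
  shows "R G K \<rho> \<Phi> \<alpha> \<in> group_cochains G \<and> VE G K \<rho> \<mu> (R G K \<rho> \<Phi> \<alpha>) = \<alpha>"
proof -
  interpret lie_group G by fact
  interpret homogeneous G K \<rho> pr \<Phi>
    by (intro homogeneous.intro lie_group_calculus.intro homogeneous_axioms.intro)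
      (use assms in \<open>simp_all add: maximal_compact_subgroup_def\<close>)
  show ?thesis using R_cochain[OF assms(9)] VE_R_eq[OF assms(9,5)] by blast
qed

end
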